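(* Let $k\ge0$ and $\Delta(T)=T_1\cdots T_n$. (1) For each $\eta\in\mathbb N_0^n$ there is $a_\eta\in\mathbb R$ such that $\Delta(T)E_\eta=a_\eta E_{\eta-\underline1}$ if $\eta_i\ge1$ for all $i$, and $\Delta(T)E_\eta=0$ (set $a_\eta=0$) if $\eta_i=0$ for some $i$. (2) The map $\eta\mapsto a_\eta$ is $\mathcal S_n$-invariant. (3) $\Delta(T)L_\eta=d_\eta L_{\eta-\underline1}$ for $\eta\in\mathbb N_0^n$ and $\Delta(T)C_\lambda=d_\lambda C_{\lambda-\underline1}$ for $\lambda\in\Lambda_n^+$, where $d_\eta=\frac{|\eta|!}{|\eta-\underline1|!}$ if $\eta_i\ne0$ for all $i$, and $d_\eta=0$ otherwise (the right-hand side being $0$ in that case). (4) Let $p\le q+1$, $\mu\in\mathbb C^p$, $\nu\in\mathbb C^q$ with $\nu_i\notin\{0,k,\dots,k(n-1)\}-\mathbb N_0$ for all $i$, and $w\in\mathbb C^n$. Then, with $\Delta(T)$ acting in the second variable (on the domain where the series converge), $$\Delta(T)\,{}_pK_q(\mu;\nu;w,\cdot)=\frac{[\mu]_{\underline1}}{[\nu]_{\underline1}}\,\Delta(w)\,{}_pK_q(\mu+\underline1;\nu+\underline1;w,\cdot),$$ where $\mu+\underline1,\nu+\underline1$ mean adding $1$ to each component, $[\mu]_{\underline1}=1$ if $p=0$ and $[\nu]_{\underline1}=1$ if $q=0$. The same identity holds with ${}_pF_q$ in place of ${}_pK_q$.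
   Context: $s_{ij}$ transposition of coordinates; Dunkl operators $T_\xi f(x)=\partial_\xi f(x)+k\sum_{i<j}(\xi_i-\xi_j)\frac{f(x)-f(s_{ij}x)}{x_i-x_j}$, $T_j=T_{e_j}$ (commuting). $\underline1=(1,\dots,1)$; $\Delta(w)=\prod w_j$; $[\mu]_\eta=\prod_{j=1}^n(\mu-k(j-1))_{\eta_j}$ and for vectors $[\mu]_\lambda=\prod_i[\mu_i]_\lambda$. Jack polynomials: $\Lambda_n^+$ partitions of length $\le n$; $\eta_+$ decreasing rearrangement, $|\eta|=\sum\eta_i$. Order $\prec$ on $\mathbb N_0^n$: $\kappa\prec\eta$ iff $\kappa_+$ strictly below $\eta_+$ in dominance order, or $\kappa_+=\eta_+$ and $w_\eta<w_\kappa$ in Bruhat order ($w_\eta$ shortest permutation with $w_\eta\eta_+=\eta$). With $\mathcal D_j=x_jT_j+k(1-n)+k\sum_{i>j}s_{ij}$, $\overline\eta_j=\eta_j-k\#\{i<j:\eta_i\ge\eta_j\}-k\#\{i>j:\eta_i>\eta_j\}$, $E_\eta$ is the unique polynomial $x^\eta+\sum_{\kappa\prec\eta}c_{\eta\kappa}x^\kappa$ with $\mathcal D_jE_\eta=\overline\eta_jE_\eta$. Let $c_\eta$ be the unique scalars with $(z_1+\dots+z_n)^m=\sum_{|\eta|=m}c_\eta E_\eta(z)$ for all $m$, $L_\eta=c_\eta E_\eta$, $C_\lambda=\sum_{\eta\in\mathcal S_n\lambda}L_\eta$. ${}_pK_q(\mu;\nu;z,w)=\sum_{\eta\in\mathbb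 N_0^n}\frac{[\mu]_{\eta_+}}{[\nu]_{\eta_+}}\frac{L_\eta(z)L_\eta(w)}{|\eta|!L_\eta(\underline1)}$, ${}_pF_q(\mu;\nu;z,w)=\sum_{\lambda\in\Lambda_n^+}\frac{[\mu]_\lambda}{[\nu]_\lambda}\frac{C_\lambda(z)C_\lambda(w)}{|\lambda|!C_\lambda(\underline1)}$ (entire if $p\le q$, convergent for $\|z\|_\infty\|w\|_\infty<1$ if $p=q+1$). *)

theory Defs
  imports "HOL-Analysis.Analysis" "HOL-Combinatorics.Permutations"
begin

text \<open>Conventions: n is the number of variables; coordinates are indexed 0..n-1.
 Points are functions nat => complex (only coordinates < n matter); multi-indices
 in N_0^n are functions nat => nat vanishing from n on. k :: real is the Dunkl
 parameter.\<close>

definition multi_idx :: "nat \<Rightarrow> (nat \<Rightarrow> nat) set" where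
  "multi_idx n = {\<eta>. \<forall>i\<ge>n. \<eta> i = 0}"

definition absv :: "nat \<Rightarrow> (nat \<Rightarrow> nat) \<Rightarrow> nat" where
  "absv n \<eta> = (\<Sum>i<n. \<eta> i)"

definition is_partition :: "nat \<Rightarrow> (nat \<Rightarrow> nat) \<Rightarrow> bool" where
  "is_partition n lam \<longleftrightarrow> lam \<in> multi_idx n \<and> (\<forall>i j. i \<le> j \<longrightarrow> j < n \<longrightarrow> lam j \<le> lam i)"

definition plus_part :: "nat \<Rightarrow> (nat \<Rightarrow> nat) \<Rightarrow> (nat \<Rightarrow> nat)" where
  "plus_part n \<eta> = (THE lam. is_partition n lam \<and> (\<exists>\<sigma>. \<sigma> permutes {..<n} \<and> lam = \<eta> \<circ> \<sigma>))"

definition dom_lt :: "nat \<Rightarrow> (nat \<Rightarrow> nat) \<Rightarrow> (nat \<Rightarrow> nat) \<Rightarrow> bool" where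
  "dom_lt n lam \<mu> \<longleftrightarrow> absv n lam = absv n \<mu> \<and>
     (\<forall>m\<le>n. (\<Sum>i<m. lam i) \<le> (\<Sum>i<m. \<mu> i)) \<and> lam \<noteq> \<mu>"

definition swp :: "nat \<Rightarrow> nat \<Rightarrow> nat \<Rightarrow> nat" where
  "swp i j = (\<lambda>m. if m = i then j else if m = j then i else m)"

definition inversions :: "nat \<Rightarrow> (nat \<Rightarrow> nat) \<Rightarrow> nat" where
  "inversions n w = card {(i, j). i < j \<and> j < n \<and> w j < w i}"

definition bruhat_step :: "nat \<Rightarrow> (nat \<Rightarrow> nat) \<Rightarrow> (nat \<Rightarrow> nat) \<Rightarrow> bool" where
  "bruhat_step n u v \<longleftrightarrow> u permutes {..<n} \<and>
     (\<exists>i j. i < j \<and> j < n \<and> v = u \<circ> swp i j \<and> inversions n u < inversions n v)"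

definition bruhat_lt :: "nat \<Rightarrow> (nat \<Rightarrow> nat) \<Rightarrow> (nat \<Rightarrow> nat) \<Rightarrow> bool" where
  "bruhat_lt n = tranclp (bruhat_step n)"

definition perm_act :: "(nat \<Rightarrow> nat) \<Rightarrow> (nat \<Rightarrow> 'a) \<Rightarrow> (nat \<Rightarrow> 'a)" where
  "perm_act w \<eta> = \<eta> \<circ> inv w"

definition w_perm :: "nat \<Rightarrow> (nat \<Rightarrow> nat) \<Rightarrow> (nat \<Rightarrow> nat)" where
  "w_perm n \<eta> = (THE w. w permutes {..<n} \<and> perm_act w (plus_part n \<eta>) = \<eta> \<and>
      (\<forall>w'. w' permutes {..<n} \<and> perm_act w' (plus_part n \<eta>) = \<eta> \<longrightarrow>
             inversions n w \<le> inversions n w'))"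

definition prec :: "nat \<Rightarrow> (nat \<Rightarrow> nat) \<Rightarrow> (nat \<Rightarrow> nat) \<Rightarrow> bool" where
  "prec n \<kappa> \<eta> \<longleftrightarrow> dom_lt n (plus_part n \<kappa>) (plus_part n \<eta>) \<or>
     (plus_part n \<kappa> = plus_part n \<eta> \<and> bruhat_lt n (w_perm n \<eta>) (w_perm n \<kappa>))"

definition monom :: "nat \<Rightarrow> (nat \<Rightarrow> nat) \<Rightarrow> (nat \<Rightarrow> complex) \<Rightarrow> complex" where
  "monom n \<eta> x = (\<Prod>i<n. x i ^ \<eta> i)"

definition sw_pt :: "nat \<Rightarrow> nat \<Rightarrow> (nat \<Rightarrow> complex) \<Rightarrow> (nat \<Rightarrow> complex)" where
  "sw_pt i j x = x \<circ> swp i j"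

definition dir_deriv :: "(nat \<Rightarrow> complex) \<Rightarrow> ((nat \<Rightarrow> complex) \<Rightarrow> complex) \<Rightarrow> (nat \<Rightarrow> complex) \<Rightarrow> complex" where
  "dir_deriv \<xi> f x = deriv (\<lambda>t. f (\<lambda>m. x m + t * \<xi> m)) 0"

definition unit_vec :: "nat \<Rightarrow> nat \<Rightarrow> complex" where
  "unit_vec j = (\<lambda>m. if m = j then 1 else 0)"

text \<open>difference quotient (f(x) - f(s_ij x)) / (x_i - x_j), extended continuously to
 the hyperplane x_i = x_j (where it equals (d_i - d_j) f (x) for C^1 functions)\<close>
definition diff_quot :: "nat \<Rightarrow> nat \<Rightarrow> ((nat \<Rightarrow> complex) \<Rightarrow> complex) \<Rightarrow> (nat \<Rightarrow> complex) \<Rightarrow> complex" where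
  "diff_quot i j f x = (if x i \<noteq> x j then (f x - f (sw_pt i j x)) / (x i - x j)
      else dir_deriv (unit_vec i) f x - dir_deriv (unit_vec j) f x)"

definition dunkl :: "nat \<Rightarrow> real \<Rightarrow> (nat \<Rightarrow> complex) \<Rightarrow> ((nat \<Rightarrow> complex) \<Rightarrow> complex) \<Rightarrow> (nat \<Rightarrow> complex) \<Rightarrow> complex" where
  "dunkl n k \<xi> f x = dir_deriv \<xi> f x +
     of_real k * (\<Sum>(i, j)\<in>{(i, j). i < j \<and> j < n}. (\<xi> i - \<xi> j) * diff_quot i j f x)"

definition dunkl_Delta :: "nat \<Rightarrow> real \<Rightarrow> ((nat \<Rightarrow> complex) \<Rightarrow> complex) \<Rightarrow> (nat \<Rightarrow> complex) \<Rightarrow> complex" where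
  "dunkl_Delta n k f = foldr (\<lambda>j g. dunkl n k (unit_vec j) g) [0..<n] f"

definition cher_D :: "nat \<Rightarrow> real \<Rightarrow> nat \<Rightarrow> ((nat \<Rightarrow> complex) \<Rightarrow> complex) \<Rightarrow> (nat \<Rightarrow> complex) \<Rightarrow> complex" where
  "cher_D n k j f x = x j * dunkl n k (unit_vec j) f x + of_real k * (1 - of_nat n) * f x
     + of_real k * (\<Sum>i\<in>{j<..<n}. f (sw_pt i j x))"

definition eigval :: "nat \<Rightarrow> real \<Rightarrow> (nat \<Rightarrow> nat) \<Rightarrow> nat \<Rightarrow> real" where
  "eigval n k \<eta> j = real (\<eta> j) - k * real (card {i. i < j \<and> \<eta> j \<le> \<eta> i})
      - k * real (card {i. j < i \<and> i < n \<and> \<eta> j < \<eta> i})"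

definition jackE :: "nat \<Rightarrow> real \<Rightarrow> (nat \<Rightarrow> nat) \<Rightarrow> (nat \<Rightarrow> complex) \<Rightarrow> complex" where
  "jackE n k \<eta> = (THE f. (\<exists>c. f = (\<lambda>x. monom n \<eta> x +
        (\<Sum>\<kappa>\<in>{\<kappa>\<in>multi_idx n. prec n \<kappa> \<eta>}. c \<kappa> * monom n \<kappa> x))) \<and>
      (\<forall>j<n. \<forall>x. cher_D n k j f x = of_real (eigval n k \<eta> j) * f x))"

definition coefs :: "nat \<Rightarrow> real \<Rightarrow> nat \<Rightarrow> (nat \<Rightarrow> nat) \<Rightarrow> complex" where
  "coefs n k m = (THE c. (\<forall>\<kappa>. \<kappa> \<notin> {\<kappa>\<in>multi_idx n. absv n \<kappa> = m} \<longrightarrow> c \<kappa> = 0) \<and>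
      (\<forall>z. (\<Sum>i<n. z i) ^ m = (\<Sum>\<kappa>\<in>{\<kappa>\<in>multi_idx n. absv n \<kappa> = m}. c \<kappa> * jackE n k \<kappa> z)))"

definition jackL :: "nat \<Rightarrow> real \<Rightarrow> (nat \<Rightarrow> nat) \<Rightarrow> (nat \<Rightarrow> complex) \<Rightarrow> complex" where
  "jackL n k \<eta> z = coefs n k (absv n \<eta>) \<eta> * jackE n k \<eta> z"

definition jackC :: "nat \<Rightarrow> real \<Rightarrow> (nat \<Rightarrow> nat) \<Rightarrow> (nat \<Rightarrow> complex) \<Rightarrow> complex" where
  "jackC n k lam z = (\<Sum>\<eta>\<in>{\<eta>\<in>multi_idx n. plus_part n \<eta> = lam}. jackL n k \<eta> z)"

definition one_vec :: "nat \<Rightarrow> complex" where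
  "one_vec = (\<lambda>_. 1)"

definition gpoch :: "nat \<Rightarrow> real \<Rightarrow> nat \<Rightarrow> (nat \<Rightarrow> complex) \<Rightarrow> (nat \<Rightarrow> nat) \<Rightarrow> complex" where
  "gpoch n k p \<mu> lam = (\<Prod>i<p. \<Prod>j<n. pochhammer (\<mu> i - of_real k * of_nat j) (lam j))"

definition hypK :: "nat \<Rightarrow> real \<Rightarrow> nat \<Rightarrow> nat \<Rightarrow> (nat \<Rightarrow> complex) \<Rightarrow> (nat \<Rightarrow> complex)
     \<Rightarrow> (nat \<Rightarrow> complex) \<Rightarrow> (nat \<Rightarrow> complex) \<Rightarrow> complex" where
  "hypK n k p q \<mu> \<nu> z w = infsum (\<lambda>\<eta>.
      gpoch n k p \<mu> (plus_part n \<eta>) / gpoch n k q \<nu> (plus_part n \<eta>) *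
      (jackL n k \<eta> z * jackL n k \<eta> w / (fact (absv n \<eta>) * jackL n k \<eta> one_vec))) (multi_idx n)"

definition hypF :: "nat \<Rightarrow> real \<Rightarrow> nat \<Rightarrow> nat \<Rightarrow> (nat \<Rightarrow> complex) \<Rightarrow> (nat \<Rightarrow> complex)
     \<Rightarrow> (nat \<Rightarrow> complex) \<Rightarrow> (nat \<Rightarrow> complex) \<Rightarrow> complex" where
  "hypF n k p q \<mu> \<nu> z w = infsum (\<lambda>lam.
      gpoch n k p \<mu> lam / gpoch n k q \<nu> lam *
      (jackC n k lam z * jackC n k lam w / (fact (absv n lam) * jackC n k lam one_vec)))
      {lam. is_partition n lam}"

definition supnorm :: "nat \<Rightarrow> (nat \<Rightarrow> complex) \<Rightarrow> real" where
  "supnorm n z = Max ((\<lambda>i. cmod (z i)) ` {..<n})"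

definition conv_dom :: "nat \<Rightarrow> nat \<Rightarrow> nat \<Rightarrow> (nat \<Rightarrow> complex) \<Rightarrow> (nat \<Rightarrow> complex) set" where
  "conv_dom n p q w = (if p \<le> q then UNIV else {z. supnorm n z * supnorm n w < 1})"

definition minus_one :: "(nat \<Rightarrow> nat) \<Rightarrow> (nat \<Rightarrow> nat)" where
  "minus_one \<eta> = (\<lambda>i. \<eta> i - 1)"

definition d_coef :: "nat \<Rightarrow> (nat \<Rightarrow> nat) \<Rightarrow> complex" where
  "d_coef n \<eta> = (if \<forall>i<n. \<eta> i \<noteq> 0
     then of_nat (fact (absv n \<eta>)) / of_nat (fact (absv n (minus_one \<eta>))) else 0)"

end

theory Submission
  imports Defs "HOL-Complex_Analysis.Complex_Analysis"
begin

text \<open>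
  The nonsymmetric Jack polynomials are built from 1 by the Knop-Sahi recursion: a raising operator
  \<Phi> (multiply by the last coordinate after a cyclic shift) and adjacent transpositions corrected by a
  multiple of the identity. Triangularity of the Cherednik operators and the separation of their
  spectra identify the result with the polynomials of the definition and show that all coefficients are
  nonnegative. The lowering operator \<Psi>, a cyclic shift followed by one Dunkl operator, satisfies
  \<Psi> E(\<Phi> \<eta>) = c E(\<eta>) and kills E(\<eta>) if the last entry of \<eta> is 0. As \<Psi>^n is the product of all
  Dunkl operators, parts (1) and (2) follow with the product of the shifted eigenvalues as constant.
  Applying \<Psi> to the powers of the coordinate sum gives the recursion for the coefficients of the L and
  hence part (3). For part (4), nonnegativity bounds the L on polydiscs by their values at the all-one
  vector, the recursion bounds these values by a product over the entries of \<eta>, and the ratio test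
  gives locally uniform convergence on the stated domain, so \<Psi> acts termwise.
\<close>

subsection \<open>Multi-indices, ranks and the order on compositions\<close>

text \<open>\<open>plus_part\<close>, \<open>w_perm\<close>, \<open>jackE\<close> and
  \<open>coefs\<close> are definite descriptions, so each must be identified before it can be
  computed with. The obstacle is the order: the recursion produces joint eigenfunctions but says
  nothing about dominance or Bruhat comparisons. The support of such a function is therefore
  recovered from its eigenvalues: the operators are triangular for the order, and a joint spectrum
  determines its index. Ranks are the common language. The spectrum of \<eta> consists of the
  numbers \<eta> j - k * \<open>rnk n \<eta> j\<close>, and \<open>w_perm n \<eta>\<close> is
  \<open>inv (rnk n \<eta>)\<close>, so facts about order and spectrum become facts about sorting.
  Every constant below is built from two numbers: \<open>phi_fac\<close>, the eigenvalue of T_0 x_0,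
  and \<open>swap_coef\<close>, which is k divided by a gap of the spectrum. Since k \<ge> 0, ranks
  are at most n - 1 and larger entries have smaller ranks, the first is at least 1 and the second
  lies in [0, 1). This yields nonnegative coefficients of \<open>jackE\<close>, positive
  \<open>coefs\<close>, and the growth estimates.\<close>

lemma swp_eq_transpose: "swp i j = Transposition.transpose i j"
  by (auto simp: fun_eq_iff swp_def Transposition.transpose_def)

lemma swp_permutes: "i < n \<Longrightarrow> j < n \<Longrightarrow> swp i j permutes {..<n}"
  unfolding swp_eq_transpose by (rule permutes_swap_id) auto

lemma swp_simps [simp]: "swp i j i = j" "swp i j j = i" "m \<noteq> i \<Longrightarrow> m \<noteq> j \<Longrightarrow> swp i j m = m"
  "swp i j (swp i j m) = m" "swp i j \<circ> swp i j = id"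
  by (auto simp: swp_def fun_eq_iff)

lemma swp_commute: "swp i j = swp j i"
  by (auto simp: swp_def fun_eq_iff)

lemma comp_swp_swp [simp]: "f \<circ> swp i j \<circ> swp i j = f"
  by (auto simp: fun_eq_iff)

lemma perm_comp_swp: "\<sigma> permutes S \<Longrightarrow> \<sigma> \<circ> swp i j = swp (\<sigma> i) (\<sigma> j) \<circ> \<sigma>"
  by (auto simp: fun_eq_iff swp_def inj_eq[OF permutes_inj])

lemma multi_idx_perm: "\<eta> \<in> multi_idx n \<Longrightarrow> \<sigma> permutes {..<n} \<Longrightarrow> \<eta> \<circ> \<sigma> \<in> multi_idx n"
  by (auto simp: multi_idx_def permutes_def)

lemma absv_perm: "\<sigma> permutes {..<n} \<Longrightarrow> absv n (\<eta> \<circ> \<sigma>) = absv n \<eta>"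
  unfolding absv_def using sum.permute[of \<sigma> "{..<n}" \<eta>] by simp

lemma multi_idx_eqI:
  "\<eta> \<in> multi_idx n \<Longrightarrow> \<kappa> \<in> multi_idx n \<Longrightarrow> (\<And>i. i < n \<Longrightarrow> \<eta> i = \<kappa> i) \<Longrightarrow> \<eta> = \<kappa>"
  by (rule ext, rule_tac P = "x < n" in case_split) (auto simp: multi_idx_def not_less)

definition deg_idx :: "nat \<Rightarrow> nat \<Rightarrow> (nat \<Rightarrow> nat) set" where
  "deg_idx n m = {\<kappa> \<in> multi_idx n. absv n \<kappa> = m}"

lemma finite_deg_idx [simp]: "finite (deg_idx n m)"
proof (rule finite_subset)
  show "deg_idx n m \<subseteq> {f. \<forall>x. (x \<in> {..<n} \<longrightarrow> f x \<in> {..m}) \<and> (x \<notin> {..<n} \<longrightarrow> f x = 0)}"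
    unfolding deg_idx_def multi_idx_def absv_def
    by (auto simp: not_less) (metis finite_lessThan lessThan_iff member_le_sum zero_le)
  show "finite {f. \<forall>x. (x \<in> {..<n} \<longrightarrow> f x \<in> {..m}) \<and> (x \<notin> {..<n} \<longrightarrow> f x = (0::nat))}"
    by (rule finite_set_of_finite_funs) auto
qed

lemma deg_idx_zero: "deg_idx n 0 = {\<lambda>_. 0}"
  by (auto simp: deg_idx_def absv_def multi_idx_def fun_eq_iff) (metis lessThan_iff not_less)

text \<open>Ties are broken by position exactly as in \<open>eigval\<close>: an equal entry counts
  if it stands to the left and not if it stands to the right.\<close>

definition before :: "(nat \<Rightarrow> nat) \<Rightarrow> nat \<Rightarrow> nat \<Rightarrow> bool" where
  "before \<eta> i j \<longleftrightarrow> \<eta> j < \<eta> i \<or> (\<eta> i = \<eta> j \<and> i < j)"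

text \<open>The inverse of this permutation is the shortest permutation taking the partition of \<eta> to \<eta>, and
  the Cherednik eigenvalue is \<eta> minus k times the rank.\<close>

definition rnk :: "nat \<Rightarrow> (nat \<Rightarrow> nat) \<Rightarrow> nat \<Rightarrow> nat" where
  "rnk n \<eta> j = (if j < n then card {i. i < n \<and> before \<eta> i j} else j)"

lemma before_trans: "before \<eta> i j \<Longrightarrow> before \<eta> j l \<Longrightarrow> before \<eta> i l"
  unfolding before_def by auto

lemma before_irrefl: "\<not> before \<eta> i i"
  unfolding before_def by auto

lemma before_total: "i \<noteq> j \<Longrightarrow> before \<eta> i j \<or> before \<eta> j i"
  unfolding before_def by auto

lemma rnk_less_iff:
  assumes "i < n" "j < n" shows "rnk n \<eta> i < rnk n \<eta> j \<longleftrightarrow> before \<eta> i j"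
proof -
  have *: "rnk n \<eta> i < rnk n \<eta> j" if "before \<eta> i j" "i < n" "j < n" for i j
  proof -
    have "{l. l < n \<and> before \<eta> l i} \<subset> {l. l < n \<and> before \<eta> l j}"
      using that before_trans before_irrefl by blast
    then show ?thesis using that unfolding rnk_def by (simp add: psubset_card_mono)
  qed
  show ?thesis
    using *[of i j] *[of j i] before_total[of i j \<eta>] assms by fastforce
qed

lemma rnk_permutes: "rnk n \<eta> permutes {..<n}"
proof (rule bij_imp_permutes)
  have inj: "inj_on (rnk n \<eta>) {..<n}"
    by (rule inj_onI) (metis before_total lessThan_iff less_irrefl rnk_less_iff)
  have sub: "rnk n \<eta> ` {..<n} \<subseteq> {..<n}"
  proof clarsimp
    fix j assume "j < n"
    then have "{i. i < n \<and> before \<eta> i j} \<subset> {..<n}" using before_irrefl by auto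
    then have "card {i. i < n \<and> before \<eta> i j} < card {..<n}" by (intro psubset_card_mono) auto
    then show "rnk n \<eta> j < n" using \<open>j < n\<close> by (simp add: rnk_def)
  qed
  show "bij_betw (rnk n \<eta>) {..<n} {..<n}"
    unfolding bij_betw_def using inj sub by (simp add: endo_inj_surj)
qed (auto simp: rnk_def)

text \<open>A permutation is determined by its order pattern, since u j counts the positions with
  smaller image. Ranks of modified indices are computed below through this criterion.\<close>

lemma rnk_unique:
  assumes "u permutes {..<n}" and "\<And>i j. i < n \<Longrightarrow> j < n \<Longrightarrow> u i < u j \<longleftrightarrow> before \<eta> i j"
  shows "u = rnk n \<eta>"
proof
  fix j show "u j = rnk n \<eta> j"
  proof (cases "j < n")
    case True
    have "bij_betw u {i. i < n \<and> before \<eta> i j} {..<u j}"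
    proof (rule bij_betw_imageI)
      show "inj_on u {i. i < n \<and> before \<eta> i j}" using permutes_inj_on[OF assms(1)] .
      have "\<exists>i. i < n \<and> before \<eta> i j \<and> u i = l" if "l < u j" for l
      proof -
        have "u j < n" using True permutes_in_image[OF assms(1), of j] by simp
        then have "inv u l < n" "u (inv u l) = l"
          using that permutes_in_image[OF permutes_inv[OF assms(1)], of l]
          by (auto simp: permutes_inverses[OF assms(1)])
        then show ?thesis using assms(2)[of "inv u l" j] that True by (intro exI[of _ "inv u l"]) simp
      qed
      then show "u ` {i. i < n \<and> before \<eta> i j} = {..<u j}"
        using assms(2)[OF _ True] by fastforce
    qed
    then show ?thesis using True by (auto simp: rnk_def dest: bij_betw_same_card)
  next
    case False then show ?thesis using assms(1) by (auto simp: rnk_def permutes_def)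
  qed
qed

text \<open>A partition is recovered from its level counts: v \<le> lam i holds iff more than i
  entries are at least v. Permuting the entries does not change these counts.\<close>

lemma partition_unique:
  assumes "is_partition n lam" "is_partition n (lam \<circ> \<sigma>)" "\<sigma> permutes {..<n}"
  shows "lam \<circ> \<sigma> = lam"
proof -
  have key: "v \<le> l i \<longleftrightarrow> i < card {i. i < n \<and> v \<le> l i}" if "is_partition n l" "i < n" for l i v
  proof
    assume "v \<le> l i"
    then have "{..i} \<subseteq> {i. i < n \<and> v \<le> l i}"
      using that unfolding is_partition_def by (auto intro: order_trans)
    from card_mono[OF _ this] show "i < card {i. i < n \<and> v \<le> l i}" by simp
  next
    assume a: "i < card {i. i < n \<and> v \<le> l i}"
    show "v \<le> l i"
    proof (rule ccontr)
      assume "\<not> v \<le> l i"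
      then have "j < i" if "v \<le> l j" "j < n" for j
        using \<open>is_partition n l\<close> \<open>i < n\<close> that unfolding is_partition_def
        by (meson not_le order_trans)
      then have "{i. i < n \<and> v \<le> l i} \<subseteq> {..<i}" by auto
      from card_mono[OF _ this] a show False by simp
    qed
  qed
  have c: "card {i. i < n \<and> v \<le> (lam \<circ> \<sigma>) i} = card {i. i < n \<and> v \<le> lam i}" for v
  proof (rule bij_betw_same_card[of \<sigma>], rule bij_betw_imageI)
    show "inj_on \<sigma> {i. i < n \<and> v \<le> (lam \<circ> \<sigma>) i}" using permutes_inj_on[OF assms(3)] .
    have "\<exists>j. j < n \<and> v \<le> lam (\<sigma> j) \<and> i = \<sigma> j" if "i < n" "v \<le> lam i" for i
      using that permutes_in_image[OF permutes_inv[OF assms(3)], of i]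
      by (intro exI[of _ "inv \<sigma> i"]) (simp add: permutes_inverses[OF assms(3)])
    then show "\<sigma> ` {i. i < n \<and> v \<le> (lam \<circ> \<sigma>) i} = {i. i < n \<and> v \<le> lam i}"
      using permutes_in_image[OF assms(3)] by auto
  qed
  show ?thesis
  proof (rule multi_idx_eqI)
    show "lam \<circ> \<sigma> \<in> multi_idx n" "lam \<in> multi_idx n" using assms by (auto simp: is_partition_def)
    fix i assume i: "i < n"
    have "v \<le> (lam \<circ> \<sigma>) i \<longleftrightarrow> v \<le> lam i" for v
      using key[OF assms(1) i, of v] key[OF assms(2) i, of v] c[of v] by simp
    then show "(lam \<circ> \<sigma>) i = lam i" by (metis le_antisym order_refl)
  qed
qed

text \<open>Listing the entries by rank sorts them; \<open>partition_unique\<close> supplies the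
  uniqueness demanded by the definite description.\<close>

lemma plus_part_rnk:
  assumes "\<eta> \<in> multi_idx n"
  shows "plus_part n \<eta> = \<eta> \<circ> inv (rnk n \<eta>)" and "is_partition n (plus_part n \<eta>)"
proof -
  let ?l = "\<eta> \<circ> inv (rnk n \<eta>)"
  note P = rnk_permutes[of n \<eta>]
  have p: "is_partition n ?l"
    unfolding is_partition_def
  proof (intro conjI allI impI)
    show "?l \<in> multi_idx n" by (intro multi_idx_perm assms permutes_inv P)
    fix i j assume ij: "i \<le> j" "j < n"
    let ?a = "inv (rnk n \<eta>) i" and ?b = "inv (rnk n \<eta>) j"
    have ab: "?a < n" "?b < n" using ij permutes_in_image[OF permutes_inv[OF P]] by auto
    show "?l j \<le> ?l i"
    proof (cases "i = j")
      case False
      then have "rnk n \<eta> ?a < rnk n \<eta> ?b" using ij by (simp add: permutes_inverses[OF P])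
      then have "before \<eta> ?a ?b" using rnk_less_iff[OF ab] by simp
      then show ?thesis by (auto simp: before_def)
    qed auto
  qed
  have u: "lam = ?l" if "is_partition n lam" "\<sigma> permutes {..<n}" "lam = \<eta> \<circ> \<sigma>" for lam \<sigma>
  proof -
    have "lam \<circ> (inv \<sigma> \<circ> inv (rnk n \<eta>)) = ?l"
      using that by (auto simp: fun_eq_iff permutes_inverses)
    then show ?thesis
      using partition_unique[OF that(1), of "inv \<sigma> \<circ> inv (rnk n \<eta>)"] p that P
      by (simp add: permutes_compose permutes_inv)
  qed
  show "plus_part n \<eta> = ?l"
    unfolding plus_part_def
    by (rule the_equality) (use p u permutes_inv[OF P] in blast)+
  then show "is_partition n (plus_part n \<eta>)" using p by simp
qed

lemma plus_part_o_rnk: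
  assumes "\<eta> \<in> multi_idx n" shows "plus_part n \<eta> (rnk n \<eta> j) = \<eta> j"
  by (simp add: plus_part_rnk[OF assms] permutes_inverses[OF rnk_permutes])

lemma plus_part_unique:
  assumes "\<eta> \<in> multi_idx n" "\<sigma> permutes {..<n}" "is_partition n (\<eta> \<circ> \<sigma>)"
  shows "plus_part n \<eta> = \<eta> \<circ> \<sigma>"
  unfolding plus_part_def
proof (rule the_equality)
  show "is_partition n (\<eta> \<circ> \<sigma>) \<and> (\<exists>\<tau>. \<tau> permutes {..<n} \<and> \<eta> \<circ> \<sigma> = \<eta> \<circ> \<tau>)" using assms by blast
  fix lam assume "is_partition n lam \<and> (\<exists>\<tau>. \<tau> permutes {..<n} \<and> lam = \<eta> \<circ> \<tau>)"
  then obtain \<tau> where l: "is_partition n lam" "\<tau> permutes {..<n}" "lam = \<eta> \<circ> \<tau>" by blast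
  have "(\<eta> \<circ> \<sigma>) \<circ> (inv \<sigma> \<circ> \<tau>) = lam" using l assms by (auto simp: fun_eq_iff permutes_inverses)
  then show "lam = \<eta> \<circ> \<sigma>"
    using partition_unique[OF assms(3), of "inv \<sigma> \<circ> \<tau>"] l assms
    by (simp add: permutes_compose permutes_inv)
qed

lemma plus_part_perm:
  assumes "\<eta> \<in> multi_idx n" "\<sigma> permutes {..<n}"
  shows "plus_part n (\<eta> \<circ> \<sigma>) = plus_part n \<eta>"
proof -
  have "(\<eta> \<circ> \<sigma>) \<circ> (inv \<sigma> \<circ> inv (rnk n \<eta>)) = plus_part n \<eta>"
    using assms by (auto simp: fun_eq_iff permutes_inverses plus_part_rnk)
  then show ?thesis
    using plus_part_unique[OF multi_idx_perm[OF assms], of "inv \<sigma> \<circ> inv (rnk n \<eta>)"]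
      plus_part_rnk(2)[OF assms(1)] assms(2) by (simp add: permutes_compose permutes_inv rnk_permutes)
qed

lemma plus_part_eqD:
  assumes "\<eta> \<in> multi_idx n" "\<kappa> \<in> multi_idx n" "plus_part n \<eta> = plus_part n \<kappa>"
  obtains \<sigma> where "\<sigma> permutes {..<n}" "\<eta> = \<kappa> \<circ> \<sigma>"
proof
  show "inv (rnk n \<kappa>) \<circ> rnk n \<eta> permutes {..<n}" by (simp add: permutes_compose permutes_inv rnk_permutes)
  have "\<kappa> (inv (rnk n \<kappa>) (rnk n \<eta> i)) = \<eta> i" for i
    using plus_part_o_rnk[OF assms(1), of i] assms(3) plus_part_rnk(1)[OF assms(2)] by simp
  then show "\<eta> = \<kappa> \<circ> (inv (rnk n \<kappa>) \<circ> rnk n \<eta>)" by (intro ext) (simp only: o_apply)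
qed

lemma absv_plus_part: "\<eta> \<in> multi_idx n \<Longrightarrow> absv n (plus_part n \<eta>) = absv n \<eta>"
  by (simp only: plus_part_rnk(1) absv_perm[OF permutes_inv[OF rnk_permutes]])

lemma plus_part_partition: "is_partition n lam \<Longrightarrow> plus_part n lam = lam"
  using plus_part_unique[of lam n id] by (simp add: is_partition_def permutes_id)

text \<open>Remove the largest index of A. It is at least card A - 1, so its entry is at most the
  last summand on the right.\<close>

lemma partition_sum_max:
  assumes "is_partition n lam" "A \<subseteq> {..<n}"
  shows "(\<Sum>i\<in>A. lam i) \<le> (\<Sum>i<card A. lam i)"
  using assms(2)
proof (induction "card A" arbitrary: A)
  case 0
  then show ?case using finite_subset by fastforce
next
  case (Suc m)
  have fin: "finite A" using Suc.prems finite_subset by auto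
  have ne: "A \<noteq> {}" using Suc.hyps(2) by auto
  let ?M = "Max A"
  have M: "?M \<in> A" "?M < n" using fin ne Suc.prems by auto
  have c: "card (A - {?M}) = m" using Suc.hyps(2) M fin by simp
  have "A \<subseteq> {..?M}" using fin by auto
  from card_mono[OF _ this] have "m \<le> ?M" using Suc.hyps(2) by simp
  then have "lam ?M \<le> lam m" using M assms(1) unfolding is_partition_def by blast
  moreover have "(\<Sum>i\<in>A - {?M}. lam i) \<le> (\<Sum>i<m. lam i)"
    using Suc.hyps(1)[of "A - {?M}"] c Suc.prems by auto
  ultimately show ?case
    using Suc.hyps(2)[symmetric] sum.remove[OF fin M(1), of lam] by simp
qed

text \<open>Partial sums of the sorted index are maxima over index sets of the given size. In this
  form dominance can be tested without sorting.\<close>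

lemma sum_le_plus_part:
  assumes "\<eta> \<in> multi_idx n" "A \<subseteq> {..<n}"
  shows "(\<Sum>i\<in>A. \<eta> i) \<le> (\<Sum>i<card A. plus_part n \<eta> i)"
proof -
  note P = rnk_permutes[of n \<eta>]
  have inj: "inj_on (rnk n \<eta>) A" using permutes_inj_on[OF P] .
  have "(\<Sum>i\<in>A. \<eta> i) = (\<Sum>i\<in>rnk n \<eta> ` A. plus_part n \<eta> i)"
    by (simp add: sum.reindex[OF inj] plus_part_o_rnk[OF assms(1)])
  also have "\<dots> \<le> (\<Sum>i<card (rnk n \<eta> ` A). plus_part n \<eta> i)"
    by (rule partition_sum_max) (use assms plus_part_rnk(2) permutes_in_image[OF P] in auto)
  finally show ?thesis by (simp add: card_image[OF inj])
qed

lemma sum_remove2: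
  fixes g :: "'a \<Rightarrow> 'b::comm_monoid_add"
  assumes "finite A" "i \<in> A" "j \<in> A" "i \<noteq> j"
  shows "sum g A = g i + (g j + sum g (A - {i, j}))"
  using sum.subset_diff[of "{i, j}" A g] assms by (simp add: ac_simps)

text \<open>These are the exponents strictly between \<eta> and its reflection that a difference
  quotient produces. Dominance is tested on arbitrary index sets A; strictness follows from the sum
  of squares, which sorting preserves and the transfer of l units strictly lowers.\<close>

lemma prec_intermediate:
  assumes "\<eta> \<in> multi_idx n" "i < n" "j < n" "0 < l" "\<eta> i + l < \<eta> j"
  shows "prec n (\<eta>(j := \<eta> j - l, i := \<eta> i + l)) \<eta>"
proof -
  let ?k = "\<eta>(j := \<eta> j - l, i := \<eta> i + l)"
  have ij: "i \<noteq> j" using assms by auto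
  have mk: "?k \<in> multi_idx n" using assms by (auto simp: multi_idx_def)
  have split: "(\<Sum>m<n. g m) = g i + (g j + sum g ({..<n} - {i, j}))" for g :: "nat \<Rightarrow> nat"
    using ij assms by (intro sum_remove2) auto
  have abs: "absv n ?k = absv n \<eta>"
    unfolding absv_def split[of ?k] split[of \<eta>] using assms ij by simp
  have sumk: "sum ?k A = sum \<eta> A" if "A \<subseteq> {..<n}" "i \<in> A \<longleftrightarrow> j \<in> A" for A
  proof (cases "i \<in> A")
    case True
    then have s: "sum g A = g i + (g j + sum g (A - {i, j}))" for g :: "nat \<Rightarrow> nat"
      using that ij finite_subset[OF that(1)] by (intro sum_remove2) auto
    show ?thesis unfolding s[of ?k] s[of \<eta>] using assms ij by simp
  next
    case False then show ?thesis using that by (intro sum.cong) auto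
  qed
  have le: "sum ?k A \<le> (\<Sum>m<card A. plus_part n \<eta> m)" if A: "A \<subseteq> {..<n}" for A
  proof -
    have fin: "finite A" using A finite_subset by auto
    consider "i \<in> A \<longleftrightarrow> j \<in> A" | "i \<in> A" "j \<notin> A" | "j \<in> A" "i \<notin> A" by auto
    then show ?thesis
    proof cases
      case 1 then show ?thesis using sumk[OF A] sum_le_plus_part[OF assms(1) A] by simp
    next
      case 2
      \<comment> \<open>Exchanging i for j keeps the cardinality, and \<eta> i + l does not exceed
        \<eta> j.\<close>
      let ?B = "insert j (A - {i})"
      have "card ?B = card A" using 2 fin card_gt_0_iff[of A] by (auto simp: card_insert_if card_Diff_singleton)
      moreover have "sum ?k A \<le> sum \<eta> ?B"
        using 2 fin assms ij by (simp add: sum.remove[OF fin 2(1)]) (intro add_mono sum_mono, auto)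
      moreover have "?B \<subseteq> {..<n}" using A assms by auto
      ultimately show ?thesis using sum_le_plus_part[OF assms(1), of ?B] by simp
    next
      case 3
      have "sum ?k A \<le> sum \<eta> A" using 3 by (intro sum_mono) auto
      then show ?thesis using sum_le_plus_part[OF assms(1) A] by simp
    qed
  qed
  have part: "(\<Sum>m<M. plus_part n ?k m) \<le> (\<Sum>m<M. plus_part n \<eta> m)" if "M \<le> n" for M
  proof -
    let ?r = "inv (rnk n ?k)"
    note P = permutes_inv[OF rnk_permutes[of n ?k]]
    have inj: "inj_on ?r {..<M}" using permutes_inj_on[OF P] .
    have "(\<Sum>m<M. plus_part n ?k m) = sum ?k (?r ` {..<M})"
      unfolding plus_part_rnk(1)[OF mk] sum.reindex[OF inj] by simp
    also have "\<dots> \<le> (\<Sum>m<card (?r ` {..<M}). plus_part n \<eta> m)"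
    proof (rule le)
      have "?r x < n" if "x < M" for x
        using permutes_in_image[OF P, of x] that \<open>M \<le> n\<close> by simp
      then show "?r ` {..<M} \<subseteq> {..<n}" by blast
    qed
    finally show ?thesis by (simp add: card_image[OF inj])
  qed
  have sq: "(\<Sum>m<n. (plus_part n \<kappa> m)\<^sup>2) = (\<Sum>m<n. (\<kappa> m)\<^sup>2)" if "\<kappa> \<in> multi_idx n" for \<kappa>
    using sum.permute[OF permutes_inv[OF rnk_permutes[of n \<kappa>]], of "\<lambda>m. (\<kappa> m)\<^sup>2"]
    by (simp add: plus_part_rnk(1)[OF that] o_def)
  have "(\<Sum>m<n. (?k m)\<^sup>2) < (\<Sum>m<n. (\<eta> m)\<^sup>2)"
  proof -
    define d where "d = \<eta> j - (\<eta> i + l)"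
    have d: "\<eta> j = \<eta> i + l + d" "0 < d" using assms(5) by (auto simp: d_def)
    have "(\<eta> i + l)\<^sup>2 + (\<eta> j - l)\<^sup>2 < (\<eta> i)\<^sup>2 + (\<eta> j)\<^sup>2"
      using assms(4) d by (simp add: power2_eq_square algebra_simps)
    then show ?thesis
      unfolding split[of "\<lambda>m. (?k m)\<^sup>2"] split[of "\<lambda>m. (\<eta> m)\<^sup>2"] using ij by simp
  qed
  then have "plus_part n ?k \<noteq> plus_part n \<eta>" using sq[OF mk] sq[OF assms(1)] by auto
  then show ?thesis
    unfolding prec_def dom_lt_def using part abs absv_plus_part[OF mk] absv_plus_part[OF assms(1)] by simp
qed

text \<open>The map \<phi> injects the old inversions into the new ones and misses (i, j), which is
  a new inversion: a pair with an endpoint outside the interval from i to j has its positions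
  swapped, any other pair stays.\<close>

lemma inversions_swap:
  assumes "i < j" "j < n" "u i < u j" "u permutes {..<n}"
  shows "inversions n u < inversions n (u \<circ> swp i j)"
proof -
  let ?v = "u \<circ> swp i j"
  let ?I = "\<lambda>u. {(a, b). a < b \<and> b < n \<and> u b < (u a :: nat)}"
  define \<phi> where "\<phi> = (\<lambda>(a, b). if a < i \<or> j < b then (swp i j a, swp i j b) else (a, b))"
  have fin: "finite (?I ?v)" by (rule finite_subset[of _ "{..<n} \<times> {..<n}"]) auto
  have inj: "inj_on \<phi> (?I u)"
    using assms(1) by (auto simp: inj_on_def \<phi>_def swp_def split: if_splits)
  have sub: "\<phi> ` ?I u \<subseteq> ?I ?v - {(i, j)}"
  proof clarsimp
    fix a b assume ab: "a < b" "b < n" "u b < u a"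
    show "(case \<phi> (a, b) of (a, b) \<Rightarrow> a < b \<and> b < n \<and> u (swp i j b) < u (swp i j a)) \<and> \<phi> (a, b) \<noteq> (i, j)"
      using ab assms(1-3) by (auto simp: \<phi>_def swp_def)
  qed
  have "(i, j) \<in> ?I ?v" using assms by auto
  have "card (?I u) = card (\<phi> ` ?I u)" by (simp add: card_image[OF inj])
  also have "\<dots> \<le> card (?I ?v - {(i, j)})" using fin sub by (intro card_mono) auto
  also have "\<dots> < card (?I ?v)" using fin \<open>(i, j) \<in> ?I ?v\<close> by (rule card_Diff1_less)
  finally show ?thesis unfolding inversions_def .
qed

text \<open>A permutation with fewest inversions increases on every block of equal parts, since
  otherwise a transposition inside a block fixes the partition and removes inversions. Increasing on
  blocks means that its inverse breaks ties by position, as \<open>rnk\<close> does.\<close>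

lemma w_perm_eq:
  assumes "\<eta> \<in> multi_idx n" shows "w_perm n \<eta> = inv (rnk n \<eta>)"
proof -
  let ?l = "plus_part n \<eta>"
  note lp = plus_part_rnk(2)[OF assms]
  define W where "W = {w. w permutes {..<n} \<and> perm_act w ?l = \<eta>}"
  have finW: "finite W" unfolding W_def by (rule finite_subset[OF _ finite_permutations[of "{..<n}"]]) auto
  have r: "inv (rnk n \<eta>) \<in> W"
    unfolding W_def perm_act_def
    by (auto simp: permutes_inv rnk_permutes permutes_inv_inv[OF rnk_permutes] plus_part_o_rnk[OF assms])
  have min_eq: "w = inv (rnk n \<eta>)" if w: "w \<in> W" "\<And>w'. w' \<in> W \<Longrightarrow> inversions n w \<le> inversions n w'" for w
  proof -
    have wp: "w permutes {..<n}" and wl: "?l (inv w i) = \<eta> i" for i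
      using w by (auto simp: W_def perm_act_def fun_eq_iff)
    have wl': "\<eta> (w i) = ?l i" for i using wl[of "w i"] by (simp add: permutes_inverses[OF wp])
    have asc: "w i < w j" if ij: "i < j" "j < n" "?l i = ?l j" for i j
    proof (rule ccontr)
      assume "\<not> w i < w j"
      then have lt: "w j < w i" using ij inj_eq[OF permutes_inj[OF wp], of i j] by (auto simp: not_less_iff_gr_or_eq)
      let ?w = "w \<circ> swp i j"
      have sp: "swp i j permutes {..<n}" using ij by (intro swp_permutes) auto
      have p': "?w permutes {..<n}" by (intro permutes_compose sp wp)
      have "inversions n ?w < inversions n (?w \<circ> swp i j)"
        using ij lt by (intro inversions_swap p') auto
      moreover have "?w \<in> W"
      proof -
        have "?l (inv ?w m) = \<eta> m" for m
        proof -
          obtain m' where m: "m = ?w m'" using permutes_surj[OF p'] by (metis surj_def)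
          have "\<eta> (?w m') = ?l (swp i j m')" by (simp add: wl')
          also have "\<dots> = ?l m'" using ij(3) by (auto simp: swp_def)
          finally have "\<eta> (?w m') = ?l m'" .
          moreover have "inv ?w (?w m') = m'" by (rule permutes_inverses(2)[OF p'])
          ultimately show ?thesis by (simp add: m)
        qed
        then show ?thesis using p' by (auto simp: W_def perm_act_def)
      qed
      ultimately show False using w(2)[of ?w] by simp
    qed
    have imp: "inv w i < inv w j" if "before \<eta> i j" "i < n" "j < n" for i j
    proof (rule ccontr)
      assume c: "\<not> inv w i < inv w j"
      have iw: "inv w i < n" using that permutes_in_image[OF permutes_inv[OF wp], of i] by simp
      have "\<eta> i \<le> \<eta> j" using c lp iw wl[of i] wl[of j] unfolding is_partition_def by (metis not_le)
      then have e: "\<eta> i = \<eta> j" "i < j" using that by (auto simp: before_def)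
      then have "inv w j < inv w i" using c inj_eq[OF permutes_inj[OF permutes_inv[OF wp]], of i j] by auto
      from asc[OF this iw] wl e show False by (simp add: permutes_inverses[OF wp])
    qed
    have "inv w = rnk n \<eta>"
    proof (rule rnk_unique[OF permutes_inv[OF wp]])
      fix i j assume "i < n" "j < n"
      then show "inv w i < inv w j \<longleftrightarrow> before \<eta> i j"
        using imp[of i j] imp[of j i] before_total[of i j \<eta>] by force
    qed
    then show ?thesis using permutes_inv_inv[OF wp] by simp
  qed
  \<comment> \<open>Minimality of \<open>inv (rnk n \<eta>)\<close> is obtained indirectly: some
    minimizer exists, and \<open>min_eq\<close> identifies it.\<close>
  obtain w where w: "w \<in> W" "\<And>w'. w' \<in> W \<Longrightarrow> inversions n w \<le> inversions n w'"
    using ex_has_least_nat[of "\<lambda>w. w \<in> W" _ "inversions n"] r by blast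
  have e: "w = inv (rnk n \<eta>)" using min_eq w by blast
  show ?thesis
    unfolding w_perm_def
  proof (rule the_equality)
    show "inv (rnk n \<eta>) permutes {..<n} \<and> perm_act (inv (rnk n \<eta>)) ?l = \<eta> \<and>
      (\<forall>w'. w' permutes {..<n} \<and> perm_act w' ?l = \<eta> \<longrightarrow>
        inversions n (inv (rnk n \<eta>)) \<le> inversions n w')"
      using w unfolding e W_def by blast
    fix v assume "v permutes {..<n} \<and> perm_act v ?l = \<eta> \<and>
      (\<forall>w'. w' permutes {..<n} \<and> perm_act w' ?l = \<eta> \<longrightarrow> inversions n v \<le> inversions n w')"
    then show "v = inv (rnk n \<eta>)" by (intro min_eq) (auto simp: W_def)
  qed
qed

text \<open>An entry between p and q equal to \<eta> p or \<eta> q would see its tie-break reversed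
  by the swap. Without such entries the order pattern simply travels with the positions.\<close>

lemma rnk_swap:
  assumes "p < q" "q < n" "\<eta> p \<noteq> \<eta> q"
    and "\<And>t. p < t \<Longrightarrow> t < q \<Longrightarrow> \<eta> t \<noteq> \<eta> p \<and> \<eta> t \<noteq> \<eta> q"
  shows "rnk n (\<eta> \<circ> swp p q) = rnk n \<eta> \<circ> swp p q"
proof (rule rnk_unique[symmetric])
  have sp: "swp p q permutes {..<n}" using assms by (intro swp_permutes) auto
  show "rnk n \<eta> \<circ> swp p q permutes {..<n}" by (intro permutes_compose sp rnk_permutes)
  fix i j assume ij: "i < n" "j < n"
  have *: "swp p q i < n" "swp p q j < n" using ij permutes_in_image[OF sp] by auto
  have "before \<eta> (swp p q i) (swp p q j) \<longleftrightarrow> before (\<eta> \<circ> swp p q) i j"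
  proof (cases "\<eta> (swp p q i) = \<eta> (swp p q j)")
    case False then show ?thesis by (auto simp: before_def)
  next
    case True
    have "swp p q i < swp p q j \<longleftrightarrow> i < j"
      using True assms(1,3) assms(4)[of i] assms(4)[of j] not_less_iff_gr_or_eq[of i p]
        not_less_iff_gr_or_eq[of q j]
      by (cases "i = p"; cases "i = q"; cases "j = p"; cases "j = q") auto
    then show ?thesis by (auto simp: before_def)
  qed
  then show "(rnk n \<eta> \<circ> swp p q) i < (rnk n \<eta> \<circ> swp p q) j \<longleftrightarrow> before (\<eta> \<circ> swp p q) i j"
    using rnk_less_iff[OF *] by simp
qed

lemma bruhat_lt_inversions: "bruhat_lt n u v \<Longrightarrow> inversions n u < inversions n v"
  unfolding bruhat_lt_def
proof (induction rule: tranclp_induct)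
  case (base v) then show ?case unfolding bruhat_step_def by blast
next
  case (step v w)
  from step(2) have "inversions n v < inversions n w" unfolding bruhat_step_def by blast
  with step(3) show ?case by simp
qed

text \<open>Ties between p and q break the relation between the ranks of \<eta> and of its swap; then the swap is
  factored through a tied position into two shorter swaps.\<close>

lemma bruhat_swap:
  assumes "\<eta> \<in> multi_idx n" "p < q" "q < n" "\<eta> q < \<eta> p"
  shows "bruhat_lt n (w_perm n \<eta>) (w_perm n (\<eta> \<circ> swp p q))"
  using assms
proof (induction "q - p" arbitrary: p q \<eta> rule: less_induct)
  case less
  have sp: "swp a b permutes {..<n}" if "a < n" "b < n" for a b using that by (rule swp_permutes)
  have mi: "\<eta> \<circ> swp a b \<in> multi_idx n" if "a < n" "b < n" for a b
    using less.prems that by (intro multi_idx_perm sp) auto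
  show ?case
  proof (cases "\<exists>t. p < t \<and> t < q \<and> (\<eta> t = \<eta> p \<or> \<eta> t = \<eta> q)")
    case True
    then obtain t where t: "p < t" "t < q" and or: "\<eta> t = \<eta> p \<or> \<eta> t = \<eta> q" by blast
    from or show ?thesis
    proof
      assume e: "\<eta> t = \<eta> q"
      have eq: "\<eta> \<circ> swp p q = (\<eta> \<circ> swp p t) \<circ> swp t q"
        using t e by (auto simp: fun_eq_iff swp_def)
      have "bruhat_lt n (w_perm n \<eta>) (w_perm n (\<eta> \<circ> swp p t))"
        using t e less.prems by (intro less.hyps) auto
      moreover have "bruhat_lt n (w_perm n (\<eta> \<circ> swp p t)) (w_perm n (\<eta> \<circ> swp p q))"
        unfolding eq using t e less.prems by (intro less.hyps mi) (auto simp: swp_def)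
      ultimately show ?thesis unfolding bruhat_lt_def by (rule tranclp_trans)
    next
      assume e: "\<eta> t = \<eta> p"
      have eq: "\<eta> \<circ> swp p q = (\<eta> \<circ> swp t q) \<circ> swp p t"
        using t e by (auto simp: fun_eq_iff swp_def)
      have "bruhat_lt n (w_perm n \<eta>) (w_perm n (\<eta> \<circ> swp t q))"
        using t e less.prems by (intro less.hyps) auto
      moreover have "bruhat_lt n (w_perm n (\<eta> \<circ> swp t q)) (w_perm n (\<eta> \<circ> swp p q))"
        unfolding eq using t e less.prems by (intro less.hyps mi) (auto simp: swp_def)
      ultimately show ?thesis unfolding bruhat_lt_def by (rule tranclp_trans)
    qed
  next
    case False
    let ?r = "rnk n \<eta>"
    note P = rnk_permutes[of n \<eta>]
    have pq: "p < n" "q < n" using less.prems by auto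
    have r: "rnk n (\<eta> \<circ> swp p q) = ?r \<circ> swp p q"
      using False less.prems by (intro rnk_swap) auto
    have "w_perm n (\<eta> \<circ> swp p q) = inv (?r \<circ> swp p q)"
      by (simp add: w_perm_eq mi pq r)
    also have "\<dots> = inv ?r \<circ> swp (?r p) (?r q)"
    proof -
      have "?r \<circ> swp p q \<circ> (inv ?r \<circ> swp (?r p) (?r q)) = id"
        by (simp add: perm_comp_swp[OF P] fun_eq_iff permutes_inverses[OF P])
      moreover have "bij (?r \<circ> swp p q)" using permutes_bij[OF permutes_compose[OF sp[OF pq] P]] .
      ultimately show ?thesis by (metis bij_is_inj inv_o_cancel comp_assoc comp_id id_comp)
    qed
    finally have w: "w_perm n (\<eta> \<circ> swp p q) = w_perm n \<eta> \<circ> swp (?r p) (?r q)"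
      by (simp add: w_perm_eq less.prems)
    have lt: "?r p < ?r q" using less.prems by (subst rnk_less_iff) (auto simp: before_def)
    have qn: "?r q < n" using pq permutes_in_image[OF P, of q] by simp
    have wp: "w_perm n \<eta> permutes {..<n}" by (simp add: w_perm_eq less.prems permutes_inv[OF P])
    have "inversions n (w_perm n \<eta>) < inversions n (w_perm n \<eta> \<circ> swp (?r p) (?r q))"
      using less.prems by (intro inversions_swap lt qn wp) (simp add: w_perm_eq permutes_inverses[OF P])
    then have "bruhat_step n (w_perm n \<eta>) (w_perm n (\<eta> \<circ> swp p q))"
      unfolding bruhat_step_def using lt qn wp w by metis
    then show ?thesis unfolding bruhat_lt_def by blast
  qed
qed

text \<open>The Bruhat comparison in \<open>prec\<close> is reversed: moving a larger entry to the
  right lengthens \<open>w_perm\<close> and lowers the index.\<close>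

lemma prec_swap:
  assumes "\<eta> \<in> multi_idx n" "p < q" "q < n" "\<eta> q < \<eta> p"
  shows "prec n (\<eta> \<circ> swp p q) \<eta>"
  unfolding prec_def using bruhat_swap[OF assms] plus_part_perm[OF assms(1) swp_permutes[of p n q]] assms by simp

lemma dom_lt_trans:
  assumes "dom_lt n a b" "dom_lt n b c" "a \<in> multi_idx n" "b \<in> multi_idx n"
  shows "dom_lt n a c"
proof -
  have "a \<noteq> c"
  proof
    assume "a = c"
    then have e: "(\<Sum>i<m. a i) = (\<Sum>i<m. b i)" if "m \<le> n" for m
      using assms that unfolding dom_lt_def by (metis le_antisym)
    have "a i = b i" if "i < n" for i using e[of i] e[of "Suc i"] that by simp
    then have "a = b" using assms(3,4) by (intro multi_idx_eqI)
    then show False using assms(1) by (simp add: dom_lt_def)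
  qed
  then show ?thesis using assms unfolding dom_lt_def by (auto intro: order_trans)
qed

lemma prec_trans:
  assumes "prec n a b" "prec n b c" "a \<in> multi_idx n" "b \<in> multi_idx n"
  shows "prec n a c"
proof -
  have "plus_part n a \<in> multi_idx n" "plus_part n b \<in> multi_idx n"
    using plus_part_rnk(2) assms by (auto simp: is_partition_def)
  then show ?thesis
    using assms(1,2) dom_lt_trans[of n "plus_part n a" "plus_part n b" "plus_part n c"]
    unfolding prec_def bruhat_lt_def by (auto intro: tranclp_trans)
qed

lemma prec_irrefl: "\<not> prec n a a"
  unfolding prec_def dom_lt_def using bruhat_lt_inversions by blast

lemma prec_absv: "prec n a b \<Longrightarrow> a \<in> multi_idx n \<Longrightarrow> b \<in> multi_idx n \<Longrightarrow> absv n a = absv n b"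
  unfolding prec_def dom_lt_def using absv_plus_part by metis

section \<open>Separation of the spectra\<close>

lemma eigval_rnk: "j < n \<Longrightarrow> eigval n k \<eta> j = real (\<eta> j) - k * real (rnk n \<eta> j)"
proof -
  assume j: "j < n"
  have "{i. i < n \<and> before \<eta> i j} = {i. i < j \<and> \<eta> j \<le> \<eta> i} \<union> {i. j < i \<and> i < n \<and> \<eta> j < \<eta> i}"
    using j by (auto simp: before_def) (metis linorder_neqE_nat less_irrefl)
  moreover have "card ({i. i < j \<and> \<eta> j \<le> \<eta> i} \<union> {i. j < i \<and> i < n \<and> \<eta> j < \<eta> i})
    = card {i. i < j \<and> \<eta> j \<le> \<eta> i} + card {i. j < i \<and> i < n \<and> \<eta> j < \<eta> i}"
    by (rule card_Un_disjoint) auto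
  ultimately show ?thesis using j by (simp add: eigval_def rnk_def algebra_simps)
qed

text \<open>For k > 0 the eigenvalues strictly decrease along \<open>before\<close>, so comparing
  them recovers the ranks and then the entries; for k = 0 they are the entries. The permutation is
  the identity when spectra are separated and an adjacent transposition in
  \<open>jackE_sw_pt_expand\<close>.\<close>

lemma eigval_inj:
  assumes "0 \<le> k" "\<tau> \<in> multi_idx n" "\<kappa> \<in> multi_idx n" "\<sigma> permutes {..<n}"
    and e: "\<And>j. j < n \<Longrightarrow> eigval n k \<tau> j = eigval n k \<kappa> (\<sigma> j)"
  shows "\<tau> = \<kappa> \<circ> \<sigma>"
proof (rule multi_idx_eqI[OF assms(2) multi_idx_perm[OF assms(3,4)]])
  fix j assume j: "j < n"
  have sn: "\<sigma> i < n" if "i < n" for i using that permutes_in_image[OF assms(4), of i] by simp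
  show "\<tau> j = (\<kappa> \<circ> \<sigma>) j"
  proof (cases "k = 0")
    case True then show ?thesis using e[OF j] j sn by (simp add: eigval_rnk)
  next
    case False
    then have k: "0 < k" using assms(1) by simp
    have lt: "eigval n k \<eta> j < eigval n k \<eta> i" if "before \<eta> i j" "i < n" "j < n" for \<eta> i j
    proof -
      have "rnk n \<eta> i < rnk n \<eta> j" using that rnk_less_iff by blast
      then have "k * real (rnk n \<eta> i) < k * real (rnk n \<eta> j)" using k by simp
      moreover have "\<eta> j \<le> \<eta> i" using that by (auto simp: before_def)
      ultimately show ?thesis using that by (simp add: eigval_rnk)
    qed
    have iff: "before \<eta> i j \<longleftrightarrow> eigval n k \<eta> j < eigval n k \<eta> i" if "i < n" "j < n" for \<eta> i j
      using lt[of \<eta> i j] lt[of \<eta> j i] before_total[of i j \<eta>] that by fastforce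
    have "rnk n \<tau> = rnk n \<kappa> \<circ> \<sigma>"
    proof (rule rnk_unique[symmetric])
      show "rnk n \<kappa> \<circ> \<sigma> permutes {..<n}" by (intro permutes_compose assms(4) rnk_permutes)
      fix i j assume "i < n" "j < n"
      then show "(rnk n \<kappa> \<circ> \<sigma>) i < (rnk n \<kappa> \<circ> \<sigma>) j \<longleftrightarrow> before \<tau> i j"
        by (simp add: rnk_less_iff sn iff e)
    qed
    then show ?thesis using e[OF j] j sn by (simp add: eigval_rnk)
  qed
qed

subsection \<open>Dunkl operators on partially differentiable functions\<close>

text \<open>Complex differentiability along every coordinate line separately: just enough for the
  \<open>deriv\<close> inside \<open>dir_deriv\<close> to obey the usual rules.\<close>

definition dir_diff :: "((nat \<Rightarrow> complex) \<Rightarrow> complex) \<Rightarrow> bool" where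
  "dir_diff f \<longleftrightarrow> (\<forall>x j. (\<lambda>t. f (\<lambda>m. x m + t * unit_vec j m)) field_differentiable at 0)"

lemma unit_vec_apply: "unit_vec j m = (if m = j then 1 else 0)"
  by (simp add: unit_vec_def)

lemma dir_diff_DERIV:
  "dir_diff f \<Longrightarrow> ((\<lambda>t. f (\<lambda>m. x m + t * unit_vec j m)) has_field_derivative dir_deriv (unit_vec j) f x) (at 0)"
  unfolding dir_diff_def dir_deriv_def by (simp add: DERIV_deriv_iff_field_differentiable)

lemma dir_derivI:
  "((\<lambda>t. f (\<lambda>m. x m + t * unit_vec j m)) has_field_derivative D) (at 0) \<Longrightarrow> dir_deriv (unit_vec j) f x = D"
  unfolding dir_deriv_def by (rule DERIV_imp_deriv)

lemma admI:
  "(\<And>x j. \<exists>D. ((\<lambda>t. f (\<lambda>m. x m + t * unit_vec j m)) has_field_derivative D) (at 0)) \<Longrightarrow> dir_diff f"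
  unfolding dir_diff_def field_differentiable_def by blast

lemma dir_diff_const [intro, simp]: "dir_diff (\<lambda>_. c)"
  by (rule admI, rule exI[of _ 0]) simp

lemma dir_deriv_const [simp]: "dir_deriv (unit_vec j) (\<lambda>_. c) x = 0"
  by (rule dir_derivI) simp

lemma DERIV_coord: "((\<lambda>t. x l + t * unit_vec j l) has_field_derivative unit_vec j l) (at 0)"
  by (auto intro!: derivative_eq_intros)

lemma dir_diff_coord [intro, simp]: "dir_diff (\<lambda>x. x l)"
  using DERIV_coord by (intro admI) blast

lemma dir_deriv_coord: "dir_deriv (unit_vec j) (\<lambda>x. x l) x = unit_vec j l"
  by (intro dir_derivI DERIV_coord)

lemma dir_diff_add [intro]: "dir_diff f \<Longrightarrow> dir_diff g \<Longrightarrow> dir_diff (\<lambda>x. f x + g x)"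
  unfolding dir_diff_def by (auto intro: field_differentiable_add)

lemma dir_deriv_add: "dir_diff f \<Longrightarrow> dir_diff g \<Longrightarrow>
  dir_deriv (unit_vec j) (\<lambda>x. f x + g x) x = dir_deriv (unit_vec j) f x + dir_deriv (unit_vec j) g x"
  by (intro dir_derivI DERIV_add dir_diff_DERIV)

lemma dir_diff_diff [intro]: "dir_diff f \<Longrightarrow> dir_diff g \<Longrightarrow> dir_diff (\<lambda>x. f x - g x)"
  unfolding dir_diff_def by (auto intro: field_differentiable_diff)

lemma dir_deriv_diff: "dir_diff f \<Longrightarrow> dir_diff g \<Longrightarrow>
  dir_deriv (unit_vec j) (\<lambda>x. f x - g x) x = dir_deriv (unit_vec j) f x - dir_deriv (unit_vec j) g x"
  by (intro dir_derivI DERIV_diff dir_diff_DERIV)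

lemma dir_diff_mult [intro]: "dir_diff f \<Longrightarrow> dir_diff g \<Longrightarrow> dir_diff (\<lambda>x. f x * g x)"
  unfolding dir_diff_def by (auto intro: field_differentiable_mult)

lemma dir_deriv_mult: "dir_diff f \<Longrightarrow> dir_diff g \<Longrightarrow>
  dir_deriv (unit_vec j) (\<lambda>x. f x * g x) x = dir_deriv (unit_vec j) f x * g x + f x * dir_deriv (unit_vec j) g x"
  by (rule dir_derivI) (use DERIV_mult[OF dir_diff_DERIV dir_diff_DERIV, of f g x j x j] in \<open>simp add: mult.commute add.commute\<close>)

lemma dir_deriv_cmult: "dir_diff f \<Longrightarrow>
  dir_deriv (unit_vec j) (\<lambda>x. c * f x) x = c * dir_deriv (unit_vec j) f x"
  using dir_deriv_mult[of "\<lambda>_. c" f j x] by simp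

lemma dir_diff_sum [intro]: "(\<And>i. i \<in> S \<Longrightarrow> dir_diff (f i)) \<Longrightarrow> dir_diff (\<lambda>x. \<Sum>i\<in>S. f i x)"
  by (induction S rule: infinite_finite_induct) auto

lemma dir_diff_prod [intro]: "(\<And>i. i \<in> S \<Longrightarrow> dir_diff (f i)) \<Longrightarrow> dir_diff (\<lambda>x. \<Prod>i\<in>S. f i x)"
  by (induction S rule: infinite_finite_induct) auto

lemma dir_diff_power [intro]: "dir_diff f \<Longrightarrow> dir_diff (\<lambda>x. f x ^ m)"
  by (induction m) auto

lemma dir_diff_monom [intro, simp]: "dir_diff (monom n \<eta>)"
  unfolding monom_def[abs_def] by (intro dir_diff_prod dir_diff_power dir_diff_coord)

lemma shift_perm:
  assumes "\<sigma> permutes S"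
  shows "(\<lambda>m. x m + t * unit_vec (\<sigma> b) m) \<circ> \<sigma> = (\<lambda>m. (x \<circ> \<sigma>) m + t * unit_vec b m)"
  by (auto simp: fun_eq_iff unit_vec_apply inj_eq[OF permutes_inj[OF assms]])

lemma dir_diff_perm [intro]:
  assumes "dir_diff f" "\<sigma> permutes S" shows "dir_diff (\<lambda>x. f (x \<circ> \<sigma>))"
  unfolding dir_diff_def
proof (intro allI)
  fix x j
  have "(\<lambda>m. x m + t * unit_vec j m) \<circ> \<sigma> = (\<lambda>m. (x \<circ> \<sigma>) m + t * unit_vec (inv \<sigma> j) m)" for t
    using shift_perm[OF assms(2), of x t "inv \<sigma> j"] by (simp add: permutes_inverses[OF assms(2)])
  then show "(\<lambda>t. f ((\<lambda>m. x m + t * unit_vec j m) \<circ> \<sigma>)) field_differentiable at 0"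
    using assms(1) unfolding dir_diff_def by simp
qed

lemma dir_deriv_perm:
  "\<sigma> permutes S \<Longrightarrow> dir_deriv (unit_vec (\<sigma> b)) (\<lambda>x. f (x \<circ> \<sigma>)) x = dir_deriv (unit_vec b) f (x \<circ> \<sigma>)"
  unfolding dir_deriv_def by (simp add: shift_perm)

lemma swp_permutes_UNIV: "swp i j permutes UNIV"
  unfolding swp_eq_transpose by (rule permutes_swap_id) auto

lemma dir_diff_sw_pt [intro]: "dir_diff f \<Longrightarrow> dir_diff (\<lambda>x. f (sw_pt i j x))"
  unfolding sw_pt_def using swp_permutes_UNIV by (intro dir_diff_perm)

lemma sw_pt_commute: "sw_pt i j x = sw_pt j i x"
  by (simp add: sw_pt_def swp_commute)

lemma sw_pt_same: "x i = x j \<Longrightarrow> sw_pt i j x = x"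
  by (auto simp: sw_pt_def swp_def fun_eq_iff)

section \<open>Difference quotients and Dunkl operators\<close>

lemma diff_quot_anti: "diff_quot i j f x = - diff_quot j i f x"
  by (simp add: diff_quot_def sw_pt_commute[of i j] minus_divide_right)

lemma diff_quot_add: "dir_diff f \<Longrightarrow> dir_diff g \<Longrightarrow>
  diff_quot i j (\<lambda>x. f x + g x) x = diff_quot i j f x + diff_quot i j g x"
  by (simp add: diff_quot_def dir_deriv_add add_divide_distrib[symmetric])

lemma diff_quot_cmult: "dir_diff f \<Longrightarrow> diff_quot i j (\<lambda>x. c * f x) x = c * diff_quot i j f x"
  by (simp add: diff_quot_def dir_deriv_cmult algebra_simps)

text \<open>A Leibniz rule: the extra term measures how far x l is from being invariant under
  exchanging x a and x b. It takes the same form on the hyperplane x a = x b, where the quotient is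
  a derivative.\<close>

lemma diff_quot_coord_mult:
  assumes "dir_diff f" "a \<noteq> b"
  shows "diff_quot a b (\<lambda>x. x l * f x) x = x l * diff_quot a b f x +
    (if l = a then f (sw_pt a b x) else if l = b then - f (sw_pt a b x) else 0)"
proof (cases "x a = x b")
  case True
  then show ?thesis using assms
    by (simp add: diff_quot_def dir_deriv_mult dir_deriv_coord sw_pt_same unit_vec_apply algebra_simps)
next
  case False
  then have ne: "x a - x b \<noteq> 0" by simp
  have "sw_pt a b x l = (if l = a then x b else if l = b then x a else x l)"
    by (auto simp: sw_pt_def)
  then show ?thesis using False ne assms(2)
    by (auto simp: diff_quot_def field_simps)
qed

lemma sw_pt_perm:
  assumes "\<sigma> permutes S" shows "sw_pt (\<sigma> a) (\<sigma> b) x \<circ> \<sigma> = sw_pt a b (x \<circ> \<sigma>)"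
  unfolding sw_pt_def comp_assoc perm_comp_swp[OF assms] ..

lemma diff_quot_perm:
  assumes "\<sigma> permutes S"
  shows "diff_quot (\<sigma> a) (\<sigma> b) (\<lambda>x. f (x \<circ> \<sigma>)) x = diff_quot a b f (x \<circ> \<sigma>)"
  by (simp add: diff_quot_def dir_deriv_perm[OF assms] sw_pt_perm[OF assms])

text \<open>Off the hyperplane one divides. On it, differentiating the identity in direction i
  leaves q, because the factor x i - x j vanishes there. A quotient known as a polynomial identity
  is thus correct at every point.\<close>

lemma diff_quot_eqI:
  assumes f: "dir_diff f" and q: "dir_diff q" and "i \<noteq> j"
    and eq: "\<And>x. f x - f (sw_pt i j x) = (x i - x j) * q x"
  shows "diff_quot i j f x = q x"
proof (cases "x i = x j")
  case False then show ?thesis by (simp add: diff_quot_def eq)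
next
  case True
  have "dir_deriv (unit_vec i) (\<lambda>x. f (sw_pt i j x)) x = dir_deriv (unit_vec j) f x"
    using dir_deriv_perm[OF swp_permutes_UNIV, of i j j f x] sw_pt_same[OF True] by (simp add: sw_pt_def)
  then have "dir_deriv (unit_vec i) f x - dir_deriv (unit_vec j) f x
      = dir_deriv (unit_vec i) (\<lambda>x. f x - f (sw_pt i j x)) x"
    using f by (simp add: dir_deriv_diff dir_diff_sw_pt)
  also have "\<dots> = dir_deriv (unit_vec i) (\<lambda>x. (x i - x j) * q x) x" by (simp add: eq)
  also have "\<dots> = q x"
    using q True assms(3) by (simp add: dir_deriv_mult dir_diff_diff dir_deriv_diff dir_deriv_coord unit_vec_apply)
  finally show ?thesis using True by (simp add: diff_quot_def)
qed

text \<open>In a coordinate direction only pairs containing a survive, and antisymmetry of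
  \<open>diff_quot\<close> compensates for the orientation of the pair. The map h lists these pairs
  by their other member.\<close>

lemma dunkl_unit:
  assumes "a < n"
  shows "dunkl n k (unit_vec a) f x = dir_deriv (unit_vec a) f x +
    of_real k * (\<Sum>b\<in>{..<n} - {a}. diff_quot a b f x)"
proof -
  let ?A = "{(i, j). i < j \<and> j < n}"
  let ?g = "\<lambda>(i, j). (unit_vec a i - unit_vec a j) * diff_quot i j f x"
  define h where "h b = (if b < a then (b, a) else (a, b))" for b
  have fin: "finite ?A" by (rule finite_subset[of _ "{..<n} \<times> {..<n}"]) auto
  have inj: "inj_on h ({..<n} - {a})" by (auto simp: inj_on_def h_def split: if_splits)
  have sub: "h ` ({..<n} - {a}) \<subseteq> ?A" using assms by (auto simp: h_def)
  have zero: "?g p = 0" if p: "p \<in> ?A - h ` ({..<n} - {a})" for p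
  proof -
    obtain i j where ij: "p = (i, j)" "i < j" "j < n" using p by auto
    have "i \<noteq> a"
    proof
      assume "i = a"
      then have "p = h j" "j \<in> {..<n} - {a}" using ij by (auto simp: h_def)
      then show False using p by blast
    qed
    moreover have "j \<noteq> a"
    proof
      assume "j = a"
      then have "p = h i" "i \<in> {..<n} - {a}" using ij assms by (auto simp: h_def)
      then show False using p by blast
    qed
    ultimately show ?thesis using ij by (simp add: unit_vec_apply)
  qed
  have "sum ?g ?A = sum ?g (h ` ({..<n} - {a}))"
    using fin sub zero by (intro sum.mono_neutral_right) auto
  also have "\<dots> = (\<Sum>b\<in>{..<n} - {a}. ?g (h b))" by (simp add: sum.reindex[OF inj])
  also have "\<dots> = (\<Sum>b\<in>{..<n} - {a}. diff_quot a b f x)"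
    by (intro sum.cong) (auto simp: h_def unit_vec_apply diff_quot_anti[of _ a])
  finally show ?thesis by (simp add: dunkl_def)
qed

lemma dunkl_add:
  assumes "a < n" "dir_diff f" "dir_diff g"
  shows "dunkl n k (unit_vec a) (\<lambda>x. f x + g x) x = dunkl n k (unit_vec a) f x + dunkl n k (unit_vec a) g x"
  using assms by (simp add: dunkl_unit dir_deriv_add diff_quot_add sum.distrib algebra_simps)

lemma dunkl_cmult:
  assumes "a < n" "dir_diff f"
  shows "dunkl n k (unit_vec a) (\<lambda>x. c * f x) x = c * dunkl n k (unit_vec a) f x"
  using assms by (simp add: dunkl_unit dir_deriv_cmult diff_quot_cmult sum_distrib_left[symmetric] algebra_simps)

lemma dunkl_zero: "a < n \<Longrightarrow> dunkl n k (unit_vec a) (\<lambda>x. 0) x = 0"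
  using dunkl_cmult[of a n "\<lambda>_. 0" k 0 x] by simp

lemma dunkl_sum:
  assumes "a < n" "\<And>i. i \<in> S \<Longrightarrow> dir_diff (f i)"
  shows "dunkl n k (unit_vec a) (\<lambda>x. \<Sum>i\<in>S. c i * f i x) x = (\<Sum>i\<in>S. c i * dunkl n k (unit_vec a) (f i) x)"
  using assms(2)
proof (induction S rule: infinite_finite_induct)
  case (insert i S)
  then have "dir_diff (\<lambda>x. c i * f i x)" "dir_diff (\<lambda>x. \<Sum>i\<in>S. c i * f i x)"
    by (auto intro!: dir_diff_sum dir_diff_mult)
  then show ?case using insert assms(1) by (simp add: dunkl_add dunkl_cmult)
qed (use assms(1) dunkl_zero in auto)

text \<open>Together with \<open>dunkl_coord_mult_other\<close>, this is the commutation relation of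
  Dunkl operators with coordinates in the rational Cherednik algebra.\<close>

lemma dunkl_coord_mult_same:
  assumes "a < n" "dir_diff f"
  shows "dunkl n k (unit_vec a) (\<lambda>x. x a * f x) x = x a * dunkl n k (unit_vec a) f x + f x
    + of_real k * (\<Sum>b\<in>{..<n} - {a}. f (sw_pt a b x))"
proof -
  have "(\<Sum>b\<in>{..<n} - {a}. diff_quot a b (\<lambda>x. x a * f x) x)
    = (\<Sum>b\<in>{..<n} - {a}. x a * diff_quot a b f x + f (sw_pt a b x))"
    using assms by (intro sum.cong refl) (auto simp: diff_quot_coord_mult)
  then show ?thesis using assms
    by (simp add: dunkl_unit dir_deriv_mult dir_deriv_coord unit_vec_apply sum.distrib sum_distrib_left[symmetric] algebra_simps)
qed

lemma dunkl_coord_mult_other: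
  assumes "a < n" "b < n" "a \<noteq> b" "dir_diff f"
  shows "dunkl n k (unit_vec a) (\<lambda>x. x b * f x) x = x b * dunkl n k (unit_vec a) f x - of_real k * f (sw_pt a b x)"
proof -
  have "(\<Sum>c\<in>{..<n} - {a}. diff_quot a c (\<lambda>x. x b * f x) x)
    = (\<Sum>c\<in>{..<n} - {a}. x b * diff_quot a c f x + (if c = b then - f (sw_pt a b x) else 0))"
    using assms by (intro sum.cong refl) (auto simp: diff_quot_coord_mult)
  also have "\<dots> = x b * (\<Sum>c\<in>{..<n} - {a}. diff_quot a c f x) - f (sw_pt a b x)"
    using assms by (simp add: sum.distrib sum_distrib_left[symmetric])
  finally have e: "(\<Sum>c\<in>{..<n} - {a}. diff_quot a c (\<lambda>x. x b * f x) x)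
    = x b * (\<Sum>c\<in>{..<n} - {a}. diff_quot a c f x) - f (sw_pt a b x)" .
  show ?thesis unfolding dunkl_unit[OF assms(1)] e using assms
    by (simp add: dir_deriv_mult dir_deriv_coord unit_vec_apply algebra_simps)
qed

text \<open>Equivariance under the symmetric group; it is what lets the cyclic shifts in
  \<open>Phi_op\<close> and \<open>Psi_op\<close> turn one Dunkl operator into the next.\<close>

lemma dunkl_perm:
  assumes s: "\<sigma> permutes {..<n}" and "b < n"
  shows "dunkl n k (unit_vec (\<sigma> b)) (\<lambda>x. f (x \<circ> \<sigma>)) x = dunkl n k (unit_vec b) f (x \<circ> \<sigma>)"
proof -
  have sb: "\<sigma> b < n" using assms permutes_in_image[OF s, of b] by simp
  have "bij_betw \<sigma> ({..<n} - {b}) ({..<n} - {\<sigma> b})"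
    by (rule bij_betw_DiffI[OF permutes_imp_bij[OF s], of "{b}" "{\<sigma> b}"]) (use assms sb in auto)
  from sum.reindex_bij_betw[OF this, of "\<lambda>c. diff_quot (\<sigma> b) c (\<lambda>x. f (x \<circ> \<sigma>)) x"]
  have "(\<Sum>c\<in>{..<n} - {\<sigma> b}. diff_quot (\<sigma> b) c (\<lambda>x. f (x \<circ> \<sigma>)) x) = (\<Sum>c\<in>{..<n} - {b}. diff_quot b c f (x \<circ> \<sigma>))"
    by (simp add: diff_quot_perm[OF s])
  then show ?thesis using assms sb by (simp add: dunkl_unit dir_deriv_perm[OF s])
qed

lemma cher_D_sum:
  assumes "j < n" "\<And>i. i \<in> S \<Longrightarrow> dir_diff (f i)"
  shows "cher_D n k j (\<lambda>x. \<Sum>i\<in>S. c i * f i x) x = (\<Sum>i\<in>S. c i * cher_D n k j (f i) x)"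
proof -
  have "cher_D n k j (\<lambda>x. \<Sum>i\<in>S. c i * f i x) x = x j * (\<Sum>i\<in>S. c i * dunkl n k (unit_vec j) (f i) x)
    + of_real k * (1 - of_nat n) * (\<Sum>i\<in>S. c i * f i x)
    + of_real k * (\<Sum>i\<in>S. \<Sum>l\<in>{j<..<n}. c i * f i (sw_pt l j x))"
  proof -
    have 1: "dunkl n k (unit_vec j) (\<lambda>x. \<Sum>i\<in>S. c i * f i x) x
      = (\<Sum>i\<in>S. c i * dunkl n k (unit_vec j) (f i) x)"
      by (rule dunkl_sum[OF assms])
    show ?thesis unfolding cher_D_def 1 sum.swap[of _ "{j<..<n}" S] ..
  qed
  also have "\<dots> = (\<Sum>i\<in>S. c i * cher_D n k j (f i) x)"
    unfolding cher_D_def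
    by (simp add: sum_distrib_left sum.distrib[symmetric] algebra_simps)
  finally show ?thesis .
qed

lemma cher_D_add:
  assumes "j < n" "dir_diff f" "dir_diff g"
  shows "cher_D n k j (\<lambda>x. f x + c * g x) x = cher_D n k j f x + c * cher_D n k j g x"
  using assms by (simp add: cher_D_def dunkl_add dunkl_cmult dir_diff_mult sum.distrib sum_distrib_left algebra_simps)

text \<open>Subtracting \<open>ev j \<rho>\<close> times the relation from its image under
  \<open>op j\<close> removes the term of \<rho> and multiplies that of \<kappa> by a nonzero factor
  when j separates the two. The operators are left abstract to cover both monomials and Jack
  polynomials.\<close>

lemma eigenfunctions_independent:
  fixes f :: "'i \<Rightarrow> 'p \<Rightarrow> complex" and op :: "nat \<Rightarrow> ('p \<Rightarrow> complex) \<Rightarrow> 'p \<Rightarrow> complex"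
  assumes "finite S"
    and lin: "\<And>j c S'. j < n \<Longrightarrow> S' \<subseteq> S \<Longrightarrow> op j (\<lambda>x. \<Sum>\<kappa>\<in>S'. c \<kappa> * f \<kappa> x) = (\<lambda>x. \<Sum>\<kappa>\<in>S'. c \<kappa> * op j (f \<kappa>) x)"
    and eig: "\<And>j \<kappa> x. j < n \<Longrightarrow> \<kappa> \<in> S \<Longrightarrow> op j (f \<kappa>) x = ev j \<kappa> * f \<kappa> x"
    and sep: "\<And>\<kappa> \<kappa>'. \<kappa> \<in> S \<Longrightarrow> \<kappa>' \<in> S \<Longrightarrow> \<kappa> \<noteq> \<kappa>' \<Longrightarrow> \<exists>j<n. ev j \<kappa> \<noteq> ev j \<kappa>'"
    and nz: "\<And>\<kappa>. \<kappa> \<in> S \<Longrightarrow> \<exists>x. f \<kappa> x \<noteq> 0"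
    and zero: "\<And>x. (\<Sum>\<kappa>\<in>S. c \<kappa> * f \<kappa> x) = 0"
  shows "\<forall>\<kappa>\<in>S. c \<kappa> = 0"
proof -
  have "\<forall>\<kappa>\<in>S'. c \<kappa> = 0" if "S' \<subseteq> S" "\<And>x. (\<Sum>\<kappa>\<in>S'. c \<kappa> * f \<kappa> x) = 0" for S' c
    using finite_subset[OF that(1) assms(1)] that
  proof (induction S' arbitrary: c rule: finite_induct)
    case (insert \<rho> S')
    have z: "(\<lambda>x. \<Sum>\<kappa>\<in>insert \<rho> S'. c \<kappa> * f \<kappa> x) = (\<lambda>x. 0)" using insert by auto
    have S'c: "c \<kappa> = 0" if \<kappa>: "\<kappa> \<in> S'" for \<kappa>
    proof -
      have "\<kappa> \<noteq> \<rho>" "\<kappa> \<in> S" "\<rho> \<in> S" using \<kappa> insert by auto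
      then obtain j where j: "j < n" "ev j \<kappa> \<noteq> ev j \<rho>" using sep by blast
      have "op j (\<lambda>x. 0) = (\<lambda>x. 0)" using lin[OF j(1), of "{}"] by simp
      then have "(\<Sum>\<kappa>\<in>insert \<rho> S'. c \<kappa> * op j (f \<kappa>) x) = 0" for x
        using lin[OF j(1) insert.prems(1), of c] unfolding z by (metis (no_types))
      moreover have "(\<Sum>\<kappa>\<in>insert \<rho> S'. c \<kappa> * op j (f \<kappa>) x) = (\<Sum>\<kappa>\<in>insert \<rho> S'. c \<kappa> * (ev j \<kappa> * f \<kappa> x))" for x
        using insert.prems(1) j by (intro sum.cong refl) (auto simp: eig)
      ultimately have 1: "(\<Sum>\<kappa>\<in>insert \<rho> S'. c \<kappa> * (ev j \<kappa> * f \<kappa> x)) = 0" for x by metis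
      have "(\<Sum>\<kappa>\<in>S'. ((ev j \<kappa> - ev j \<rho>) * c \<kappa>) * f \<kappa> x) = 0" for x
      proof -
        have "(\<Sum>\<kappa>\<in>insert \<rho> S'. ((ev j \<kappa> - ev j \<rho>) * c \<kappa>) * f \<kappa> x)
          = (\<Sum>\<kappa>\<in>insert \<rho> S'. c \<kappa> * (ev j \<kappa> * f \<kappa> x)) - ev j \<rho> * (\<Sum>\<kappa>\<in>insert \<rho> S'. c \<kappa> * f \<kappa> x)"
          by (simp only: sum_distrib_left sum_subtractf[symmetric]) (simp add: algebra_simps)
        also have "\<dots> = 0" using 1[of x] insert.prems(2)[of x] by simp
        finally show ?thesis using insert.hyps by simp
      qed
      then have "(ev j \<kappa> - ev j \<rho>) * c \<kappa> = 0"
        using insert.IH[of "\<lambda>\<kappa>. (ev j \<kappa> - ev j \<rho>) * c \<kappa>"] insert.prems(1) \<kappa> by blast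
      then show ?thesis using j by simp
    qed
    moreover obtain x where x: "f \<rho> x \<noteq> 0" using nz insert.prems(1) by blast
    then have "c \<rho> = 0" using insert.prems(2)[of x] insert.hyps S'c by simp
    ultimately show ?case by blast
  qed auto
  from this[OF subset_refl zero] show ?thesis .
qed

section \<open>Monomials\<close>

lemma monom_split:
  assumes "j < n" shows "monom n \<eta> x = x j ^ \<eta> j * (\<Prod>i\<in>{..<n} - {j}. x i ^ \<eta> i)"
  unfolding monom_def using assms by (subst prod.remove[of _ j]) auto

lemma coord_mult_monom:
  assumes "j < n" shows "x j * monom n \<eta> x = monom n (\<eta>(j := Suc (\<eta> j))) x"
  unfolding monom_split[OF assms] by (simp add: ac_simps)

lemma monom_perm:
  assumes "\<sigma> permutes {..<n}" shows "monom n (\<eta> \<circ> \<sigma>) (x \<circ> \<sigma>) = monom n \<eta> x"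
  unfolding monom_def using prod.permute[OF assms, of "\<lambda>i. x i ^ \<eta> i"] by (simp add: o_def)

lemma monom_sw_pt:
  assumes "i < n" "j < n" shows "monom n \<eta> (sw_pt i j x) = monom n (\<eta> \<circ> swp i j) x"
  using monom_perm[OF swp_permutes[OF assms], of "\<eta> \<circ> swp i j" x] unfolding sw_pt_def by simp

lemma dir_deriv_monom:
  assumes "j < n"
  shows "dir_deriv (unit_vec j) (monom n \<eta>) x = of_nat (\<eta> j) * monom n (\<eta>(j := \<eta> j - 1)) x"
proof -
  let ?c = "\<Prod>i\<in>{..<n} - {j}. x i ^ \<eta> i"
  have "monom n \<eta> (\<lambda>m. x m + t * unit_vec j m) = (x j + t) ^ \<eta> j * ?c" for t
    unfolding monom_split[OF assms] by (intro arg_cong2[of _ _ _ _ "(*)"] prod.cong) (auto simp: unit_vec_apply)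
  moreover have "((\<lambda>t. (x j + t) ^ \<eta> j * ?c) has_field_derivative of_nat (\<eta> j) * x j ^ (\<eta> j - 1) * ?c) (at 0)"
    by (auto intro!: derivative_eq_intros)
  ultimately have "dir_deriv (unit_vec j) (monom n \<eta>) x = of_nat (\<eta> j) * x j ^ (\<eta> j - 1) * ?c"
    by (intro dir_derivI) simp
  then show ?thesis unfolding monom_split[OF assms] by simp
qed

lemma coord_mult_dir_deriv_monom:
  assumes "j < n" shows "x j * dir_deriv (unit_vec j) (monom n \<eta>) x = of_nat (\<eta> j) * monom n \<eta> x"
proof (cases "\<eta> j")
  case (Suc m)
  then have "x j * monom n (\<eta>(j := \<eta> j - 1)) x = monom n \<eta> x"
    unfolding coord_mult_monom[OF assms] by (simp add: fun_upd_idem)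
  then show ?thesis unfolding dir_deriv_monom[OF assms] by (simp only: mult.left_commute[of "x j"])
qed (simp add: dir_deriv_monom[OF assms])

text \<open>Monomials are joint eigenfunctions of x_j d/dx_j, and their exponents are the
  eigenvalues.\<close>

lemma monoms_independent:
  assumes "finite S" "S \<subseteq> multi_idx n" "\<And>x. (\<Sum>\<kappa>\<in>S. c \<kappa> * monom n \<kappa> x) = 0" "\<kappa> \<in> S"
  shows "c \<kappa> = 0"
proof -
  have dsum: "dir_deriv (unit_vec j) (\<lambda>x. \<Sum>\<kappa>\<in>S'. c \<kappa> * monom n \<kappa> x) x
    = (\<Sum>\<kappa>\<in>S'. c \<kappa> * dir_deriv (unit_vec j) (monom n \<kappa>) x)" for j c S' x
  proof (induction S' rule: infinite_finite_induct)
    case (insert i S)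
    then show ?case by (simp add: dir_deriv_add dir_deriv_cmult dir_diff_mult dir_diff_sum)
  qed auto
  have "\<forall>\<kappa>\<in>S. c \<kappa> = 0"
  proof (rule eigenfunctions_independent[where op = "\<lambda>j f x. x j * dir_deriv (unit_vec j) f x"
        and f = "monom n" and ev = "\<lambda>j \<kappa>. of_nat (\<kappa> j)" and n = n])
    fix \<kappa> \<kappa>' assume "\<kappa> \<in> S" "\<kappa>' \<in> S" "\<kappa> \<noteq> \<kappa>'"
    then show "\<exists>j<n. of_nat (\<kappa> j) \<noteq> (of_nat (\<kappa>' j) :: complex)"
      using multi_idx_eqI[of \<kappa> n \<kappa>'] assms(2) by (metis of_nat_eq_iff subsetD)
  next
    fix \<kappa> show "\<exists>x. monom n \<kappa> x \<noteq> 0" by (rule exI[of _ "\<lambda>_. 1"]) (simp add: monom_def)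
  qed (use assms in \<open>auto simp: dsum sum_distrib_left coord_mult_dir_deriv_monom intro!: ext sum.cong\<close>)
  then show ?thesis using assms(4) by blast
qed

lemma monoms_eq_iff:
  assumes "\<And>x. (\<Sum>\<kappa>\<in>deg_idx n m. c \<kappa> * monom n \<kappa> x) = (\<Sum>\<kappa>\<in>deg_idx n m. d \<kappa> * monom n \<kappa> x)" "\<kappa> \<in> deg_idx n m"
  shows "c \<kappa> = d \<kappa>"
proof -
  have "deg_idx n m \<subseteq> multi_idx n" by (auto simp: deg_idx_def)
  then have "c \<kappa> - d \<kappa> = 0"
    by (rule monoms_independent[of "deg_idx n m" n "\<lambda>\<kappa>. c \<kappa> - d \<kappa>", rotated])
      (use assms in \<open>auto simp: left_diff_distrib sum_subtractf\<close>)
  then show ?thesis by simp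
qed

subsection \<open>Triangularity of the Cherednik operators\<close>

text \<open>The coefficients vanish off A so that they extend to larger index sets in
  \<open>fspan_mono\<close> and meet the normalization demanded by \<open>coefs\<close>.\<close>

definition fspan :: "('i \<Rightarrow> 'p \<Rightarrow> complex) \<Rightarrow> 'i set \<Rightarrow> ('p \<Rightarrow> complex) \<Rightarrow> bool" where
  "fspan F A f \<longleftrightarrow> (\<exists>c. (\<forall>\<kappa>. \<kappa> \<notin> A \<longrightarrow> c \<kappa> = 0) \<and> (\<forall>x. f x = (\<Sum>\<kappa>\<in>A. c \<kappa> * F \<kappa> x)))"

lemma fspanI: "(\<And>x. f x = (\<Sum>\<kappa>\<in>A. c \<kappa> * F \<kappa> x)) \<Longrightarrow> fspan F A f"
  unfolding fspan_def by (rule exI[of _ "\<lambda>\<kappa>. if \<kappa> \<in> A then c \<kappa> else 0"]) (auto intro!: sum.cong)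

lemma fspan_zero: "fspan F A (\<lambda>x. 0)"
  by (rule fspanI[where c = "\<lambda>_. 0"]) simp

lemma fspan_add:
  assumes "fspan F A f" "fspan F A g" shows "fspan F A (\<lambda>x. f x + g x)"
proof -
  obtain c d where "\<And>x. f x = (\<Sum>\<kappa>\<in>A. c \<kappa> * F \<kappa> x)" "\<And>x. g x = (\<Sum>\<kappa>\<in>A. d \<kappa> * F \<kappa> x)"
    using assms unfolding fspan_def by blast
  then show ?thesis
    by (intro fspanI[where c = "\<lambda>\<kappa>. c \<kappa> + d \<kappa>"]) (simp add: distrib_right sum.distrib)
qed

lemma fspan_cmult:
  assumes "fspan F A f" shows "fspan F A (\<lambda>x. b * f x)"
proof -
  obtain c where "\<And>x. f x = (\<Sum>\<kappa>\<in>A. c \<kappa> * F \<kappa> x)"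
    using assms unfolding fspan_def by blast
  then show ?thesis
    by (intro fspanI[where c = "\<lambda>\<kappa>. b * c \<kappa>"]) (simp add: sum_distrib_left mult.assoc)
qed

lemma fspan_sum: "(\<And>i. i \<in> S \<Longrightarrow> fspan F A (f i)) \<Longrightarrow> fspan F A (\<lambda>x. \<Sum>i\<in>S. f i x)"
  by (induction S rule: infinite_finite_induct) (auto intro: fspan_zero fspan_add)

lemma fspan_mem: "finite A \<Longrightarrow> \<kappa> \<in> A \<Longrightarrow> fspan F A (F \<kappa>)"
proof (rule fspanI[where c = "\<lambda>\<tau>. if \<tau> = \<kappa> then 1 else 0"])
  fix x assume "finite A" "\<kappa> \<in> A"
  then have "(\<Sum>\<tau>\<in>A. if \<tau> = \<kappa> then F \<tau> x else 0) = F \<kappa> x" by simp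
  then show "F \<kappa> x = (\<Sum>\<tau>\<in>A. (if \<tau> = \<kappa> then 1 else 0) * F \<tau> x)"
    by (simp add: if_distrib[of "\<lambda>c. c * _"] cong: if_cong)
qed

lemma fspan_mono:
  assumes "fspan F A f" "A \<subseteq> B" "finite B"
  obtains c where "\<And>\<kappa>. \<kappa> \<notin> A \<Longrightarrow> c \<kappa> = 0" "\<And>x. f x = (\<Sum>\<kappa>\<in>B. c \<kappa> * F \<kappa> x)"
proof -
  obtain c where c: "\<And>\<kappa>. \<kappa> \<notin> A \<Longrightarrow> c \<kappa> = 0" "\<And>x. f x = (\<Sum>\<kappa>\<in>A. c \<kappa> * F \<kappa> x)"
    using assms(1) unfolding fspan_def by blast
  have "(\<Sum>\<kappa>\<in>A. c \<kappa> * F \<kappa> x) = (\<Sum>\<kappa>\<in>B. c \<kappa> * F \<kappa> x)" for x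
    using assms(2,3) c(1) by (intro sum.mono_neutral_left) auto
  then show ?thesis using c by (intro that[of c]) simp_all
qed

lemma fspan_monom_dir_diff: "fspan (monom n) A f \<Longrightarrow> dir_diff f"
proof -
  assume "fspan (monom n) A f"
  then obtain c where "\<And>x. f x = (\<Sum>\<kappa>\<in>A. c \<kappa> * monom n \<kappa> x)" unfolding fspan_def by blast
  then have "f = (\<lambda>x. \<Sum>\<kappa>\<in>A. c \<kappa> * monom n \<kappa> x)" by auto
  moreover have "dir_diff (\<lambda>x. \<Sum>\<kappa>\<in>A. c \<kappa> * monom n \<kappa> x)" by (intro dir_diff_sum dir_diff_mult dir_diff_const dir_diff_monom)
  ultimately show ?thesis by simp
qed

definition low_idx :: "nat \<Rightarrow> (nat \<Rightarrow> nat) \<Rightarrow> (nat \<Rightarrow> nat) set" where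
  "low_idx n \<eta> = {\<kappa> \<in> multi_idx n. prec n \<kappa> \<eta>}"

lemma low_idx_subset: "\<eta> \<in> multi_idx n \<Longrightarrow> low_idx n \<eta> \<subseteq> deg_idx n (absv n \<eta>)"
  unfolding low_idx_def deg_idx_def using prec_absv by auto

lemma finite_low_idx: "\<eta> \<in> multi_idx n \<Longrightarrow> finite (low_idx n \<eta>)"
  using low_idx_subset finite_deg_idx finite_subset by metis

text \<open>A geometric sum: multiplied by x j - x i it telescopes from the monomial at l = 0 to its
  reflection at l = \<eta> j - \<eta> i.\<close>

lemma diff_quot_monom_greater:
  assumes "i < n" "j < n" "\<eta> i < \<eta> j"
  shows "diff_quot j i (monom n \<eta>) x = (\<Sum>l<\<eta> j - \<eta> i. monom n (\<eta>(j := \<eta> j - 1 - l, i := \<eta> i + l)) x)"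
proof (rule diff_quot_eqI[where q = "\<lambda>x. \<Sum>l<\<eta> j - \<eta> i. monom n (\<eta>(j := \<eta> j - 1 - l, i := \<eta> i + l)) x"])
  show ij: "j \<noteq> i" using assms by auto
  fix x :: "nat \<Rightarrow> complex"
  let ?d = "\<eta> j - \<eta> i"
  define m where "m l = monom n (\<eta>(j := \<eta> j - l, i := \<eta> i + l)) x" for l
  have 1: "x j * monom n (\<eta>(j := \<eta> j - 1 - l, i := \<eta> i + l)) x = m l" if "l < ?d" for l
  proof -
    have "(\<eta>(j := \<eta> j - 1 - l, i := \<eta> i + l))(j := Suc ((\<eta>(j := \<eta> j - 1 - l, i := \<eta> i + l)) j))
      = \<eta>(j := \<eta> j - l, i := \<eta> i + l)" using that ij by (auto simp: fun_eq_iff)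
    then show ?thesis unfolding coord_mult_monom[OF assms(2)] m_def by simp
  qed
  have 2: "x i * monom n (\<eta>(j := \<eta> j - 1 - l, i := \<eta> i + l)) x = m (Suc l)" if "l < ?d" for l
  proof -
    have "(\<eta>(j := \<eta> j - 1 - l, i := \<eta> i + l))(i := Suc ((\<eta>(j := \<eta> j - 1 - l, i := \<eta> i + l)) i))
      = \<eta>(j := \<eta> j - Suc l, i := \<eta> i + Suc l)" using that ij by (auto simp: fun_eq_iff)
    then show ?thesis unfolding coord_mult_monom[OF assms(1)] m_def by simp
  qed
  have "(x j - x i) * (\<Sum>l<?d. monom n (\<eta>(j := \<eta> j - 1 - l, i := \<eta> i + l)) x) = (\<Sum>l<?d. m l - m (Suc l))"
    unfolding sum_distrib_left by (intro sum.cong refl) (simp only: left_diff_distrib 1 2 lessThan_iff)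
  also have "\<dots> = m 0 - m ?d" by (rule sum_lessThan_telescope')
  also have "m 0 = monom n \<eta> x" unfolding m_def by simp
  also have "m ?d = monom n \<eta> (sw_pt j i x)"
  proof -
    have "\<eta>(j := \<eta> j - ?d, i := \<eta> i + ?d) = \<eta> \<circ> swp j i"
      using assms ij by (auto simp: fun_eq_iff swp_def)
    then show ?thesis unfolding m_def monom_sw_pt[OF assms(2,1)] by simp
  qed
  finally show "monom n \<eta> x - monom n \<eta> (sw_pt j i x)
    = (x j - x i) * (\<Sum>l<?d. monom n (\<eta>(j := \<eta> j - 1 - l, i := \<eta> i + l)) x)" by (rule sym)
qed auto

lemma diff_quot_monom_equal:
  assumes "i < n" "j < n" "i \<noteq> j" "\<eta> i = \<eta> j" shows "diff_quot j i (monom n \<eta>) x = 0"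
proof (rule diff_quot_eqI[where q = "\<lambda>_. 0"])
  fix x
  have "\<eta> \<circ> swp j i = \<eta>" using assms by (auto simp: fun_eq_iff swp_def)
  then show "monom n \<eta> x - monom n \<eta> (sw_pt j i x) = (x j - x i) * 0"
    using monom_sw_pt[OF assms(2,1), of \<eta> x] by simp
qed (use assms in auto)

lemma dir_diff_diff_quot_monom:
  assumes "i < n" "j < n" "i \<noteq> j" shows "dir_diff (diff_quot j i (monom n \<eta>))"
proof -
  have g: "dir_diff (diff_quot j i (monom n \<eta>))" if "i < n" "j < n" "\<eta> i < \<eta> j" for i j
    using that by (subst ext[OF diff_quot_monom_greater]) auto
  consider "\<eta> i < \<eta> j" | "\<eta> i = \<eta> j" | "\<eta> j < \<eta> i" by linarith
  then show ?thesis
  proof cases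
    case 3
    have "diff_quot j i (monom n \<eta>) = (\<lambda>x. (-1) * diff_quot i j (monom n \<eta>) x)"
      by (rule ext, subst diff_quot_anti) simp
    then show ?thesis using g[OF assms(2,1) 3] by (simp only: dir_diff_mult dir_diff_const)
  next
    case 2 then show ?thesis using assms by (subst ext[OF diff_quot_monom_equal]) auto
  qed (use g assms in auto)
qed

lemma dir_diff_dunkl_monom:
  assumes "j < n" shows "dir_diff (dunkl n k (unit_vec j) (monom n \<eta>))"
proof -
  have "dunkl n k (unit_vec j) (monom n \<eta>) = (\<lambda>x. of_nat (\<eta> j) * monom n (\<eta>(j := \<eta> j - 1)) x +
      of_real k * (\<Sum>b\<in>{..<n} - {j}. diff_quot j b (monom n \<eta>) x))"
    by (rule ext) (simp only: dunkl_unit[OF assms] dir_deriv_monom[OF assms])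
  moreover have "dir_diff (\<lambda>x. of_nat (\<eta> j) * monom n (\<eta>(j := \<eta> j - 1)) x +
      of_real k * (\<Sum>b\<in>{..<n} - {j}. diff_quot j b (monom n \<eta>) x))"
    using assms by (intro dir_diff_add dir_diff_mult dir_diff_sum dir_diff_const dir_diff_monom dir_diff_diff_quot_monom) auto
  ultimately show ?thesis by simp
qed

text \<open>The contribution of one position i to \<open>cher_D\<close>. Only for j < i and \<eta> j
  < \<eta> i is the reflected monomial higher than \<eta>, and there the transposition term of
  \<open>cher_D\<close> cancels it. Intermediate monomials are lower by
  \<open>prec_intermediate\<close>, the remaining reflections by \<open>prec_swap\<close>.\<close>

lemma coord_mult_diff_quot_monom:
  assumes \<eta>: "\<eta> \<in> multi_idx n" and ij: "i < n" "j < n" "i \<noteq> j"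
  shows "\<exists>g. fspan (monom n) (low_idx n \<eta>) g \<and>
    (\<forall>x. x j * diff_quot j i (monom n \<eta>) x + (if j < i then monom n \<eta> (sw_pt i j x) else 0)
      = (if before \<eta> i j then 0 else monom n \<eta> x) + g x)"
proof -
  note fin = finite_low_idx[OF \<eta>]
  have inter: "fspan (monom n) (low_idx n \<eta>) (\<lambda>x. \<Sum>l<e. monom n (\<eta>(a := \<eta> a - Suc l, b := \<eta> b + Suc l)) x)"
    if "a < n" "b < n" "\<eta> a = \<eta> b + Suc e" for a b e
  proof (intro fspan_sum fspan_mem fin)
    fix l assume "l \<in> {..<e}"
    then show "\<eta>(a := \<eta> a - Suc l, b := \<eta> b + Suc l) \<in> low_idx n \<eta>"
      using prec_intermediate[OF \<eta> that(2,1), of "Suc l"] that \<eta>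
      by (auto simp: low_idx_def multi_idx_def)
  qed
  have sw: "fspan (monom n) (low_idx n \<eta>) (\<lambda>x. monom n \<eta> (sw_pt p q x))" if "p < q" "q < n" "\<eta> q < \<eta> p" for p q
  proof -
    have "\<eta> \<circ> swp p q \<in> low_idx n \<eta>"
      using that prec_swap[OF \<eta> that] multi_idx_perm[OF \<eta> swp_permutes[of p n q]] by (simp add: low_idx_def)
    then show ?thesis using fspan_mem[OF fin] that by (simp add: monom_sw_pt)
  qed
  consider "\<eta> i < \<eta> j" | "\<eta> i = \<eta> j" | "\<eta> j < \<eta> i" by linarith
  then show ?thesis
  proof cases
    case 1
    define e where "e = \<eta> j - \<eta> i - 1"
    have e: "\<eta> j - \<eta> i = Suc e" "\<eta> j = \<eta> i + Suc e" using 1 by (auto simp: e_def)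
    define g where "g x = (\<Sum>l<e. monom n (\<eta>(j := \<eta> j - Suc l, i := \<eta> i + Suc l)) x)
      + (if j < i then monom n \<eta> (sw_pt i j x) else 0)" for x
    have "fspan (monom n) (low_idx n \<eta>) (\<lambda>x. if j < i then monom n \<eta> (sw_pt i j x) else 0)"
      using sw[of j i, unfolded sw_pt_commute[of j i]] 1 ij by (cases "j < i") (auto intro: fspan_zero)
    then have "fspan (monom n) (low_idx n \<eta>) g"
      unfolding g_def[abs_def] by (intro fspan_add inter[OF ij(2,1) e(2)])
    moreover have "x j * diff_quot j i (monom n \<eta>) x
      = monom n \<eta> x + (\<Sum>l<e. monom n (\<eta>(j := \<eta> j - Suc l, i := \<eta> i + Suc l)) x)" for x
    proof -
      have "x j * monom n (\<eta>(j := \<eta> j - 1 - l, i := \<eta> i + l)) x = monom n (\<eta>(j := \<eta> j - l, i := \<eta> i + l)) x"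
        if "l < Suc e" for l
      proof -
        have "(\<eta>(j := \<eta> j - 1 - l, i := \<eta> i + l))(j := Suc ((\<eta>(j := \<eta> j - 1 - l, i := \<eta> i + l)) j))
          = \<eta>(j := \<eta> j - l, i := \<eta> i + l)" using that ij(3) e(1) by (auto simp: fun_eq_iff)
        then show ?thesis unfolding coord_mult_monom[OF ij(2)] by simp
      qed
      then have "x j * diff_quot j i (monom n \<eta>) x = (\<Sum>l<Suc e. monom n (\<eta>(j := \<eta> j - l, i := \<eta> i + l)) x)"
        unfolding diff_quot_monom_greater[of i n j \<eta>, OF ij(1,2) 1] e(1) sum_distrib_left by (intro sum.cong) auto
      then show ?thesis by (simp only: sum.lessThan_Suc_shift) simp
    qed
    ultimately show ?thesis using 1 by (intro exI[of _ g]) (auto simp: before_def g_def)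
  next
    case 2
    have "\<eta> \<circ> swp i j = \<eta>" using 2 by (auto simp: fun_eq_iff swp_def)
    then show ?thesis using ij 2
      by (intro exI[of _ "\<lambda>_. 0"]) (auto simp: before_def diff_quot_monom_equal monom_sw_pt fspan_zero)
  next
    case 3
    define e where "e = \<eta> i - \<eta> j - 1"
    have e: "\<eta> i - \<eta> j = Suc e" "\<eta> i = \<eta> j + Suc e" using 3 by (auto simp: e_def)
    \<comment> \<open>For j < i the reflection from the quotient cancels against the transposition
      term, so it stays in g only for i < j.\<close>
    define g where "g x = (-1) * ((\<Sum>l<e. monom n (\<eta>(i := \<eta> i - Suc l, j := \<eta> j + Suc l)) x)
      + (if i < j then monom n \<eta> (sw_pt i j x) else 0))" for x
    have "fspan (monom n) (low_idx n \<eta>) (\<lambda>x. if i < j then monom n \<eta> (sw_pt i j x) else 0)"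
      using sw[of i j] 3 ij by (cases "i < j") (auto intro: fspan_zero)
    then have "fspan (monom n) (low_idx n \<eta>) g"
      unfolding g_def[abs_def] by (intro fspan_cmult fspan_add inter[OF ij(1,2) e(2)])
    moreover have "x j * diff_quot i j (monom n \<eta>) x
      = monom n \<eta> (sw_pt i j x) + (\<Sum>l<e. monom n (\<eta>(i := \<eta> i - Suc l, j := \<eta> j + Suc l)) x)" for x
    proof -
      have "x j * monom n (\<eta>(i := \<eta> i - 1 - l, j := \<eta> j + l)) x = monom n (\<eta>(i := \<eta> i - Suc l, j := \<eta> j + Suc l)) x"
        for l
      proof -
        have "(\<eta>(i := \<eta> i - 1 - l, j := \<eta> j + l))(j := Suc ((\<eta>(i := \<eta> i - 1 - l, j := \<eta> j + l)) j))
          = \<eta>(i := \<eta> i - Suc l, j := \<eta> j + Suc l)" using ij(3) by (auto simp: fun_eq_iff)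
        then show ?thesis unfolding coord_mult_monom[OF ij(2)] by simp
      qed
      then have "x j * diff_quot i j (monom n \<eta>) x = (\<Sum>l<Suc e. monom n (\<eta>(i := \<eta> i - Suc l, j := \<eta> j + Suc l)) x)"
        unfolding diff_quot_monom_greater[of j n i \<eta>, OF ij(2,1) 3] e(1) sum_distrib_left by (intro sum.cong) auto
      moreover have "\<eta>(i := \<eta> i - Suc e, j := \<eta> j + Suc e) = \<eta> \<circ> swp i j"
        using e ij by (auto simp: fun_eq_iff swp_def)
      ultimately show ?thesis using ij by (simp add: monom_sw_pt)
    qed
    ultimately show ?thesis using 3 ij
      by (intro exI[of _ g]) (auto simp: before_def g_def diff_quot_anti[of j i])
  qed
qed

text \<open>On the diagonal the derivative gives \<eta> j, the constant term gives k(1 - n), and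
  each of the n - 1 - \<open>rnk n \<eta> j\<close> other positions not ranked before j gives k. The
  sum is \<open>eigval n k \<eta> j\<close>.\<close>

lemma cher_D_monom:
  assumes \<eta>: "\<eta> \<in> multi_idx n" and j: "j < n"
  shows "\<exists>g. fspan (monom n) (low_idx n \<eta>) g \<and>
    (\<forall>x. cher_D n k j (monom n \<eta>) x = of_real (eigval n k \<eta> j) * monom n \<eta> x + g x)"
proof -
  let ?I = "{..<n} - {j}"
  have "\<forall>i\<in>?I. \<exists>g. fspan (monom n) (low_idx n \<eta>) g \<and>
    (\<forall>x. x j * diff_quot j i (monom n \<eta>) x + (if j < i then monom n \<eta> (sw_pt i j x) else 0)
      = (if before \<eta> i j then 0 else monom n \<eta> x) + g x)"
    using coord_mult_diff_quot_monom[OF \<eta> _ j] by auto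
  from bchoice[OF this] obtain G where GG: "\<forall>i\<in>?I. fspan (monom n) (low_idx n \<eta>) (G i) \<and>
    (\<forall>x. x j * diff_quot j i (monom n \<eta>) x + (if j < i then monom n \<eta> (sw_pt i j x) else 0)
      = (if before \<eta> i j then 0 else monom n \<eta> x) + G i x)" ..
  have G: "\<And>i. i \<in> ?I \<Longrightarrow> fspan (monom n) (low_idx n \<eta>) (G i)"
    and Gx: "\<And>i x. i \<in> ?I \<Longrightarrow> x j * diff_quot j i (monom n \<eta>) x + (if j < i then monom n \<eta> (sw_pt i j x) else 0)
      = (if before \<eta> i j then 0 else monom n \<eta> x) + G i x"
    using GG by blast+
  have "cher_D n k j (monom n \<eta>) x = of_real (eigval n k \<eta> j) * monom n \<eta> x + of_real k * (\<Sum>i\<in>?I. G i x)" for x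
  proof -
    let ?m = "monom n \<eta> x"
    have s1: "(\<Sum>i\<in>{j<..<n}. monom n \<eta> (sw_pt i j x)) = (\<Sum>i\<in>?I. if j < i then monom n \<eta> (sw_pt i j x) else 0)"
      by (rule sum.mono_neutral_cong_left) auto
    have s2: "(\<Sum>i\<in>?I. if before \<eta> i j then 0 else ?m) = of_nat (n - 1) * ?m - of_nat (rnk n \<eta> j) * ?m"
    proof -
      have "(\<Sum>i\<in>?I. if before \<eta> i j then 0 else ?m) = (\<Sum>i\<in>?I. ?m - (if before \<eta> i j then ?m else 0))"
        by (intro sum.cong) auto
      also have "\<dots> = of_nat (card ?I) * ?m - of_nat (card {i \<in> ?I. before \<eta> i j}) * ?m"
        by (simp only: sum_subtractf sum.inter_filter[symmetric] finite_Diff finite_lessThan sum_constant)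
      also have "{i \<in> ?I. before \<eta> i j} = {i. i < n \<and> before \<eta> i j}" using before_irrefl by auto
      finally show ?thesis using j by (simp add: rnk_def)
    qed
    have "x j * (\<Sum>i\<in>?I. diff_quot j i (monom n \<eta>) x) + (\<Sum>i\<in>{j<..<n}. monom n \<eta> (sw_pt i j x))
      = (\<Sum>i\<in>?I. x j * diff_quot j i (monom n \<eta>) x + (if j < i then monom n \<eta> (sw_pt i j x) else 0))"
      unfolding s1 sum_distrib_left sum.distrib ..
    also have "\<dots> = (\<Sum>i\<in>?I. (if before \<eta> i j then 0 else ?m) + G i x)"
      using Gx by (intro sum.cong) auto
    also have "\<dots> = of_nat (n - 1) * ?m - of_nat (rnk n \<eta> j) * ?m + (\<Sum>i\<in>?I. G i x)"
      unfolding sum.distrib s2 ..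
    finally have e: "x j * (\<Sum>i\<in>?I. diff_quot j i (monom n \<eta>) x) + (\<Sum>i\<in>{j<..<n}. monom n \<eta> (sw_pt i j x))
      = of_nat (n - 1) * ?m - of_nat (rnk n \<eta> j) * ?m + (\<Sum>i\<in>?I. G i x)" .
    have "cher_D n k j (monom n \<eta>) x = x j * dir_deriv (unit_vec j) (monom n \<eta>) x
      + of_real k * (1 - of_nat n) * ?m
      + of_real k * (x j * (\<Sum>i\<in>?I. diff_quot j i (monom n \<eta>) x) + (\<Sum>i\<in>{j<..<n}. monom n \<eta> (sw_pt i j x)))"
      unfolding cher_D_def dunkl_unit[OF j] by (simp add: algebra_simps)
    also have "\<dots> = of_real (eigval n k \<eta> j) * ?m + of_real k * (\<Sum>i\<in>?I. G i x)"
      unfolding e coord_mult_dir_deriv_monom[OF j] using j by (simp add: eigval_rnk algebra_simps of_nat_diff)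
    finally show ?thesis .
  qed
  moreover have "fspan (monom n) (low_idx n \<eta>) (\<lambda>x. of_real k * (\<Sum>i\<in>?I. G i x))"
    using G by (intro fspan_cmult fspan_sum)
  ultimately show ?thesis by blast
qed

text \<open>A maximal index in the support has the eigenvalue of the function, hence is \<eta>.\<close>

lemma eigenfunction_support:
  assumes k: "0 \<le> k" and \<eta>: "\<eta> \<in> multi_idx n"
    and f: "\<And>x. f x = (\<Sum>\<kappa>\<in>deg_idx n m. c \<kappa> * monom n \<kappa> x)"
    and eig: "\<And>j x. j < n \<Longrightarrow> cher_D n k j f x = of_real (eigval n k \<eta> j) * f x"
    and \<kappa>: "\<kappa> \<in> deg_idx n m" "c \<kappa> \<noteq> 0"
  shows "\<kappa> = \<eta> \<or> prec n \<kappa> \<eta>"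
proof (rule ccontr)
  assume neg: "\<not> (\<kappa> = \<eta> \<or> prec n \<kappa> \<eta>)"
  let ?M = "deg_idx n m"
  have mi: "\<tau> \<in> multi_idx n" if "\<tau> \<in> ?M" for \<tau> using that by (simp add: deg_idx_def)
  define B where "B = {\<kappa> \<in> ?M. c \<kappa> \<noteq> 0 \<and> \<not> (\<kappa> = \<eta> \<or> prec n \<kappa> \<eta>)}"
  have "finite B" "B \<noteq> {}" using neg \<kappa> by (auto simp: B_def)
  have tr: "transp_on B (prec n)"
    by (rule transp_onI) (use mi B_def in \<open>blast intro: prec_trans\<close>)
  have "asymp_on B (prec n)"
    by (rule asymp_onI) (use mi prec_irrefl prec_trans B_def in blast)
  from Finite_Set.bex_max_element[OF \<open>finite B\<close> this tr \<open>B \<noteq> {}\<close>]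
  obtain \<rho> where \<rho>: "\<rho> \<in> B" and max': "\<forall>\<tau>\<in>B. \<tau> \<noteq> \<rho> \<longrightarrow> \<not> prec n \<rho> \<tau>" by blast
  have max: "\<not> prec n \<rho> \<tau>" if "\<tau> \<in> B" for \<tau>
    using max' that prec_irrefl[of n \<rho>] by (cases "\<tau> = \<rho>") auto
  have \<rho>M: "\<rho> \<in> ?M" "c \<rho> \<noteq> 0" "\<rho> \<noteq> \<eta>" "\<not> prec n \<rho> \<eta>" using \<rho> by (auto simp: B_def)
  have "eigval n k \<rho> j = eigval n k \<eta> (id j)" if j: "j < n" for j
  proof -
    have "\<forall>\<tau>\<in>?M. \<exists>M. (\<forall>\<kappa>. \<kappa> \<notin> low_idx n \<tau> \<longrightarrow> M \<kappa> = 0) \<and>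
      (\<forall>x. cher_D n k j (monom n \<tau>) x = of_real (eigval n k \<tau> j) * monom n \<tau> x + (\<Sum>\<kappa>\<in>?M. M \<kappa> * monom n \<kappa> x))"
    proof
      fix \<tau> assume t: "\<tau> \<in> ?M"
      obtain g where g: "fspan (monom n) (low_idx n \<tau>) g"
        "\<And>x. cher_D n k j (monom n \<tau>) x = of_real (eigval n k \<tau> j) * monom n \<tau> x + g x"
        using cher_D_monom[OF mi[OF t] j] by blast
      have "low_idx n \<tau> \<subseteq> ?M" using low_idx_subset[OF mi[OF t]] t by (simp add: deg_idx_def)
      from fspan_mono[OF g(1) this finite_deg_idx] g(2)
      show "\<exists>M. (\<forall>\<kappa>. \<kappa> \<notin> low_idx n \<tau> \<longrightarrow> M \<kappa> = 0) \<and>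
        (\<forall>x. cher_D n k j (monom n \<tau>) x = of_real (eigval n k \<tau> j) * monom n \<tau> x + (\<Sum>\<kappa>\<in>?M. M \<kappa> * monom n \<kappa> x))"
        by metis
    qed
    from bchoice[OF this] obtain M where MM: "\<forall>\<tau>\<in>?M. (\<forall>\<kappa>. \<kappa> \<notin> low_idx n \<tau> \<longrightarrow> M \<tau> \<kappa> = 0) \<and>
      (\<forall>x. cher_D n k j (monom n \<tau>) x = of_real (eigval n k \<tau> j) * monom n \<tau> x + (\<Sum>\<kappa>\<in>?M. M \<tau> \<kappa> * monom n \<kappa> x))" ..
    have M0: "\<And>\<tau> \<kappa>. \<tau> \<in> ?M \<Longrightarrow> \<kappa> \<notin> low_idx n \<tau> \<Longrightarrow> M \<tau> \<kappa> = 0"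
      and M: "\<And>\<tau> x. \<tau> \<in> ?M \<Longrightarrow> cher_D n k j (monom n \<tau>) x
        = of_real (eigval n k \<tau> j) * monom n \<tau> x + (\<Sum>\<kappa>\<in>?M. M \<tau> \<kappa> * monom n \<kappa> x)"
      using MM by blast+
    have fe: "f = (\<lambda>x. \<Sum>\<kappa>\<in>?M. c \<kappa> * monom n \<kappa> x)" using f by auto
    have "(\<Sum>\<kappa>\<in>?M. (of_real (eigval n k \<eta> j) * c \<kappa>) * monom n \<kappa> x)
      = (\<Sum>\<kappa>\<in>?M. (c \<kappa> * of_real (eigval n k \<kappa> j) + (\<Sum>\<tau>\<in>?M. c \<tau> * M \<tau> \<kappa>)) * monom n \<kappa> x)" for x
    proof -
      have "(\<Sum>\<kappa>\<in>?M. (of_real (eigval n k \<eta> j) * c \<kappa>) * monom n \<kappa> x) = cher_D n k j f x"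
        unfolding eig[OF j] f sum_distrib_left by (simp add: mult.assoc)
      also have "\<dots> = (\<Sum>\<tau>\<in>?M. c \<tau> * cher_D n k j (monom n \<tau>) x)"
        unfolding fe by (rule cher_D_sum[OF j]) auto
      also have "\<dots> = (\<Sum>\<tau>\<in>?M. c \<tau> * (of_real (eigval n k \<tau> j) * monom n \<tau> x + (\<Sum>\<kappa>\<in>?M. M \<tau> \<kappa> * monom n \<kappa> x)))"
        using M by (intro sum.cong) auto
      also have "\<dots> = (\<Sum>\<tau>\<in>?M. c \<tau> * of_real (eigval n k \<tau> j) * monom n \<tau> x)
        + (\<Sum>\<tau>\<in>?M. \<Sum>\<kappa>\<in>?M. c \<tau> * M \<tau> \<kappa> * monom n \<kappa> x)"
        by (simp add: distrib_left sum.distrib sum_distrib_left mult.assoc)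
      also have "(\<Sum>\<tau>\<in>?M. \<Sum>\<kappa>\<in>?M. c \<tau> * M \<tau> \<kappa> * monom n \<kappa> x) = (\<Sum>\<kappa>\<in>?M. \<Sum>\<tau>\<in>?M. c \<tau> * M \<tau> \<kappa> * monom n \<kappa> x)"
        by (rule sum.swap)
      finally show ?thesis
        by (simp add: distrib_right sum.distrib sum_distrib_right)
    qed
    from monoms_eq_iff[OF this \<rho>M(1)]
    have "of_real (eigval n k \<eta> j) * c \<rho> = c \<rho> * of_real (eigval n k \<rho> j) + (\<Sum>\<tau>\<in>?M. c \<tau> * M \<tau> \<rho>)" .
    \<comment> \<open>A nonzero contribution to \<rho> comes from some \<tau> above \<rho> in the
      support. This \<tau> is neither \<eta> nor below \<eta>, as otherwise \<rho> would be below
      \<eta>; so it lies in B, against the maximality of \<rho>.\<close>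
    moreover have "(\<Sum>\<tau>\<in>?M. c \<tau> * M \<tau> \<rho>) = 0"
    proof (intro sum.neutral ballI)
      fix \<tau> assume t: "\<tau> \<in> ?M"
      show "c \<tau> * M \<tau> \<rho> = 0"
      proof (rule ccontr)
        assume "c \<tau> * M \<tau> \<rho> \<noteq> 0"
        then have "c \<tau> \<noteq> 0" "\<rho> \<in> low_idx n \<tau>" using M0[OF t] by auto
        then have p: "prec n \<rho> \<tau>" by (simp add: low_idx_def)
        then have "\<not> (\<tau> = \<eta> \<or> prec n \<tau> \<eta>)" using \<rho>M prec_trans[OF p] mi t by blast
        then have "\<tau> \<in> B" using t \<open>c \<tau> \<noteq> 0\<close> by (simp add: B_def)
        then show False using max p by blast
      qed
    qed
    ultimately have "complex_of_real (eigval n k \<eta> j) = of_real (eigval n k \<rho> j)" using \<rho>M by simp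
    then show ?thesis by simp
  qed
  then have "\<rho> = \<eta> \<circ> id" using mi[OF \<rho>M(1)] by (intro eigval_inj[OF k _ \<eta> permutes_id])
  then show False using \<rho>M by simp
qed

subsection \<open>Construction of the joint eigenfunctions\<close>

definition cyc :: "nat \<Rightarrow> nat \<Rightarrow> nat" where
  "cyc n m = (if Suc m < n then Suc m else if Suc m = n then 0 else m)"

definition dcyc :: "nat \<Rightarrow> nat \<Rightarrow> nat" where
  "dcyc n m = (if m < n then (if m = 0 then n - 1 else m - 1) else m)"

lemma cyc_dcyc [simp]: "cyc n (dcyc n m) = m" and dcyc_cyc [simp]: "dcyc n (cyc n m) = m"
  by (auto simp: cyc_def dcyc_def)

lemma cyc_o_dcyc [simp]: "f \<circ> cyc n \<circ> dcyc n = f" and dcyc_o_cyc [simp]: "f \<circ> dcyc n \<circ> cyc n = f"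
  by (auto simp: fun_eq_iff)

lemma cyc_permutes: "cyc n permutes {..<n}"
proof (rule bij_imp_permutes)
  show "bij_betw (cyc n) {..<n} {..<n}"
    by (rule bij_betw_byWitness[where f' = "dcyc n"]) (auto simp: cyc_def dcyc_def)
qed (auto simp: cyc_def)

lemma dcyc_permutes: "dcyc n permutes {..<n}"
proof (rule bij_imp_permutes)
  show "bij_betw (dcyc n) {..<n} {..<n}"
    by (rule bij_betw_byWitness[where f' = "cyc n"]) (auto simp: cyc_def dcyc_def)
qed (auto simp: dcyc_def)

definition phi_idx :: "nat \<Rightarrow> (nat \<Rightarrow> nat) \<Rightarrow> nat \<Rightarrow> nat" where
  "phi_idx n \<eta> m = (if Suc m < n then \<eta> (Suc m) else if Suc m = n then Suc (\<eta> 0) else 0)"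

text \<open>If the last entry is 0, the truncated subtraction returns 0 and this is no inverse of
  \<open>phi_idx\<close>; the factors \<open>betaE\<close> and \<open>betaL\<close> vanish there.
  The truncation still makes the n-th iterate equal to \<open>minus_one\<close> on all
  multi-indices.\<close>

definition psi_idx :: "nat \<Rightarrow> (nat \<Rightarrow> nat) \<Rightarrow> nat \<Rightarrow> nat" where
  "psi_idx n \<kappa> m = (if m = 0 then \<kappa> (n - 1) - 1 else if m < n then \<kappa> (m - 1) else 0)"

lemma phi_idx_multi [simp]: "phi_idx n \<eta> \<in> multi_idx n"
  by (auto simp: multi_idx_def phi_idx_def)

lemma psi_idx_multi: "1 \<le> n \<Longrightarrow> psi_idx n \<kappa> \<in> multi_idx n"
  by (auto simp: multi_idx_def psi_idx_def)

lemma psi_phi_idx: "1 \<le> n \<Longrightarrow> \<eta> \<in> multi_idx n \<Longrightarrow> psi_idx n (phi_idx n \<eta>) = \<eta>"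
  by (auto simp: fun_eq_iff multi_idx_def psi_idx_def phi_idx_def)

lemma phi_psi_idx: "1 \<le> n \<Longrightarrow> \<kappa> \<in> multi_idx n \<Longrightarrow> 0 < \<kappa> (n - 1) \<Longrightarrow> phi_idx n (psi_idx n \<kappa>) = \<kappa>"
  by (auto simp: fun_eq_iff multi_idx_def psi_idx_def phi_idx_def)

lemma absv_phi_idx:
  assumes "1 \<le> n" shows "absv n (phi_idx n \<eta>) = Suc (absv n \<eta>)"
proof -
  obtain p where p: "n = Suc p" using assms by (cases n) auto
  have "(\<Sum>i<p. phi_idx n \<eta> i) = (\<Sum>i<p. \<eta> (Suc i))" using p by (intro sum.cong) (auto simp: phi_idx_def)
  moreover have "phi_idx n \<eta> p = Suc (\<eta> 0)" using p by (simp add: phi_idx_def)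
  moreover have "absv n \<eta> = \<eta> 0 + (\<Sum>i<p. \<eta> (Suc i))"
    unfolding absv_def p by (rule sum.lessThan_Suc_shift)
  moreover have "absv n (phi_idx n \<eta>) = (\<Sum>i<p. phi_idx n \<eta> i) + phi_idx n \<eta> p"
    unfolding absv_def p by (rule sum.lessThan_Suc)
  ultimately show ?thesis by simp
qed

text \<open>Moved from the front to the end, an entry loses its ties, and the increment by 1 makes
  up for exactly that.\<close>

lemma rnk_phi_idx:
  assumes "1 \<le> n" shows "rnk n (phi_idx n \<eta>) = rnk n \<eta> \<circ> cyc n"
proof (rule rnk_unique[symmetric])
  show "rnk n \<eta> \<circ> cyc n permutes {..<n}" by (intro permutes_compose cyc_permutes rnk_permutes)
  fix i j assume ij: "i < n" "j < n"
  then have c: "cyc n i < n" "cyc n j < n" using permutes_in_image[OF cyc_permutes] by auto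
  have "before \<eta> (cyc n i) (cyc n j) \<longleftrightarrow> before (phi_idx n \<eta>) i j"
    using ij by (cases "Suc i = n"; cases "Suc j = n") (auto simp: before_def cyc_def phi_idx_def)
  then show "((rnk n \<eta> \<circ> cyc n) i < (rnk n \<eta> \<circ> cyc n) j) = before (phi_idx n \<eta>) i j"
    using rnk_less_iff[OF c] by simp
qed

lemma eigval_phi_idx:
  "Suc j < n \<Longrightarrow> eigval n k (phi_idx n \<eta>) j = eigval n k \<eta> (Suc j)"
  "1 \<le> n \<Longrightarrow> eigval n k (phi_idx n \<eta>) (n - 1) = eigval n k \<eta> 0 + 1"
  by (simp_all add: eigval_rnk rnk_phi_idx cyc_def) (simp_all add: phi_idx_def)

text \<open>The affine raising operator of Knop and Sahi; it intertwines the Cherednik operators and corresponds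
  to phi_idx on indices.\<close>

definition Phi_op :: "nat \<Rightarrow> ((nat \<Rightarrow> complex) \<Rightarrow> complex) \<Rightarrow> (nat \<Rightarrow> complex) \<Rightarrow> complex" where
  "Phi_op n f x = x (n - 1) * f (x \<circ> dcyc n)"

lemma monom_cong: "(\<And>i. i < n \<Longrightarrow> \<eta> i = \<kappa> i) \<Longrightarrow> monom n \<eta> x = monom n \<kappa> x"
  by (simp add: monom_def)

lemma Phi_op_monom:
  assumes "1 \<le> n" shows "Phi_op n (monom n \<eta>) x = monom n (phi_idx n \<eta>) x"
proof -
  have "monom n \<eta> (x \<circ> dcyc n) = monom n (\<eta> \<circ> cyc n) x"
    using monom_perm[OF cyc_permutes, of n \<eta> "x \<circ> dcyc n"] by (simp only: dcyc_o_cyc)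
  then have "Phi_op n (monom n \<eta>) x = monom n ((\<eta> \<circ> cyc n)(n - 1 := Suc ((\<eta> \<circ> cyc n) (n - 1)))) x"
    unfolding Phi_op_def using assms by (simp only: coord_mult_monom)
  also have "\<dots> = monom n (phi_idx n \<eta>) x"
    using assms by (intro monom_cong) (auto simp: cyc_def phi_idx_def)
  finally show ?thesis .
qed

lemma Phi_op_sum: "Phi_op n (\<lambda>x. \<Sum>\<kappa>\<in>S. c \<kappa> * f \<kappa> x) x = (\<Sum>\<kappa>\<in>S. c \<kappa> * Phi_op n (f \<kappa>) x)"
  by (simp add: Phi_op_def sum_distrib_left algebra_simps)

text \<open>For j = 0 the transposition sum in \<open>cher_D\<close> runs over all other positions,
  as does the one in the commutator of T_0 with x 0.\<close>

lemma dunkl_zero_coord_mult: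
  assumes "1 \<le> n" "dir_diff f"
  shows "dunkl n k (unit_vec 0) (\<lambda>x. x 0 * f x) x = cher_D n k 0 f x + f x + of_real k * (of_nat n - 1) * f x"
proof -
  have "{..<n} - {0} = {0<..<n}" by auto
  then show ?thesis using assms
    by (simp add: dunkl_coord_mult_same cher_D_def sw_pt_commute[of 0] algebra_simps)
qed

text \<open>\<open>Phi_op\<close> is multiplication by the first coordinate followed by the shift,
  and the shift turns T_{n-1} into T_0.\<close>

lemma dunkl_Phi_op_last:
  assumes n: "1 \<le> n"
  shows "dunkl n k (unit_vec (n - 1)) (Phi_op n f) x = dunkl n k (unit_vec 0) (\<lambda>x. x 0 * f x) (x \<circ> dcyc n)"
proof -
  have d0: "dcyc n 0 = n - 1" using n by (simp add: dcyc_def)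
  have "Phi_op n f = (\<lambda>x. (\<lambda>x. x 0 * f x) (x \<circ> dcyc n))" by (auto simp: Phi_op_def d0)
  then show ?thesis using dunkl_perm[OF dcyc_permutes, of 0 n k "\<lambda>x. x 0 * f x" x] n d0 by simp
qed

lemma cher_D_Phi_op_last:
  assumes n: "1 \<le> n" and f: "dir_diff f"
  shows "cher_D n k (n - 1) (Phi_op n f) x = Phi_op n (\<lambda>x. cher_D n k 0 f x + f x) x"
proof -
  have e: "{n - 1<..<n} = {}" by auto
  show ?thesis
    unfolding cher_D_def[of n k "n - 1"] dunkl_Phi_op_last[OF n] dunkl_zero_coord_mult[OF n f] e
    by (simp add: Phi_op_def algebra_simps)
qed

text \<open>Commuting T_j past x (n - 1) costs -k times a reflected term, which cancels the summand
  i = n - 1 of the transposition sum. The other summands are shifted by one position.\<close>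

lemma cher_D_Phi_op:
  assumes j: "Suc j < n" and f: "dir_diff f"
  shows "cher_D n k j (Phi_op n f) x = Phi_op n (cher_D n k (Suc j) f) x"
proof -
  define g where "g x = f (x \<circ> dcyc n)" for x
  have g: "dir_diff g" unfolding g_def[abs_def] by (rule dir_diff_perm[OF f dcyc_permutes])
  have P: "Phi_op n f = (\<lambda>x. x (n - 1) * g x)" by (auto simp: Phi_op_def g_def)
  have dj: "dcyc n (Suc i) = i" if "Suc i < n" for i using that by (simp add: dcyc_def)
  have Tg: "dunkl n k (unit_vec j) g x = dunkl n k (unit_vec (Suc j)) f (x \<circ> dcyc n)"
    using dunkl_perm[OF dcyc_permutes, of "Suc j" n k f x] j dj unfolding g_def[abs_def] by simp
  have T: "dunkl n k (unit_vec j) (\<lambda>x. x (n - 1) * g x) x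
      = x (n - 1) * dunkl n k (unit_vec j) g x - of_real k * g (sw_pt j (n - 1) x)"
    using j by (intro dunkl_coord_mult_other g) auto
  have "{j<..<n} = insert (n - 1) {j<..<n - 1}" using j by auto
  then have "(\<Sum>i\<in>{j<..<n}. sw_pt i j x (n - 1) * g (sw_pt i j x))
    = sw_pt (n - 1) j x (n - 1) * g (sw_pt (n - 1) j x) + (\<Sum>i\<in>{j<..<n - 1}. sw_pt i j x (n - 1) * g (sw_pt i j x))"
    by simp
  also have "sw_pt (n - 1) j x (n - 1) = x j" by (simp add: sw_pt_def)
  also have "(\<Sum>i\<in>{j<..<n - 1}. sw_pt i j x (n - 1) * g (sw_pt i j x)) = (\<Sum>i\<in>{j<..<n - 1}. x (n - 1) * g (sw_pt i j x))"
    using j by (intro sum.cong refl) (auto simp: sw_pt_def)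
  also have "\<dots> = x (n - 1) * (\<Sum>i\<in>{j<..<n - 1}. g (sw_pt i j x))" by (rule sum_distrib_left[symmetric])
  also have "(\<Sum>i\<in>{j<..<n - 1}. g (sw_pt i j x)) = (\<Sum>i\<in>{Suc j<..<n}. f (sw_pt i (Suc j) (x \<circ> dcyc n)))"
  proof (rule sum.reindex_bij_witness[where i = "\<lambda>i. i - 1" and j = Suc])
    fix i assume "i \<in> {j<..<n - 1}"
    then have "Suc i < n" by auto
    then show "f (sw_pt (Suc i) (Suc j) (x \<circ> dcyc n)) = g (sw_pt i j x)"
      using sw_pt_perm[OF dcyc_permutes, of n "Suc i" "Suc j" x] j unfolding g_def by (simp add: dj)
  qed (use j in auto)
  finally have S: "(\<Sum>i\<in>{j<..<n}. sw_pt i j x (n - 1) * g (sw_pt i j x)) = x j * g (sw_pt j (n - 1) x)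
    + x (n - 1) * (\<Sum>i\<in>{Suc j<..<n}. f (sw_pt i (Suc j) (x \<circ> dcyc n)))"
    by (simp only: sw_pt_commute[of "n - 1"])
  have xs: "x j = (x \<circ> dcyc n) (Suc j)" using j by (simp add: dj)
  show ?thesis
    unfolding P cher_D_def T S Tg Phi_op_def xs unfolding g_def by (simp add: algebra_simps)
qed

section \<open>Cherednik operators and adjacent transpositions\<close>

lemma sw_pt_comp_adjacent:
  "sw_pt i a x \<circ> swp j l = sw_pt (swp j l i) (swp j l a) (x \<circ> swp j l)"
  using sw_pt_perm[OF swp_permutes_UNIV, of j l "swp j l i" "swp j l a" x] by simp

lemma dunkl_sw_pt:
  assumes "j < n" "l < n" "a < n"
  shows "dunkl n k (unit_vec a) (\<lambda>x. f (sw_pt j l x)) x = dunkl n k (unit_vec (swp j l a)) f (sw_pt j l x)"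
proof -
  have "swp j l a < n" using permutes_in_image[OF swp_permutes[OF assms(1,2)], of a] assms by simp
  from dunkl_perm[OF swp_permutes[OF assms(1,2)] this, of k f x] show ?thesis unfolding sw_pt_def by simp
qed

text \<open>The relations of the degenerate affine Hecke algebra. The transposition sums for j and
  \<open>Suc j\<close> differ by the single term exchanging these two positions, which is the source
  of the correction by k.\<close>

lemma cher_D_sw_pt:
  assumes j: "Suc j < n"
  shows "cher_D n k j (\<lambda>x. f (sw_pt j (Suc j) x)) x = cher_D n k (Suc j) f (sw_pt j (Suc j) x) + of_real k * f x" (is ?A)
    and "cher_D n k (Suc j) (\<lambda>x. f (sw_pt j (Suc j) x)) x = cher_D n k j f (sw_pt j (Suc j) x) - of_real k * f x" (is ?B)
    and "a < n \<Longrightarrow> a \<noteq> j \<Longrightarrow> a \<noteq> Suc j \<Longrightarrow>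
      cher_D n k a (\<lambda>x. f (sw_pt j (Suc j) x)) x = cher_D n k a f (sw_pt j (Suc j) x)" (is "_ \<Longrightarrow> _ \<Longrightarrow> _ \<Longrightarrow> ?C")
proof -
  let ?s = "swp j (Suc j)" and ?y = "sw_pt j (Suc j) x"
  have y: "?y a = x (?s a)" for a by (simp add: sw_pt_def)
  have ss: "sw_pt j (Suc j) (sw_pt i a x) = sw_pt (?s i) (?s a) ?y" for i a
    using sw_pt_comp_adjacent[of i a x j "Suc j"] by (simp add: sw_pt_def)
  have self: "sw_pt j (Suc j) (sw_pt (Suc j) j x) = x" by (auto simp: sw_pt_def swp_def fun_eq_iff)
  have jn: "j < n" using j by simp
  have i1: "{j<..<n} = insert (Suc j) {Suc j<..<n}" using j by auto
  have s1: "(\<Sum>i\<in>{Suc j<..<n}. f (sw_pt j (Suc j) (sw_pt i j x))) = (\<Sum>i\<in>{Suc j<..<n}. f (sw_pt i (Suc j) ?y))"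
    by (intro sum.cong refl) (auto simp: ss)
  show ?A unfolding cher_D_def dunkl_sw_pt[OF jn j jn] i1 using s1
    by (simp add: y self algebra_simps)
  have s2: "(\<Sum>i\<in>{Suc j<..<n}. f (sw_pt j (Suc j) (sw_pt i (Suc j) x))) = (\<Sum>i\<in>{Suc j<..<n}. f (sw_pt i j ?y))"
    by (intro sum.cong refl) (auto simp: ss)
  have self2: "sw_pt (Suc j) j ?y = x" by (auto simp: sw_pt_def swp_def fun_eq_iff)
  show ?B unfolding cher_D_def dunkl_sw_pt[OF jn j j] i1 using s2
    by (simp add: y self2 algebra_simps)
  assume a: "a < n" "a \<noteq> j" "a \<noteq> Suc j"
  have "(\<Sum>i\<in>{a<..<n}. f (sw_pt j (Suc j) (sw_pt i a x))) = (\<Sum>i\<in>{a<..<n}. f (sw_pt i a ?y))"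
  proof (rule sum.reindex_bij_witness[where i = ?s and j = ?s])
    fix i assume "i \<in> {a<..<n}"
    then show "?s i \<in> {a<..<n}" using a j by (auto simp: swp_def)
    show "f (sw_pt (?s i) a ?y) = f (sw_pt j (Suc j) (sw_pt i a x))" using a by (simp add: ss)
  qed (use a j in \<open>auto simp: swp_def\<close>)
  then show ?C unfolding cher_D_def dunkl_sw_pt[OF jn j a(1)] using a by (simp add: y)
qed

text \<open>The coefficients are required to be nonnegative: both steps of the recursion preserve this.\<close>

definition is_jack :: "nat \<Rightarrow> real \<Rightarrow> (nat \<Rightarrow> nat) \<Rightarrow> ((nat \<Rightarrow> complex) \<Rightarrow> complex) \<Rightarrow> bool" where
  "is_jack n k \<eta> f \<longleftrightarrow>
    (\<exists>c :: (nat \<Rightarrow> nat) \<Rightarrow> real. (\<forall>\<kappa>. 0 \<le> c \<kappa>) \<and> c \<eta> = 1 \<and>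
      (\<forall>\<kappa>\<in>deg_idx n (absv n \<eta>). c \<kappa> \<noteq> 0 \<longrightarrow> \<kappa> = \<eta> \<or> prec n \<kappa> \<eta>) \<and>
      (\<forall>x. f x = (\<Sum>\<kappa>\<in>deg_idx n (absv n \<eta>). of_real (c \<kappa>) * monom n \<kappa> x))) \<and>
    (\<forall>j<n. \<forall>x. cher_D n k j f x = of_real (eigval n k \<eta> j) * f x)"

text \<open>\<open>eigenfunction_support\<close> provides the triangularity clause, so the recursion
  only has to track signs, the leading coefficient and the eigenvalues.\<close>

lemma is_jackI:
  fixes c :: "(nat \<Rightarrow> nat) \<Rightarrow> real"
  assumes "0 \<le> k" "\<eta> \<in> multi_idx n" "\<And>\<kappa>. 0 \<le> c \<kappa>" "c \<eta> = 1"
    and "\<And>x. f x = (\<Sum>\<kappa>\<in>deg_idx n (absv n \<eta>). of_real (c \<kappa>) * monom n \<kappa> x)"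
    and "\<And>j x. j < n \<Longrightarrow> cher_D n k j f x = of_real (eigval n k \<eta> j) * f x"
  shows "is_jack n k \<eta> f"
proof -
  have "\<kappa> = \<eta> \<or> prec n \<kappa> \<eta>" if "\<kappa> \<in> deg_idx n (absv n \<eta>)" "c \<kappa> \<noteq> 0" for \<kappa>
    using that by (intro eigenfunction_support[OF assms(1,2,5,6)]) auto
  then show ?thesis unfolding is_jack_def using assms by blast
qed

lemma is_jack_dir_diff: "is_jack n k \<eta> f \<Longrightarrow> dir_diff f"
proof -
  assume "is_jack n k \<eta> f"
  then obtain c :: "(nat \<Rightarrow> nat) \<Rightarrow> real" where
    "\<And>x. f x = (\<Sum>\<kappa>\<in>deg_idx n (absv n \<eta>). of_real (c \<kappa>) * monom n \<kappa> x)"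
    unfolding is_jack_def by blast
  then show "dir_diff f" by (intro fspan_monom_dir_diff[OF fspanI])
qed

lemma is_jack_eig: "is_jack n k \<eta> f \<Longrightarrow> j < n \<Longrightarrow> cher_D n k j f x = of_real (eigval n k \<eta> j) * f x"
  unfolding is_jack_def by blast

lemma is_jack_zero:
  assumes "0 \<le> k" "1 \<le> n" shows "is_jack n k (\<lambda>_. 0) (\<lambda>_. 1)"
proof (rule is_jackI[OF assms(1), of _ n "\<lambda>_. 1"])
  show "(\<lambda>_. 0) \<in> multi_idx n" by (simp add: multi_idx_def)
  have "absv n (\<lambda>_. 0) = 0" by (simp add: absv_def)
  then show "(1::complex) = (\<Sum>\<kappa>\<in>deg_idx n (absv n (\<lambda>_. 0)). of_real 1 * monom n \<kappa> x)" for x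
    by (simp add: monom_def deg_idx_zero)
  fix j x assume j: "j < n"
  have "diff_quot a b (\<lambda>_. 1) x = 0" for a b by (simp add: diff_quot_def)
  then have "dunkl n k (unit_vec j) (\<lambda>_. 1) x = 0" using j by (simp add: dunkl_unit)
  moreover have "card {i. i < j} = j" by simp
  ultimately show "cher_D n k j (\<lambda>_. 1) x = of_real (eigval n k (\<lambda>_. 0) j) * 1"
    using j by (simp add: cher_D_def eigval_def algebra_simps of_nat_diff)
qed auto

lemma sum_deg_idx_phi:
  assumes n: "1 \<le> n"
  shows "(\<Sum>\<kappa>\<in>{\<kappa> \<in> deg_idx n (Suc m). 0 < \<kappa> (n - 1)}. g \<kappa>) = (\<Sum>\<eta>\<in>deg_idx n m. g (phi_idx n \<eta>))"
proof (rule sum.reindex_bij_witness[where j = "psi_idx n" and i = "phi_idx n"])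
  fix \<kappa> assume \<kappa>: "\<kappa> \<in> deg_idx n m"
  then show "psi_idx n (phi_idx n \<kappa>) = \<kappa>" using psi_phi_idx[OF n] by (simp add: deg_idx_def)
  have "0 < phi_idx n \<kappa> (n - 1)" using n by (simp add: phi_idx_def)
  then show "phi_idx n \<kappa> \<in> {\<kappa> \<in> deg_idx n (Suc m). 0 < \<kappa> (n - 1)}"
    using \<kappa> by (simp add: deg_idx_def absv_phi_idx[OF n])
next
  fix \<kappa> assume \<kappa>: "\<kappa> \<in> {\<kappa> \<in> deg_idx n (Suc m). 0 < \<kappa> (n - 1)}"
  then show pp: "phi_idx n (psi_idx n \<kappa>) = \<kappa>" using phi_psi_idx[OF n] by (simp add: deg_idx_def)
  then show "g (phi_idx n (psi_idx n \<kappa>)) = g \<kappa>" by simp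
  show "psi_idx n \<kappa> \<in> deg_idx n m"
    using \<kappa> psi_idx_multi[OF n] absv_phi_idx[OF n, of "psi_idx n \<kappa>"] unfolding pp by (simp add: deg_idx_def)
qed

lemma is_jack_Phi_op:
  assumes k: "0 \<le> k" and n: "1 \<le> n" and \<eta>: "\<eta> \<in> multi_idx n" and f: "is_jack n k \<eta> f"
  shows "is_jack n k (phi_idx n \<eta>) (Phi_op n f)"
proof -
  let ?m = "absv n \<eta>"
  note a = is_jack_dir_diff[OF f]
  obtain c :: "(nat \<Rightarrow> nat) \<Rightarrow> real" where c: "\<And>\<kappa>. 0 \<le> c \<kappa>" "c \<eta> = 1"
    "\<And>x. f x = (\<Sum>\<kappa>\<in>deg_idx n ?m. of_real (c \<kappa>) * monom n \<kappa> x)"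
    using f unfolding is_jack_def by blast
  define c' where "c' \<kappa> = (if 0 < \<kappa> (n - 1) then c (psi_idx n \<kappa>) else 0)" for \<kappa>
  have pos: "0 < phi_idx n \<kappa> (n - 1)" for \<kappa> using n by (simp add: phi_idx_def)
  show ?thesis
  proof (rule is_jackI[OF k phi_idx_multi, of c'])
    show "0 \<le> c' \<kappa>" for \<kappa> using c by (simp add: c'_def)
    show "c' (phi_idx n \<eta>) = 1" using pos c psi_phi_idx[OF n \<eta>] by (simp add: c'_def)
    fix x
    have "f = (\<lambda>x. \<Sum>\<kappa>\<in>deg_idx n ?m. of_real (c \<kappa>) * monom n \<kappa> x)" using c by auto
    then have "Phi_op n f x = (\<Sum>\<kappa>\<in>deg_idx n ?m. of_real (c \<kappa>) * Phi_op n (monom n \<kappa>) x)"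
      using Phi_op_sum by metis
    also have "\<dots> = (\<Sum>\<kappa>\<in>deg_idx n ?m. of_real (c \<kappa>) * monom n (phi_idx n \<kappa>) x)"
      by (simp add: Phi_op_monom[OF n])
    also have "\<dots> = (\<Sum>\<kappa>\<in>{\<kappa> \<in> deg_idx n (Suc ?m). 0 < \<kappa> (n - 1)}. of_real (c' \<kappa>) * monom n \<kappa> x)"
      unfolding sum_deg_idx_phi[OF n] using pos psi_phi_idx[OF n]
      by (intro sum.cong) (auto simp: c'_def deg_idx_def)
    also have "\<dots> = (\<Sum>\<kappa>\<in>deg_idx n (Suc ?m). of_real (c' \<kappa>) * monom n \<kappa> x)"
      by (rule sum.mono_neutral_left) (auto simp: c'_def)
    finally show "Phi_op n f x = (\<Sum>\<kappa>\<in>deg_idx n (absv n (phi_idx n \<eta>)). of_real (c' \<kappa>) * monom n \<kappa> x)"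
      by (simp add: absv_phi_idx[OF n])
  next
    fix j x assume j: "j < n"
    show "cher_D n k j (Phi_op n f) x = of_real (eigval n k (phi_idx n \<eta>) j) * Phi_op n f x"
    proof (cases "Suc j = n")
      case True
      then have e: "j = n - 1" by simp
      show ?thesis unfolding e cher_D_Phi_op_last[OF n a] eigval_phi_idx(2)[OF n]
        using n by (simp add: Phi_op_def is_jack_eig[OF f] algebra_simps)
    next
      case False
      then have "Suc j < n" using j by simp
      then show ?thesis using a
        by (simp add: cher_D_Phi_op eigval_phi_idx(1)) (simp add: Phi_op_def is_jack_eig[OF f])
    qed
  qed
qed

section \<open>The swap step of the recursion\<close>

lemma eigval_swap:
  assumes "Suc j < n" "\<eta> j \<noteq> \<eta> (Suc j)" "i < n"
  shows "eigval n k (\<eta> \<circ> swp j (Suc j)) i = eigval n k \<eta> (swp j (Suc j) i)"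
proof -
  have "swp j (Suc j) i < n" using assms by (auto simp: swp_def)
  then show ?thesis using assms rnk_swap[of j "Suc j" n \<eta>] by (simp add: eigval_rnk)
qed

text \<open>The larger entry has the smaller rank, so entries contribute at least 1 and ranks at
  least k. The surplus over k is what keeps \<open>swap_coef\<close> below 1.\<close>

lemma eigval_gap:
  assumes "0 \<le> k" "i < n" "j < n" "\<kappa> j < \<kappa> i"
  shows "1 + k \<le> eigval n k \<kappa> i - eigval n k \<kappa> j"
proof -
  have "rnk n \<kappa> i < rnk n \<kappa> j" using assms by (simp add: rnk_less_iff before_def)
  then have "k * real (rnk n \<kappa> i + 1) \<le> k * real (rnk n \<kappa> j)" using assms(1) by (intro mult_left_mono) auto
  moreover have "real (\<kappa> j) + 1 \<le> real (\<kappa> i)" using assms(4) by simp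
  ultimately show ?thesis using assms by (simp add: eigval_rnk algebra_simps)
qed

text \<open>Chosen so that the correction by k in \<open>cher_D_sw_pt\<close> is absorbed by this
  multiple of the difference of the two eigenvalues.\<close>

definition swap_coef :: "nat \<Rightarrow> real \<Rightarrow> (nat \<Rightarrow> nat) \<Rightarrow> nat \<Rightarrow> real" where
  "swap_coef n k \<kappa> j = k / (eigval n k \<kappa> (Suc j) - eigval n k \<kappa> j)"

lemma swap_coef_bounds:
  assumes "0 \<le> k" "Suc j < n" "\<kappa> j < \<kappa> (Suc j)"
  shows "0 \<le> swap_coef n k \<kappa> j" "swap_coef n k \<kappa> j < 1"
    "swap_coef n k \<kappa> j * (eigval n k \<kappa> (Suc j) - eigval n k \<kappa> j) = k"
  using eigval_gap[of k "Suc j" n j \<kappa>] assms by (auto simp: swap_coef_def field_simps)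

lemma is_jack_swap:
  assumes k: "0 \<le> k" and \<kappa>: "\<kappa> \<in> multi_idx n" and j: "Suc j < n" "\<kappa> j < \<kappa> (Suc j)" and f: "is_jack n k \<kappa> f"
  shows "is_jack n k (\<kappa> \<circ> swp j (Suc j)) (\<lambda>x. f (sw_pt j (Suc j) x) + of_real (swap_coef n k \<kappa> j) * f x)"
proof -
  let ?m = "absv n \<kappa>" and ?s = "swp j (Suc j)" and ?c = "swap_coef n k \<kappa> j"
  note a = is_jack_dir_diff[OF f]
  have jn: "j < n" using j by simp
  note sp = swp_permutes[OF jn j(1)]
  have s\<kappa>: "\<kappa> \<circ> ?s \<in> multi_idx n" by (rule multi_idx_perm[OF \<kappa> sp])
  have dg: "\<tau> \<circ> ?s \<in> deg_idx n ?m" if "\<tau> \<in> deg_idx n ?m" for \<tau>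
    using that multi_idx_perm[OF _ sp] absv_perm[OF sp] by (auto simp: deg_idx_def)
  obtain c :: "(nat \<Rightarrow> nat) \<Rightarrow> real" where c: "\<And>\<kappa>. 0 \<le> c \<kappa>" "c \<kappa> = 1"
    "\<And>x. f x = (\<Sum>\<kappa>\<in>deg_idx n ?m. of_real (c \<kappa>) * monom n \<kappa> x)"
    and supp: "\<And>\<tau>. \<tau> \<in> deg_idx n ?m \<Longrightarrow> c \<tau> \<noteq> 0 \<Longrightarrow> \<tau> = \<kappa> \<or> prec n \<tau> \<kappa>"
    using f unfolding is_jack_def by blast
  define c' where "c' \<tau> = c (\<tau> \<circ> ?s) + ?c * c \<tau>" for \<tau>
  show ?thesis
  proof (rule is_jackI[OF k s\<kappa>, of c'])
    show "0 \<le> c' \<tau>" for \<tau> using c swap_coef_bounds[of k j n \<kappa>] k j by (simp add: c'_def)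
    \<comment> \<open>Moving the larger entry left gives an index above \<kappa>, outside the
      support of f. Hence the leading coefficient of the new function is just that of f.\<close>
    have "c (\<kappa> \<circ> ?s) = 0"
    proof (rule ccontr)
      assume "c (\<kappa> \<circ> ?s) \<noteq> 0"
      moreover have "\<kappa> \<circ> ?s \<in> deg_idx n ?m" using \<kappa> by (intro dg) (simp add: deg_idx_def)
      ultimately have or: "\<kappa> \<circ> ?s = \<kappa> \<or> prec n (\<kappa> \<circ> ?s) \<kappa>" using supp by blast
      have "(\<kappa> \<circ> ?s) j \<noteq> \<kappa> j" using j by simp
      then have "prec n (\<kappa> \<circ> ?s) \<kappa>" using or by metis
      moreover have "prec n \<kappa> (\<kappa> \<circ> ?s)" using prec_swap[OF s\<kappa>, of j "Suc j"] j by simp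
      ultimately show False using prec_trans[OF _ _ \<kappa> s\<kappa>, of \<kappa>] prec_irrefl by blast
    qed
    then show "c' (\<kappa> \<circ> ?s) = 1" using c by (simp add: c'_def)
    fix x
    have "f (sw_pt j (Suc j) x) = (\<Sum>\<tau>\<in>deg_idx n ?m. of_real (c \<tau>) * monom n (\<tau> \<circ> ?s) x)"
      unfolding c(3) by (simp add: monom_sw_pt[OF jn j(1)])
    also have "\<dots> = (\<Sum>\<tau>\<in>deg_idx n ?m. of_real (c (\<tau> \<circ> ?s)) * monom n \<tau> x)"
      by (rule sum.reindex_bij_witness[where i = "\<lambda>\<tau>. \<tau> \<circ> ?s" and j = "\<lambda>\<tau>. \<tau> \<circ> ?s"]) (simp_all only: comp_swp_swp dg)
    finally show "f (sw_pt j (Suc j) x) + of_real ?c * f x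
      = (\<Sum>\<tau>\<in>deg_idx n (absv n (\<kappa> \<circ> ?s)). of_real (c' \<tau>) * monom n \<tau> x)"
      unfolding absv_perm[OF sp] c(3)[of x] c'_def
      by (simp only: of_real_add of_real_mult distrib_right sum.distrib sum_distrib_left mult.assoc)
  next
    fix i x assume i: "i < n"
    let ?y = "sw_pt j (Suc j) x"
    have as: "dir_diff (\<lambda>x. f (sw_pt j (Suc j) x))" by (rule dir_diff_sw_pt[OF a])
    have kc: "complex_of_real k = of_real ?c * (of_real (eigval n k \<kappa> (Suc j)) - of_real (eigval n k \<kappa> j))"
      using swap_coef_bounds(3)[of k j n \<kappa>] k j by (metis of_real_diff of_real_mult)
    have D: "cher_D n k i (\<lambda>x. f (sw_pt j (Suc j) x) + of_real ?c * f x) x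
      = cher_D n k i (\<lambda>x. f (sw_pt j (Suc j) x)) x + of_real ?c * (of_real (eigval n k \<kappa> i) * f x)"
      using cher_D_add[OF i as a] is_jack_eig[OF f i] by simp
    have ev: "eigval n k (\<kappa> \<circ> ?s) i = eigval n k \<kappa> (?s i)" using eigval_swap j i by simp
    consider "i = j" | "i = Suc j" | "i \<noteq> j" "i \<noteq> Suc j" by blast
    then show "cher_D n k i (\<lambda>x. f (sw_pt j (Suc j) x) + of_real ?c * f x) x
      = of_real (eigval n k (\<kappa> \<circ> ?s) i) * (f ?y + of_real ?c * f x)"
    proof cases
      case 1
      show ?thesis unfolding D ev unfolding 1 cher_D_sw_pt(1)[OF j(1)] is_jack_eig[OF f j(1)] kc
        by (simp add: algebra_simps)
    next
      case 2
      show ?thesis unfolding D ev unfolding 2 cher_D_sw_pt(2)[OF j(1)] is_jack_eig[OF f jn] kc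
        by (simp add: algebra_simps)
    next
      case 3
      then show ?thesis unfolding D ev cher_D_sw_pt(3)[OF j(1) i 3] is_jack_eig[OF f i]
        by (simp add: algebra_simps)
    qed
  qed
qed

text \<open>Any nonzero index arises by raising a smaller one and then moving its last nonzero entry
  left past zeros. The swap case records that everything right of the moved entry is 0; the growth
  estimate depends on this.\<close>

lemma multi_idx_induct [consumes 2, case_names zero phi swap]:
  assumes n: "1 \<le> n" and \<eta>: "\<eta> \<in> multi_idx n"
    and zero: "P (\<lambda>_. 0)"
    and phi: "\<And>\<eta>. \<eta> \<in> multi_idx n \<Longrightarrow> P \<eta> \<Longrightarrow> P (phi_idx n \<eta>)"
    and swap: "\<And>\<kappa> j. \<kappa> \<in> multi_idx n \<Longrightarrow> Suc j < n \<Longrightarrow> \<kappa> j = 0 \<Longrightarrow> 0 < \<kappa> (Suc j) \<Longrightarrow>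
      (\<forall>i>Suc j. \<kappa> i = 0) \<Longrightarrow> P \<kappa> \<Longrightarrow> P (\<kappa> \<circ> swp j (Suc j))"
  shows "P \<eta>"
  using \<eta>
proof (induction "absv n \<eta>" arbitrary: \<eta> rule: less_induct)
  case less
  \<comment> \<open>Inner induction on d, the distance of the last nonzero entry from the
    end.\<close>
  have step: "P \<kappa>" if "d < n" "\<kappa> \<in> multi_idx n" "absv n \<kappa> = absv n \<eta>" "0 < \<kappa> (n - 1 - d)"
    "\<forall>i>n - 1 - d. \<kappa> i = 0" for d \<kappa>
    using that
  proof (induction d arbitrary: \<kappa>)
    case 0
    have e: "phi_idx n (psi_idx n \<kappa>) = \<kappa>" using 0 by (intro phi_psi_idx[OF n]) auto
    have "Suc (absv n (psi_idx n \<kappa>)) = absv n \<eta>" using absv_phi_idx[OF n, of "psi_idx n \<kappa>"] e 0 by simp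
    then have "P (psi_idx n \<kappa>)" by (intro less.hyps psi_idx_multi[OF n]) auto
    then show ?case using phi[OF psi_idx_multi[OF n]] e by metis
  next
    case (Suc d)
    define j where "j = n - 1 - Suc d"
    have j: "Suc j < n" "n - 1 - d = Suc j" "j < n" using Suc.prems by (auto simp: j_def)
    have \<kappa>: "0 < \<kappa> j" "\<forall>i>j. \<kappa> i = 0" using Suc.prems j_def by auto
    let ?\<tau> = "\<kappa> \<circ> swp j (Suc j)"
    have z: "\<forall>i>Suc j. ?\<tau> i = 0" using \<kappa> by (auto simp: swp_def)
    have t: "?\<tau> \<in> multi_idx n" by (rule multi_idx_perm[OF Suc.prems(2) swp_permutes[OF j(3,1)]])
    have "P ?\<tau>"
    proof (rule Suc.IH[OF _ t])
      show "d < n" using Suc.prems(1) by simp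
      show "absv n ?\<tau> = absv n \<eta>" using Suc.prems(3) by (simp only: absv_perm[OF swp_permutes[OF j(3,1)]])
      show "0 < ?\<tau> (n - 1 - d)" "\<forall>i>n - 1 - d. ?\<tau> i = 0" unfolding j(2) using \<kappa> z by auto
    qed
    have "?\<tau> j = 0" "0 < ?\<tau> (Suc j)" using \<kappa> by auto
    from swap[OF t j(1) this z \<open>P ?\<tau>\<close>] show ?case by (simp only: comp_swp_swp)
  qed
  show ?case
  proof (cases "\<exists>i<n. 0 < \<eta> i")
    case False
    then have "\<eta> = (\<lambda>_. 0)" using less.prems by (intro multi_idx_eqI) (auto simp: multi_idx_def)
    then show ?thesis using zero by simp
  next
    case True
    define i where "i = Max {i. i < n \<and> 0 < \<eta> i}"
    have fin: "finite {i. i < n \<and> 0 < \<eta> i}" by simp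
    have i: "i < n" "0 < \<eta> i" using Max_in[OF fin] True by (auto simp: i_def)
    have "\<eta> l = 0" if "i < l" for l
    proof (rule ccontr)
      assume "\<eta> l \<noteq> 0"
      then have "l < n" "0 < \<eta> l" using less.prems by (cases "l < n"; auto simp: multi_idx_def)+
      then have "l \<le> i" unfolding i_def by (intro Max_ge fin) auto
      then show False using that by simp
    qed
    moreover have "n - 1 - (n - 1 - i) = i" using i by simp
    ultimately show ?thesis using i less.prems by (intro step[of "n - 1 - i"]) auto
  qed
qed

lemma is_jack_exists:
  assumes "0 \<le> k" "1 \<le> n" "\<eta> \<in> multi_idx n" shows "\<exists>f. is_jack n k \<eta> f"
  using assms(2,3)
proof (induction rule: multi_idx_induct)
  case zero then show ?case using is_jack_zero assms by blast
next
  case (phi \<eta>) then show ?case using is_jack_Phi_op assms by blast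
next
  case (swap \<kappa> j) then show ?case using is_jack_swap[OF assms(1)] by (metis (no_types))
qed

subsection \<open>Nonsymmetric Jack polynomials\<close>

text \<open>The number r is the sum of the coefficients, at least 1 because of the leading one. It
  also gives the nonvanishing at \<open>one_vec\<close> needed for independence and for the
  normalization of the series.\<close>

lemma is_jack_bound:
  assumes "is_jack n k \<eta> f" "\<eta> \<in> multi_idx n"
  shows "\<exists>r\<ge>1. f one_vec = complex_of_real r \<and>
    (\<forall>x R. (\<forall>i<n. cmod (x i) \<le> R) \<longrightarrow> cmod (f x) \<le> r * R ^ absv n \<eta>)"
proof -
  let ?M = "deg_idx n (absv n \<eta>)"
  obtain c :: "(nat \<Rightarrow> nat) \<Rightarrow> real" where c: "\<And>\<kappa>. 0 \<le> c \<kappa>" "c \<eta> = 1"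
    "\<And>x. f x = (\<Sum>\<kappa>\<in>?M. of_real (c \<kappa>) * monom n \<kappa> x)"
    using assms unfolding is_jack_def by blast
  have \<eta>: "\<eta> \<in> ?M" using assms by (simp add: deg_idx_def)
  show ?thesis
  proof (intro exI[of _ "\<Sum>\<kappa>\<in>?M. c \<kappa>"] conjI allI impI)
    show "1 \<le> (\<Sum>\<kappa>\<in>?M. c \<kappa>)" using member_le_sum[OF \<eta>, of c] c by simp
    show "f one_vec = of_real (\<Sum>\<kappa>\<in>?M. c \<kappa>)" unfolding c(3) by (simp add: monom_def one_vec_def)
    fix x :: "nat \<Rightarrow> complex" and R assume R: "\<forall>i<n. cmod (x i) \<le> R"
    have "cmod (monom n \<kappa> x) \<le> R ^ absv n \<eta>" if "\<kappa> \<in> ?M" for \<kappa>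
    proof -
      have "cmod (monom n \<kappa> x) = (\<Prod>i<n. cmod (x i) ^ \<kappa> i)" by (simp add: monom_def prod_norm[symmetric] norm_power)
      also have "\<dots> \<le> (\<Prod>i<n. R ^ \<kappa> i)" using R by (intro prod_mono) (auto intro: power_mono)
      also have "\<dots> = R ^ absv n \<kappa>" by (simp add: absv_def power_sum)
      finally show ?thesis using that by (simp add: deg_idx_def)
    qed
    then have "cmod (f x) \<le> (\<Sum>\<kappa>\<in>?M. c \<kappa> * R ^ absv n \<eta>)"
      unfolding c(3) by (intro sum_norm_le) (simp add: norm_mult c(1) mult_left_mono)
    then show "cmod (f x) \<le> (\<Sum>\<kappa>\<in>?M. c \<kappa>) * R ^ absv n \<eta>" by (simp add: sum_distrib_right)
  qed
qed

lemma is_jack_independent: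
  assumes k: "0 \<le> k" and S: "finite S" "S \<subseteq> multi_idx n" and F: "\<And>\<kappa>. \<kappa> \<in> S \<Longrightarrow> is_jack n k \<kappa> (F \<kappa>)"
    and zero: "\<And>x. (\<Sum>\<kappa>\<in>S. c \<kappa> * F \<kappa> x) = 0" and "\<kappa> \<in> S"
  shows "c \<kappa> = 0"
proof -
  have "\<forall>\<kappa>\<in>S. c \<kappa> = 0"
  proof (rule eigenfunctions_independent[where op = "cher_D n k" and f = F and ev = "\<lambda>j \<kappa>. of_real (eigval n k \<kappa> j)" and n = n])
    show "cher_D n k j (\<lambda>x. \<Sum>\<kappa>\<in>S'. c \<kappa> * F \<kappa> x) = (\<lambda>x. \<Sum>\<kappa>\<in>S'. c \<kappa> * cher_D n k j (F \<kappa>) x)"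
      if "j < n" "S' \<subseteq> S" for j c S'
      using that is_jack_dir_diff[OF F] by (intro ext cher_D_sum) auto
    show "cher_D n k j (F \<kappa>) x = of_real (eigval n k \<kappa> j) * F \<kappa> x" if "j < n" "\<kappa> \<in> S" for j \<kappa> x
      using that is_jack_eig[OF F] by blast
    show "\<exists>j<n. complex_of_real (eigval n k \<kappa> j) \<noteq> of_real (eigval n k \<kappa>' j)"
      if "\<kappa> \<in> S" "\<kappa>' \<in> S" "\<kappa> \<noteq> \<kappa>'" for \<kappa> \<kappa>'
    proof (rule ccontr)
      assume "\<not> (\<exists>j<n. complex_of_real (eigval n k \<kappa> j) \<noteq> of_real (eigval n k \<kappa>' j))"
      then have "eigval n k \<kappa> j = eigval n k \<kappa>' (id j)" if "j < n" for j using that by simp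
      then have "\<kappa> = \<kappa>' \<circ> id" using that S by (intro eigval_inj[OF k _ _ permutes_id]) auto
      then show False using that by simp
    qed
    show "\<exists>x. F \<kappa> x \<noteq> 0" if "\<kappa> \<in> S" for \<kappa>
    proof -
      have "\<kappa> \<in> multi_idx n" using that S by auto
      from is_jack_bound[OF F[OF that] this] obtain r :: real where "1 \<le> r" "F \<kappa> one_vec = of_real r" by blast
      then have "F \<kappa> one_vec \<noteq> 0" by simp
      then show ?thesis by blast
    qed
  qed (use S zero in auto)
  then show ?thesis using assms by blast
qed

lemma is_jack_low:
  assumes "is_jack n k \<eta> f" "\<eta> \<in> multi_idx n"
  obtains c where "\<And>x. f x = monom n \<eta> x + (\<Sum>\<kappa>\<in>low_idx n \<eta>. c \<kappa> * monom n \<kappa> x)"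
proof -
  let ?M = "deg_idx n (absv n \<eta>)"
  obtain c :: "(nat \<Rightarrow> nat) \<Rightarrow> real" where c: "c \<eta> = 1"
    "\<And>x. f x = (\<Sum>\<kappa>\<in>?M. of_real (c \<kappa>) * monom n \<kappa> x)"
    and supp: "\<And>\<tau>. \<tau> \<in> ?M \<Longrightarrow> c \<tau> \<noteq> 0 \<Longrightarrow> \<tau> = \<eta> \<or> prec n \<tau> \<eta>"
    using assms unfolding is_jack_def by blast
  have nl: "\<eta> \<notin> low_idx n \<eta>" using prec_irrefl by (simp add: low_idx_def)
  have sub: "insert \<eta> (low_idx n \<eta>) \<subseteq> ?M" using low_idx_subset[OF assms(2)] assms(2) by (auto simp: deg_idx_def)
  have "f x = monom n \<eta> x + (\<Sum>\<kappa>\<in>low_idx n \<eta>. of_real (c \<kappa>) * monom n \<kappa> x)" for x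
  proof -
    have "f x = (\<Sum>\<kappa>\<in>insert \<eta> (low_idx n \<eta>). of_real (c \<kappa>) * monom n \<kappa> x)"
      unfolding c(2)
    proof (rule sum.mono_neutral_right[OF finite_deg_idx sub], intro ballI)
      fix \<tau> assume t: "\<tau> \<in> ?M - insert \<eta> (low_idx n \<eta>)"
      then have "\<tau> \<in> multi_idx n" by (simp add: deg_idx_def)
      then have "c \<tau> = 0" using t supp[of \<tau>] by (auto simp: low_idx_def)
      then show "of_real (c \<tau>) * monom n \<tau> x = 0" by simp
    qed
    then show ?thesis using nl finite_low_idx[OF assms(2)] c by simp
  qed
  then show ?thesis by (rule that)
qed

text \<open>The unitriangular relation of \<open>is_jack_low\<close> is inverted by induction along
  the order, with the number of lower indices as measure.\<close>

lemma fspan_jack: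
  assumes F: "\<And>\<kappa>. \<kappa> \<in> deg_idx n m \<Longrightarrow> is_jack n k \<kappa> (F \<kappa>)" and f: "fspan (monom n) (deg_idx n m) f"
  shows "fspan F (deg_idx n m) f"
proof -
  have mono: "fspan F (deg_idx n m) (monom n \<eta>)" if "\<eta> \<in> deg_idx n m" for \<eta>
    using that
  proof (induction "card (low_idx n \<eta>)" arbitrary: \<eta> rule: less_induct)
    case less
    have \<eta>: "\<eta> \<in> multi_idx n" "absv n \<eta> = m" using less.prems by (auto simp: deg_idx_def)
    obtain c where c: "\<And>x. F \<eta> x = monom n \<eta> x + (\<Sum>\<kappa>\<in>low_idx n \<eta>. c \<kappa> * monom n \<kappa> x)"
      using is_jack_low[OF F[OF less.prems] \<eta>(1)] by blast
    have "fspan F (deg_idx n m) (monom n \<kappa>)" if \<kappa>: "\<kappa> \<in> low_idx n \<eta>" for \<kappa>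
    proof (rule less.hyps)
      show "\<kappa> \<in> deg_idx n m" using \<kappa> low_idx_subset[OF \<eta>(1)] \<eta>(2) by auto
      have km: "\<kappa> \<in> multi_idx n" "prec n \<kappa> \<eta>" using \<kappa> by (auto simp: low_idx_def)
      have "low_idx n \<kappa> \<subseteq> low_idx n \<eta>"
        using prec_trans[OF _ km(2) _ km(1)] by (auto simp: low_idx_def)
      moreover have "\<kappa> \<notin> low_idx n \<kappa>" using prec_irrefl by (simp add: low_idx_def)
      ultimately have "low_idx n \<kappa> \<subset> low_idx n \<eta>" using \<kappa> by auto
      then show "card (low_idx n \<kappa>) < card (low_idx n \<eta>)"
        using finite_low_idx[OF \<eta>(1)] by (rule psubset_card_mono[rotated])
    qed
    then have "fspan F (deg_idx n m) (\<lambda>x. F \<eta> x + (-1) * (\<Sum>\<kappa>\<in>low_idx n \<eta>. c \<kappa> * monom n \<kappa> x))"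
      using less.prems by (intro fspan_add fspan_cmult fspan_sum fspan_mem) auto
    moreover have "(\<lambda>x. F \<eta> x + (-1) * (\<Sum>\<kappa>\<in>low_idx n \<eta>. c \<kappa> * monom n \<kappa> x)) = monom n \<eta>"
      by (rule ext) (simp add: c)
    ultimately show ?case by simp
  qed
  obtain c where "\<And>x. f x = (\<Sum>\<kappa>\<in>deg_idx n m. c \<kappa> * monom n \<kappa> x)" using f unfolding fspan_def by blast
  then have "f = (\<lambda>x. \<Sum>\<kappa>\<in>deg_idx n m. c \<kappa> * monom n \<kappa> x)" by auto
  then show ?thesis using mono by (simp only:) (intro fspan_sum fspan_cmult, auto)
qed

text \<open>In the eigenbasis, separated spectra reduce g to a multiple d \<eta> of f; comparing the
  coefficient of the leading monomial gives d \<eta> = 1.\<close>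

lemma is_jack_unique:
  assumes k: "0 \<le> k" and n: "1 \<le> n" and \<eta>: "\<eta> \<in> multi_idx n" and f: "is_jack n k \<eta> f"
    and g: "\<And>x. g x = monom n \<eta> x + (\<Sum>\<kappa>\<in>low_idx n \<eta>. c \<kappa> * monom n \<kappa> x)"
    and eig: "\<And>j x. j < n \<Longrightarrow> cher_D n k j g x = of_real (eigval n k \<eta> j) * g x"
  shows "g = f"
proof -
  let ?m = "absv n \<eta>"
  let ?M = "deg_idx n ?m"
  \<comment> \<open>Eigenfunctions for the other indices are chosen abstractly, because
    \<open>jackE\<close> can be identified only after uniqueness.\<close>
  define F where "F \<kappa> = (if \<kappa> = \<eta> then f else (SOME h. is_jack n k \<kappa> h))" for \<kappa>
  have F: "is_jack n k \<kappa> (F \<kappa>)" if "\<kappa> \<in> ?M" for \<kappa>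
    using that f someI_ex[OF is_jack_exists[OF k n]] by (auto simp: F_def deg_idx_def)
  have \<eta>M: "\<eta> \<in> ?M" using \<eta> by (simp add: deg_idx_def)
  have subM: "?M \<subseteq> multi_idx n" by (auto simp: deg_idx_def)
  have "fspan (monom n) ?M (\<lambda>x. monom n \<eta> x + (\<Sum>\<kappa>\<in>low_idx n \<eta>. c \<kappa> * monom n \<kappa> x))"
    using low_idx_subset[OF \<eta>] \<eta>M by (intro fspan_add fspan_sum fspan_cmult fspan_mem) auto
  then have "fspan (monom n) ?M g" using g by (metis (no_types, lifting) ext)
  then obtain d where d: "\<And>x. g x = (\<Sum>\<kappa>\<in>?M. d \<kappa> * F \<kappa> x)"
    using fspan_jack[of n ?m k F g] F unfolding fspan_def by blast
  have ge: "g = (\<lambda>x. \<Sum>\<kappa>\<in>?M. d \<kappa> * F \<kappa> x)" using d by auto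
  have d0: "d \<kappa> = 0" if \<kappa>: "\<kappa> \<in> ?M" "\<kappa> \<noteq> \<eta>" for \<kappa>
  proof (rule ccontr)
    assume nz: "d \<kappa> \<noteq> 0"
    have "eigval n k \<kappa> j = eigval n k \<eta> (id j)" if j: "j < n" for j
    proof -
      have "(\<Sum>\<kappa>\<in>?M. (d \<kappa> * (of_real (eigval n k \<kappa> j) - of_real (eigval n k \<eta> j))) * F \<kappa> x) = 0" for x
      proof -
        have "(\<Sum>\<kappa>\<in>?M. d \<kappa> * cher_D n k j (F \<kappa>) x) = of_real (eigval n k \<eta> j) * (\<Sum>\<kappa>\<in>?M. d \<kappa> * F \<kappa> x)"
          using eig[OF j, of x] cher_D_sum[OF j, of ?M F k d x] is_jack_dir_diff[OF F] unfolding ge by simp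
        moreover have "(\<Sum>\<kappa>\<in>?M. d \<kappa> * cher_D n k j (F \<kappa>) x) = (\<Sum>\<kappa>\<in>?M. d \<kappa> * (of_real (eigval n k \<kappa> j) * F \<kappa> x))"
          using is_jack_eig[OF F j] by (intro sum.cong) auto
        ultimately show ?thesis by (simp add: algebra_simps sum_subtractf sum_distrib_left)
      qed
      then have "d \<kappa> * (of_real (eigval n k \<kappa> j) - of_real (eigval n k \<eta> j)) = 0"
        using \<kappa>(1) F subM
        by (intro is_jack_independent[OF k, of ?M n F "\<lambda>\<kappa>. d \<kappa> * (of_real (eigval n k \<kappa> j) - of_real (eigval n k \<eta> j))" \<kappa>]) simp_all
      then have "complex_of_real (eigval n k \<kappa> j) = of_real (eigval n k \<eta> j)" using nz by simp
      then show ?thesis by simp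
    qed
    then have "\<kappa> = \<eta> \<circ> id" using \<kappa> \<eta> by (intro eigval_inj[OF k _ \<eta> permutes_id]) (auto simp: deg_idx_def)
    then show False using \<kappa> by simp
  qed
  have gf: "g x = d \<eta> * f x" for x
  proof -
    have "g x = (\<Sum>\<kappa>\<in>{\<eta>}. d \<kappa> * F \<kappa> x)"
      unfolding d using \<eta>M d0 by (intro sum.mono_neutral_right) auto
    then show ?thesis by (simp add: F_def)
  qed
  obtain c' where c': "\<And>x. f x = monom n \<eta> x + (\<Sum>\<kappa>\<in>low_idx n \<eta>. c' \<kappa> * monom n \<kappa> x)"
    using is_jack_low[OF f \<eta>] by blast
  define b where "b \<kappa> = (if \<kappa> = \<eta> then 1 - d \<eta> else c \<kappa> - d \<eta> * c' \<kappa>)" for \<kappa>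
  have nl: "\<eta> \<notin> low_idx n \<eta>" using prec_irrefl by (simp add: low_idx_def)
  have "b \<eta> = 0"
  proof (rule monoms_independent[of "insert \<eta> (low_idx n \<eta>)" n b])
    fix x
    have "(\<Sum>\<kappa>\<in>low_idx n \<eta>. b \<kappa> * monom n \<kappa> x) = (\<Sum>\<kappa>\<in>low_idx n \<eta>. (c \<kappa> - d \<eta> * c' \<kappa>) * monom n \<kappa> x)"
      using nl by (intro sum.cong) (auto simp: b_def)
    then have "(\<Sum>\<kappa>\<in>insert \<eta> (low_idx n \<eta>). b \<kappa> * monom n \<kappa> x) = g x - d \<eta> * f x"
      unfolding g c' using nl finite_low_idx[OF \<eta>]
      by (simp add: b_def[of \<eta>] algebra_simps sum_subtractf sum_distrib_left)
    then show "(\<Sum>\<kappa>\<in>insert \<eta> (low_idx n \<eta>). b \<kappa> * monom n \<kappa> x) = 0" using gf by simp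
  qed (use \<eta> finite_low_idx[OF \<eta>] in \<open>auto simp: low_idx_def\<close>)
  then show ?thesis using gf by (auto simp: b_def)
qed

lemma jackE_eq:
  assumes k: "0 \<le> k" and n: "1 \<le> n" and \<eta>: "\<eta> \<in> multi_idx n" and f: "is_jack n k \<eta> f"
  shows "jackE n k \<eta> = f"
  unfolding jackE_def low_idx_def[symmetric]
proof (rule the_equality)
  obtain c where "\<And>x. f x = monom n \<eta> x + (\<Sum>\<kappa>\<in>low_idx n \<eta>. c \<kappa> * monom n \<kappa> x)"
    using is_jack_low[OF f \<eta>] by blast
  then show "(\<exists>c. f = (\<lambda>x. monom n \<eta> x + (\<Sum>\<kappa>\<in>low_idx n \<eta>. c \<kappa> * monom n \<kappa> x))) \<and>
      (\<forall>j<n. \<forall>x. cher_D n k j f x = of_real (eigval n k \<eta> j) * f x)"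
    using is_jack_eig[OF f] by blast
  fix g
  assume g: "(\<exists>c. g = (\<lambda>x. monom n \<eta> x + (\<Sum>\<kappa>\<in>low_idx n \<eta>. c \<kappa> * monom n \<kappa> x))) \<and>
      (\<forall>j<n. \<forall>x. cher_D n k j g x = of_real (eigval n k \<eta> j) * g x)"
  then obtain c where "g = (\<lambda>x. monom n \<eta> x + (\<Sum>\<kappa>\<in>low_idx n \<eta>. c \<kappa> * monom n \<kappa> x))" by blast
  then have "\<And>x. g x = monom n \<eta> x + (\<Sum>\<kappa>\<in>low_idx n \<eta>. c \<kappa> * monom n \<kappa> x)" by simp
  then show "g = f" using g by (intro is_jack_unique[OF k n \<eta> f]) auto
qed

locale jack_setup =
  fixes n :: nat and k :: real
  assumes n: "1 \<le> n" and k: "0 \<le> k"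
begin

abbreviation "E \<equiv> jackE n k"

lemma jackE_is_jack: "\<eta> \<in> multi_idx n \<Longrightarrow> is_jack n k \<eta> (E \<eta>)"
  using is_jack_exists[OF k n] jackE_eq[OF k n] by metis

lemma dir_diff_jackE: "\<eta> \<in> multi_idx n \<Longrightarrow> dir_diff (E \<eta>)"
  by (rule is_jack_dir_diff[OF jackE_is_jack])

lemma jackE_zero: "E (\<lambda>_. 0) = (\<lambda>_. 1)"
  by (intro jackE_eq[OF k n] is_jack_zero[OF k n]) (simp add: multi_idx_def)

lemma jackE_phi: "\<eta> \<in> multi_idx n \<Longrightarrow> E (phi_idx n \<eta>) = Phi_op n (E \<eta>)"
  by (intro jackE_eq[OF k n] is_jack_Phi_op[OF k n] jackE_is_jack phi_idx_multi)

lemma jackE_swap: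
  assumes "\<kappa> \<in> multi_idx n" "Suc j < n" "\<kappa> j < \<kappa> (Suc j)"
  shows "E (\<kappa> \<circ> swp j (Suc j)) x = E \<kappa> (sw_pt j (Suc j) x) + of_real (swap_coef n k \<kappa> j) * E \<kappa> x"
proof -
  have "E (\<kappa> \<circ> swp j (Suc j)) = (\<lambda>x. E \<kappa> (sw_pt j (Suc j) x) + of_real (swap_coef n k \<kappa> j) * E \<kappa> x)"
    using assms by (intro jackE_eq[OF k n] is_jack_swap[OF k] jackE_is_jack multi_idx_perm swp_permutes) auto
  then show ?thesis by simp
qed

lemma jackE_independent:
  assumes "\<And>x. (\<Sum>\<kappa>\<in>deg_idx n m. c \<kappa> * E \<kappa> x) = (\<Sum>\<kappa>\<in>deg_idx n m. d \<kappa> * E \<kappa> x)" "\<kappa> \<in> deg_idx n m"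
  shows "c \<kappa> = d \<kappa>"
proof -
  have "c \<kappa> - d \<kappa> = 0"
  proof (rule is_jack_independent[OF k, of "deg_idx n m" n E "\<lambda>\<kappa>. c \<kappa> - d \<kappa>"])
    show "deg_idx n m \<subseteq> multi_idx n" by (auto simp: deg_idx_def)
    show "is_jack n k \<kappa> (E \<kappa>)" if "\<kappa> \<in> deg_idx n m" for \<kappa> using that jackE_is_jack by (simp add: deg_idx_def)
  qed (use assms in \<open>auto simp: left_diff_distrib sum_subtractf\<close>)
  then show ?thesis by simp
qed

lemma fspan_jackE: "fspan (monom n) (deg_idx n m) f \<Longrightarrow> fspan E (deg_idx n m) f"
  by (rule fspan_jack[OF jackE_is_jack]) (auto simp: deg_idx_def)

lemma fspan_coord_mult:
  assumes "fspan (monom n) (deg_idx n m) f" "l < n"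
  shows "fspan (monom n) (deg_idx n (Suc m)) (\<lambda>x. x l * f x)"
proof -
  obtain c where c: "\<And>x. f x = (\<Sum>\<kappa>\<in>deg_idx n m. c \<kappa> * monom n \<kappa> x)" using assms unfolding fspan_def by blast
  have "\<kappa>(l := Suc (\<kappa> l)) \<in> deg_idx n (Suc m)" if "\<kappa> \<in> deg_idx n m" for \<kappa>
  proof -
    have "absv n (\<kappa>(l := Suc (\<kappa> l))) = Suc (absv n \<kappa>)"
      unfolding absv_def using assms(2) sum.remove[of "{..<n}" l "\<kappa>(l := Suc (\<kappa> l))"] sum.remove[of "{..<n}" l \<kappa>] by simp
    then show ?thesis using that assms(2) by (auto simp: deg_idx_def multi_idx_def)
  qed
  then have "fspan (monom n) (deg_idx n (Suc m)) (\<lambda>x. \<Sum>\<kappa>\<in>deg_idx n m. c \<kappa> * monom n (\<kappa>(l := Suc (\<kappa> l))) x)"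
    by (intro fspan_sum fspan_cmult fspan_mem) auto
  moreover have "(\<Sum>\<kappa>\<in>deg_idx n m. c \<kappa> * monom n (\<kappa>(l := Suc (\<kappa> l))) x) = x l * f x" for x
    unfolding c sum_distrib_left coord_mult_monom[OF assms(2), symmetric] by (simp add: algebra_simps)
  ultimately show ?thesis by simp
qed

lemma fspan_sum_power: "fspan (monom n) (deg_idx n m) (\<lambda>z. (\<Sum>i<n. z i) ^ m)"
proof (induction m)
  case 0
  have "(\<lambda>_. 0) \<in> deg_idx n 0" by (simp add: deg_idx_def multi_idx_def absv_def)
  from fspan_mem[OF finite_deg_idx this, of "monom n"] show ?case by (simp add: monom_def[abs_def])
next
  case (Suc m)
  have "fspan (monom n) (deg_idx n (Suc m)) (\<lambda>z. \<Sum>i<n. z i * (\<Sum>i<n. z i) ^ m)"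
    by (intro fspan_sum fspan_coord_mult Suc) auto
  then show ?case by (simp add: sum_distrib_right)
qed

abbreviation "C \<equiv> coefs n k"

text \<open>This resolves the definite description in \<open>coefs\<close>: existence by spanning,
  uniqueness by independence together with the vanishing off degree m.\<close>

lemma sum_power_coefs: "(\<Sum>i<n. z i) ^ m = (\<Sum>\<kappa>\<in>deg_idx n m. C m \<kappa> * E \<kappa> z)"
proof -
  let ?P = "\<lambda>c. (\<forall>\<kappa>. \<kappa> \<notin> deg_idx n m \<longrightarrow> c \<kappa> = 0) \<and>
      (\<forall>z. (\<Sum>i<n. z i) ^ m = (\<Sum>\<kappa>\<in>deg_idx n m. c \<kappa> * E \<kappa> z))"
  obtain c where c: "?P c" using fspan_jackE[OF fspan_sum_power] unfolding fspan_def by metis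
  have "d = c" if "?P d" for d
  proof
    fix \<kappa> show "d \<kappa> = c \<kappa>"
    proof (cases "\<kappa> \<in> deg_idx n m")
      case True
      show ?thesis by (rule jackE_independent[OF _ True]) (use c that in metis)
    qed (use c that in simp)
  qed
  with c have P: "?P (THE c. ?P c)" by (rule theI)
  have eq: "C m = (THE c. ?P c)" unfolding coefs_def deg_idx_def ..
  have "?P (C m)" unfolding eq by (rule P)
  then show ?thesis by auto
qed

text \<open>Since the cyclic shift permutes the Dunkl operators cyclically, the n-th power of this lowering operator
  is the product of all of them, in the given order; their commutativity is never used.\<close>

definition Psi_op :: "((nat \<Rightarrow> complex) \<Rightarrow> complex) \<Rightarrow> (nat \<Rightarrow> complex) \<Rightarrow> complex" where
  "Psi_op f x = dunkl n k (unit_vec (n - 1)) f (x \<circ> cyc n)"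

text \<open>The eigenvalue of T_0 x_0 on \<open>E \<eta>\<close>, as computed by
  \<open>dunkl_zero_coord_mult\<close>.\<close>

definition phi_fac :: "(nat \<Rightarrow> nat) \<Rightarrow> real" where
  "phi_fac \<eta> = eigval n k \<eta> 0 + 1 + k * (real n - 1)"

text \<open>The shifts in \<open>Psi_op\<close> and \<open>Phi_op\<close> cancel, so their
  composition is T_0 x_0.\<close>

lemma Psi_op_jackE_phi:
  assumes "\<eta> \<in> multi_idx n"
  shows "Psi_op (E (phi_idx n \<eta>)) x = of_real (phi_fac \<eta>) * E \<eta> x"
proof -
  have "Psi_op (E (phi_idx n \<eta>)) x = dunkl n k (unit_vec 0) (\<lambda>x. x 0 * E \<eta> x) (x \<circ> cyc n \<circ> dcyc n)"
    unfolding Psi_op_def jackE_phi[OF assms] by (rule dunkl_Phi_op_last[OF n])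
  also have "\<dots> = dunkl n k (unit_vec 0) (\<lambda>x. x 0 * E \<eta> x) x" by (simp only: cyc_o_dcyc)
  also have "\<dots> = of_real (phi_fac \<eta>) * E \<eta> x"
    using n unfolding dunkl_zero_coord_mult[OF n dir_diff_jackE[OF assms]]
    by (simp add: is_jack_eig[OF jackE_is_jack[OF assms]] phi_fac_def algebra_simps)
  finally show ?thesis .
qed

lemma rnk_le: "j < n \<Longrightarrow> rnk n \<eta> j \<le> n - 1"
  using permutes_in_image[OF rnk_permutes[of n \<eta>], of j] by auto

lemma phi_fac_pos: "1 \<le> phi_fac \<eta>"
proof -
  have "k * real (rnk n \<eta> 0) \<le> k * (real n - 1)"
    using rnk_le[of 0 \<eta>] n k by (intro mult_left_mono) (auto simp: of_nat_diff)
  then show ?thesis using n by (simp add: phi_fac_def eigval_rnk)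
qed

text \<open>An entry 0 in the last place has rank n - 1, so its eigenvalue -k(n - 1) equals the
  constant term of \<open>cher_D\<close> and leaves x_{n-1} T_{n-1} E = 0. It remains to divide by
  x_{n-1}.\<close>

lemma dunkl_last_jackE_zero:
  assumes \<kappa>: "\<kappa> \<in> multi_idx n" "\<kappa> (n - 1) = 0"
  shows "dunkl n k (unit_vec (n - 1)) (E \<kappa>) x = 0"
proof -
  let ?g = "dunkl n k (unit_vec (n - 1)) (E \<kappa>)"
  have n1: "n - 1 < n" using n by simp
  have "{i. i < n \<and> before \<kappa> i (n - 1)} = {..<n - 1}"
  proof (rule set_eqI)
    fix i show "i \<in> {i. i < n \<and> before \<kappa> i (n - 1)} \<longleftrightarrow> i \<in> {..<n - 1}"
      using \<kappa> n by (cases "i = n - 1") (auto simp: before_def)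
  qed
  then have "rnk n \<kappa> (n - 1) = n - 1" using n1 by (simp add: rnk_def)
  then have ev: "eigval n k \<kappa> (n - 1) = - k * (real n - 1)" using n \<kappa> by (simp add: eigval_rnk of_nat_diff)
  have emp: "{n - 1<..<n} = {}" by auto
  have xg: "x (n - 1) * ?g x = 0" for x
    using is_jack_eig[OF jackE_is_jack[OF \<kappa>(1)] n1, of x]
    unfolding cher_D_def emp ev by (simp add: algebra_simps)
  obtain c :: "(nat \<Rightarrow> nat) \<Rightarrow> real" where
    "\<And>x. E \<kappa> x = (\<Sum>\<tau>\<in>deg_idx n (absv n \<kappa>). of_real (c \<tau>) * monom n \<tau> x)"
    using jackE_is_jack[OF \<kappa>(1)] unfolding is_jack_def by blast
  then have Ee: "E \<kappa> = (\<lambda>x. \<Sum>\<tau>\<in>deg_idx n (absv n \<kappa>). of_real (c \<tau>) * monom n \<tau> x)" by auto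
  have "?g = (\<lambda>x. \<Sum>\<tau>\<in>deg_idx n (absv n \<kappa>). of_real (c \<tau>) * dunkl n k (unit_vec (n - 1)) (monom n \<tau>) x)"
    unfolding Ee by (rule ext, rule dunkl_sum[OF n1]) auto
  then have ag: "dir_diff ?g" using n1 by (simp only:) (intro dir_diff_sum dir_diff_mult dir_diff_const dir_diff_dunkl_monom)
  show ?thesis
  proof (cases "x (n - 1) = 0")
    case True
    \<comment> \<open>On the hyperplane x_{n-1} = 0 the division is replaced by differentiating the
      identity in direction n - 1.\<close>
    have "0 = dir_deriv (unit_vec (n - 1)) (\<lambda>x. x (n - 1) * ?g x) x" by (simp only: xg dir_deriv_const)
    also have "\<dots> = ?g x" using ag True by (simp only: dir_deriv_mult dir_diff_coord dir_deriv_coord) (simp add: unit_vec_apply)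
    finally show ?thesis by simp
  qed (use xg[of x] in simp)
qed

lemma Psi_op_jackE_zero: "\<kappa> \<in> multi_idx n \<Longrightarrow> \<kappa> (n - 1) = 0 \<Longrightarrow> Psi_op (E \<kappa>) x = 0"
  unfolding Psi_op_def by (rule dunkl_last_jackE_zero)

lemma Psi_op_sum:
  "(\<And>i. i \<in> S \<Longrightarrow> dir_diff (f i)) \<Longrightarrow> Psi_op (\<lambda>x. \<Sum>i\<in>S. c i * f i x) x = (\<Sum>i\<in>S. c i * Psi_op (f i) x)"
  unfolding Psi_op_def by (rule dunkl_sum) (use n in auto)

text \<open>The function is symmetric, so all difference quotients vanish and only the derivative
  acts.\<close>

lemma Psi_op_sum_power: "Psi_op (\<lambda>z. (\<Sum>i<n. z i) ^ Suc m) x = of_nat (Suc m) * (\<Sum>i<n. x i) ^ m"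
proof -
  let ?f = "\<lambda>z :: nat \<Rightarrow> complex. (\<Sum>i<n. z i) ^ Suc m" and ?y = "x \<circ> cyc n"
  have n1: "n - 1 < n" using n by simp
  have perm: "(\<Sum>i<n. (z \<circ> \<sigma>) i) = (\<Sum>i<n. z i)" if "\<sigma> permutes {..<n}" for z :: "nat \<Rightarrow> complex" and \<sigma>
    using sum.permute[OF that, of z] by simp
  have a: "dir_diff ?f" by (intro dir_diff_power dir_diff_sum dir_diff_coord)
  have dq: "diff_quot (n - 1) b ?f y = 0" if "b \<in> {..<n} - {n - 1}" for b y
  proof (rule diff_quot_eqI[OF a, where q = "\<lambda>_. 0"])
    fix y :: "nat \<Rightarrow> complex"
    show "?f y - ?f (sw_pt (n - 1) b y) = (y (n - 1) - y b) * 0"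
      unfolding sw_pt_def using perm[OF swp_permutes[OF n1, of b]] that by simp
  qed (use that in auto)
  have "dir_deriv (unit_vec (n - 1)) ?f ?y = of_nat (Suc m) * (\<Sum>i<n. ?y i) ^ m"
  proof (rule dir_derivI)
    have "(\<Sum>i<n. unit_vec (n - 1) i) = 1" using n1 by (simp add: unit_vec_apply)
    then have "(\<Sum>i<n. ?y i + t * unit_vec (n - 1) i) = (\<Sum>i<n. ?y i) + t" for t
      by (simp only: sum.distrib sum_distrib_left[symmetric]) simp
    then have "(\<lambda>t. (\<Sum>i<n. ?y i + t * unit_vec (n - 1) i) ^ Suc m) = (\<lambda>t. ((\<Sum>i<n. ?y i) + t) ^ Suc m)" by simp
    moreover have "((\<lambda>t. ((\<Sum>i<n. ?y i) + t) ^ Suc m) has_field_derivative of_nat (Suc m) * (\<Sum>i<n. ?y i) ^ m) (at 0)"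
      by (auto intro!: derivative_eq_intros simp del: power_Suc)
    ultimately show "((\<lambda>t. (\<Sum>i<n. ?y i + t * unit_vec (n - 1) i) ^ Suc m)
      has_field_derivative of_nat (Suc m) * (\<Sum>i<n. ?y i) ^ m) (at 0)" by (simp only:)
  qed
  then show ?thesis unfolding Psi_op_def dunkl_unit[OF n1] using dq perm[OF cyc_permutes, of x] by simp
qed

lemma coefs_phi:
  assumes "\<eta> \<in> multi_idx n"
  shows "C (Suc (absv n \<eta>)) (phi_idx n \<eta>) * of_real (phi_fac \<eta>) = of_nat (Suc (absv n \<eta>)) * C (absv n \<eta>) \<eta>"
proof (rule jackE_independent[where m = "absv n \<eta>" and c = "\<lambda>\<eta>. C (Suc (absv n \<eta>)) (phi_idx n \<eta>) * of_real (phi_fac \<eta>)"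
      and d = "\<lambda>\<eta>. of_nat (Suc (absv n \<eta>)) * C (absv n \<eta>) \<eta>"])
  let ?m = "absv n \<eta>"
  show "\<eta> \<in> deg_idx n ?m" using assms by (simp add: deg_idx_def)
  fix x
  have mi: "\<kappa> \<in> multi_idx n" if "\<kappa> \<in> deg_idx n m" for \<kappa> m using that by (simp add: deg_idx_def)
  have "of_nat (Suc ?m) * (\<Sum>i<n. x i) ^ ?m = Psi_op (\<lambda>z. \<Sum>\<kappa>\<in>deg_idx n (Suc ?m). C (Suc ?m) \<kappa> * E \<kappa> z) x"
  proof -
    have "(\<lambda>z. (\<Sum>i<n. z i) ^ Suc ?m) = (\<lambda>z. \<Sum>\<kappa>\<in>deg_idx n (Suc ?m). C (Suc ?m) \<kappa> * E \<kappa> z)"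
      by (rule ext, rule sum_power_coefs)
    then show ?thesis using Psi_op_sum_power[of ?m x] by metis
  qed
  also have "\<dots> = (\<Sum>\<kappa>\<in>deg_idx n (Suc ?m). C (Suc ?m) \<kappa> * Psi_op (E \<kappa>) x)"
    using mi dir_diff_jackE by (intro Psi_op_sum) auto
  \<comment> \<open>Indices with last entry 0 are killed; the others are exactly the images under
    \<open>phi_idx\<close>, so the sum returns to degree m.\<close>
  also have "\<dots> = (\<Sum>\<kappa>\<in>{\<kappa> \<in> deg_idx n (Suc ?m). 0 < \<kappa> (n - 1)}. C (Suc ?m) \<kappa> * Psi_op (E \<kappa>) x)"
    using mi Psi_op_jackE_zero by (intro sum.mono_neutral_right) auto
  also have "\<dots> = (\<Sum>\<kappa>\<in>deg_idx n ?m. C (Suc ?m) (phi_idx n \<kappa>) * Psi_op (E (phi_idx n \<kappa>)) x)"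
    by (rule sum_deg_idx_phi[OF n])
  also have "\<dots> = (\<Sum>\<kappa>\<in>deg_idx n ?m. C (Suc (absv n \<kappa>)) (phi_idx n \<kappa>) * of_real (phi_fac \<kappa>) * E \<kappa> x)"
    using Psi_op_jackE_phi[OF mi] by (intro sum.cong) (auto simp: deg_idx_def)
  finally have "(\<Sum>\<kappa>\<in>deg_idx n ?m. C (Suc (absv n \<kappa>)) (phi_idx n \<kappa>) * of_real (phi_fac \<kappa>) * E \<kappa> x)
    = of_nat (Suc ?m) * (\<Sum>i<n. x i) ^ ?m" ..
  also have "\<dots> = (\<Sum>\<kappa>\<in>deg_idx n ?m. of_nat (Suc (absv n \<kappa>)) * C (absv n \<kappa>) \<kappa> * E \<kappa> x)"
    unfolding sum_power_coefs sum_distrib_left by (intro sum.cong) (auto simp: deg_idx_def)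
  finally show "(\<Sum>\<kappa>\<in>deg_idx n ?m. C (Suc (absv n \<kappa>)) (phi_idx n \<kappa>) * of_real (phi_fac \<kappa>) * E \<kappa> x)
    = (\<Sum>\<kappa>\<in>deg_idx n ?m. of_nat (Suc (absv n \<kappa>)) * C (absv n \<kappa>) \<kappa> * E \<kappa> x)" .
qed

subsection \<open>The expansion of powers of the coordinate sum\<close>

lemma deg_idx_multi: "\<kappa> \<in> deg_idx n m \<Longrightarrow> \<kappa> \<in> multi_idx n"
  by (simp add: deg_idx_def)

lemma sum_two_terms:
  fixes g :: "(nat \<Rightarrow> nat) \<Rightarrow> complex"
  assumes "\<eta> \<in> deg_idx n m" "\<kappa> \<in> deg_idx n m" "\<eta> \<noteq> \<kappa>"
  shows "(\<Sum>\<rho>\<in>deg_idx n m. (if \<rho> = \<eta> then a else if \<rho> = \<kappa> then b else 0) * g \<rho>) = a * g \<eta> + b * g \<kappa>"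
proof -
  have "(\<Sum>\<rho>\<in>deg_idx n m. (if \<rho> = \<eta> then a else if \<rho> = \<kappa> then b else 0) * g \<rho>)
    = (\<Sum>\<rho>\<in>{\<eta>, \<kappa>}. (if \<rho> = \<eta> then a else if \<rho> = \<kappa> then b else 0) * g \<rho>)"
    using assms by (intro sum.mono_neutral_right) auto
  then show ?thesis using assms by simp
qed

text \<open>The eigenvalue equations leave only these two terms; comparing coefficients in the symmetric function
  (z_1 + ... + z_n)^m then relates the coefficients of the two indices.\<close>

lemma jackE_sw_pt_expand:
  assumes j: "Suc j < n" and \<tau>: "\<tau> \<in> deg_idx n m"
  shows "\<exists>e. (\<forall>\<rho>\<in>deg_idx n m. e \<rho> \<noteq> 0 \<longrightarrow> \<rho> = \<tau> \<or> \<rho> = \<tau> \<circ> swp j (Suc j)) \<and>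
    (\<forall>x. E \<tau> (sw_pt j (Suc j) x) = (\<Sum>\<rho>\<in>deg_idx n m. e \<rho> * E \<rho> x))"
proof -
  let ?s = "swp j (Suc j)" and ?f = "\<lambda>x. E \<tau> (sw_pt j (Suc j) x)"
  have jn: "j < n" using j by simp
  note sp = swp_permutes[OF jn j]
  have \<tau>n: "\<tau> \<in> multi_idx n" "absv n \<tau> = m" using \<tau> by (auto simp: deg_idx_def)
  note J = jackE_is_jack[OF \<tau>n(1)]
  obtain c :: "(nat \<Rightarrow> nat) \<Rightarrow> real" where c: "\<And>x. E \<tau> x = (\<Sum>\<kappa>\<in>deg_idx n m. of_real (c \<kappa>) * monom n \<kappa> x)"
    using J \<tau>n(2) unfolding is_jack_def by blast
  have "\<kappa> \<circ> ?s \<in> deg_idx n m" if "\<kappa> \<in> deg_idx n m" for \<kappa>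
    using that multi_idx_perm[OF _ sp] absv_perm[OF sp] by (auto simp: deg_idx_def)
  then have "fspan (monom n) (deg_idx n m) (\<lambda>x. \<Sum>\<kappa>\<in>deg_idx n m. of_real (c \<kappa>) * monom n (\<kappa> \<circ> ?s) x)"
    by (intro fspan_sum fspan_cmult fspan_mem) auto
  then have "fspan (monom n) (deg_idx n m) ?f" by (simp only: c monom_sw_pt[OF jn j])
  from fspan_jackE[OF this] obtain e where e: "\<And>x. ?f x = (\<Sum>\<rho>\<in>deg_idx n m. e \<rho> * E \<rho> x)"
    unfolding fspan_def by blast
  have "\<rho> = \<tau> \<circ> ?s" if \<rho>: "\<rho> \<in> deg_idx n m" "e \<rho> \<noteq> 0" "\<rho> \<noteq> \<tau>" for \<rho>
  proof (rule eigval_inj[OF k deg_idx_multi[OF \<rho>(1)] \<tau>n(1) sp])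
    fix a assume a: "a < n"
    \<comment> \<open>The correction from \<open>cher_D_sw_pt\<close>. It multiplies
      \<open>E \<tau>\<close> itself, so it affects only the coefficient at \<tau>.\<close>
    define \<delta> :: complex where "\<delta> = (if a = j then of_real k else if a = Suc j then - of_real k else 0)"
    have sa: "?s a < n" using permutes_in_image[OF sp, of a] a by simp
    have D1: "cher_D n k a ?f x = of_real (eigval n k \<tau> (?s a)) * ?f x + \<delta> * E \<tau> x" for x
      using cher_D_sw_pt[OF j, where k = k and f = "E \<tau>" and x = x] is_jack_eig[OF J] a j jn
      by (cases "a = j"; cases "a = Suc j") (auto simp: \<delta>_def)
    have fe: "?f = (\<lambda>x. \<Sum>\<rho>\<in>deg_idx n m. e \<rho> * E \<rho> x)" by (rule ext) (rule e)
    have D2: "cher_D n k a ?f x = (\<Sum>\<rho>\<in>deg_idx n m. e \<rho> * (of_real (eigval n k \<rho> a) * E \<rho> x))" for x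
    proof -
      have "cher_D n k a ?f x = (\<Sum>\<rho>\<in>deg_idx n m. e \<rho> * cher_D n k a (E \<rho>) x)"
        unfolding fe by (rule cher_D_sum[OF a]) (simp add: dir_diff_jackE deg_idx_multi)
      also have "\<dots> = (\<Sum>\<rho>\<in>deg_idx n m. e \<rho> * (of_real (eigval n k \<rho> a) * E \<rho> x))"
        using is_jack_eig[OF jackE_is_jack[OF deg_idx_multi] a] by (intro sum.cong) auto
      finally show ?thesis .
    qed
    have "(\<Sum>\<rho>\<in>deg_idx n m. (e \<rho> * (of_real (eigval n k \<rho> a) - of_real (eigval n k \<tau> (?s a)))) * E \<rho> x)
      = (\<Sum>\<rho>\<in>deg_idx n m. (if \<rho> = \<tau> then \<delta> else 0) * E \<rho> x)" for x
    proof -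
      have "(\<Sum>\<rho>\<in>deg_idx n m. (e \<rho> * (of_real (eigval n k \<rho> a) - of_real (eigval n k \<tau> (?s a)))) * E \<rho> x)
        = cher_D n k a ?f x - of_real (eigval n k \<tau> (?s a)) * ?f x"
        unfolding D2 by (simp add: e sum_distrib_left sum_subtractf algebra_simps)
      also have "\<dots> = \<delta> * E \<tau> x" using D1 by simp
      also have "\<dots> = (\<Sum>\<rho>\<in>deg_idx n m. if \<rho> = \<tau> then \<delta> * E \<rho> x else 0)" using \<tau> by simp
      also have "\<dots> = (\<Sum>\<rho>\<in>deg_idx n m. (if \<rho> = \<tau> then \<delta> else 0) * E \<rho> x)" by (intro sum.cong) auto
      finally show ?thesis .
    qed
    from jackE_independent[where c = "\<lambda>\<rho>. e \<rho> * (of_real (eigval n k \<rho> a) - of_real (eigval n k \<tau> (?s a)))", OF this \<rho>(1)]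
    have "complex_of_real (eigval n k \<rho> a) = of_real (eigval n k \<tau> (?s a))" using \<rho> by simp
    then show "eigval n k \<rho> a = eigval n k \<tau> (?s a)" by simp
  qed
  then show ?thesis using e by blast
qed

text \<open>In the reflected expansion only \<kappa> and its swap contribute to the coefficient at
  the swap: \<kappa> with weight 1, the swap with weight \<open>swap_coef n k \<kappa> j\<close>.
  Invariance of the coordinate sum equates the result with the original coefficient.\<close>

lemma coefs_swap:
  assumes \<kappa>: "\<kappa> \<in> multi_idx n" and j: "Suc j < n" "\<kappa> j < \<kappa> (Suc j)"
  shows "C (absv n \<kappa>) (\<kappa> \<circ> swp j (Suc j)) * (1 - of_real (swap_coef n k \<kappa> j)) = C (absv n \<kappa>) \<kappa>"
proof -
  let ?s = "swp j (Suc j)" and ?m = "absv n \<kappa>"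
  let ?\<eta> = "\<kappa> \<circ> ?s" and ?M = "deg_idx n ?m"
  let ?c = "complex_of_real (swap_coef n k \<kappa> j)"
  have jn: "j < n" using j by simp
  note sp = swp_permutes[OF jn j(1)]
  have \<kappa>M: "\<kappa> \<in> ?M" using \<kappa> by (simp add: deg_idx_def)
  have \<eta>M: "?\<eta> \<in> ?M" using multi_idx_perm[OF \<kappa> sp] absv_perm[OF sp] by (simp add: deg_idx_def)
  have ne: "?\<eta> \<noteq> \<kappa>" using j by (metis comp_apply less_irrefl swp_simps(1))
  have "\<forall>\<tau>\<in>?M. \<exists>e. (\<forall>\<rho>\<in>?M. e \<rho> \<noteq> 0 \<longrightarrow> \<rho> = \<tau> \<or> \<rho> = \<tau> \<circ> ?s) \<and>
    (\<forall>x. E \<tau> (sw_pt j (Suc j) x) = (\<Sum>\<rho>\<in>?M. e \<rho> * E \<rho> x))"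
    using jackE_sw_pt_expand[OF j(1)] by blast
  from bchoice[OF this] obtain e where e: "\<forall>\<tau>\<in>?M. (\<forall>\<rho>\<in>?M. e \<tau> \<rho> \<noteq> 0 \<longrightarrow> \<rho> = \<tau> \<or> \<rho> = \<tau> \<circ> ?s) \<and>
    (\<forall>x. E \<tau> (sw_pt j (Suc j) x) = (\<Sum>\<rho>\<in>?M. e \<tau> \<rho> * E \<rho> x))" ..
  have ex: "E \<tau> (sw_pt j (Suc j) x) = (\<Sum>\<rho>\<in>?M. e \<tau> \<rho> * E \<rho> x)" if "\<tau> \<in> ?M" for \<tau> x using e that by blast
  have e0: "\<tau> = ?\<eta> \<or> \<tau> = \<kappa>" if t: "\<tau> \<in> ?M" "e \<tau> ?\<eta> \<noteq> 0" for \<tau>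
  proof -
    have "?\<eta> = \<tau> \<or> ?\<eta> = \<tau> \<circ> ?s" using e t \<eta>M by blast
    then show ?thesis by (metis comp_swp_swp)
  qed
  note sw = jackE_swap[OF \<kappa> j]
  have sk: "E \<kappa> (sw_pt j (Suc j) x) = 1 * E ?\<eta> x + (- ?c) * E \<kappa> x" for x using sw[of x] by simp
  have "(\<Sum>\<rho>\<in>?M. e \<kappa> \<rho> * E \<rho> x) = (\<Sum>\<rho>\<in>?M. (if \<rho> = ?\<eta> then 1 else if \<rho> = \<kappa> then - ?c else 0) * E \<rho> x)" for x
    unfolding sum_two_terms[OF \<eta>M \<kappa>M ne] ex[OF \<kappa>M, symmetric] by (rule sk)
  from jackE_independent[OF this \<eta>M] have e1: "e \<kappa> ?\<eta> = 1" by simp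
  \<comment> \<open>Evaluating \<open>jackE_swap\<close> at the reflected point and eliminating the
    reflected \<open>E \<kappa>\<close> closes the two-dimensional span under the
    transposition.\<close>
  have s\<eta>: "E ?\<eta> (sw_pt j (Suc j) x) = ?c * E ?\<eta> x + (1 - ?c * ?c) * E \<kappa> x" for x
  proof -
    have "sw_pt j (Suc j) (sw_pt j (Suc j) x) = x" by (simp add: sw_pt_def)
    then show ?thesis using sw[of "sw_pt j (Suc j) x"] sk[of x] by (simp add: algebra_simps)
  qed
  have "(\<Sum>\<rho>\<in>?M. e ?\<eta> \<rho> * E \<rho> x) = (\<Sum>\<rho>\<in>?M. (if \<rho> = ?\<eta> then ?c else if \<rho> = \<kappa> then 1 - ?c * ?c else 0) * E \<rho> x)" for x
    unfolding sum_two_terms[OF \<eta>M \<kappa>M ne] ex[OF \<eta>M, symmetric] by (rule s\<eta>)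
  from jackE_independent[OF this \<eta>M] have e2: "e ?\<eta> ?\<eta> = ?c" by simp
  have "(\<Sum>\<rho>\<in>?M. C ?m \<rho> * E \<rho> x) = (\<Sum>\<rho>\<in>?M. (\<Sum>\<tau>\<in>?M. C ?m \<tau> * e \<tau> \<rho>) * E \<rho> x)" for x
  proof -
    have "(\<Sum>i<n. sw_pt j (Suc j) x i) = (\<Sum>i<n. x i)"
      using sum.permute[OF sp, of x] by (simp add: sw_pt_def)
    then have "(\<Sum>\<rho>\<in>?M. C ?m \<rho> * E \<rho> x) = (\<Sum>\<tau>\<in>?M. C ?m \<tau> * E \<tau> (sw_pt j (Suc j) x))"
      unfolding sum_power_coefs[symmetric] by simp
    also have "\<dots> = (\<Sum>\<tau>\<in>?M. C ?m \<tau> * (\<Sum>\<rho>\<in>?M. e \<tau> \<rho> * E \<rho> x))" using ex by (intro sum.cong) auto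
    also have "\<dots> = (\<Sum>\<tau>\<in>?M. \<Sum>\<rho>\<in>?M. C ?m \<tau> * e \<tau> \<rho> * E \<rho> x)" by (simp add: sum_distrib_left mult.assoc)
    also have "\<dots> = (\<Sum>\<rho>\<in>?M. \<Sum>\<tau>\<in>?M. C ?m \<tau> * e \<tau> \<rho> * E \<rho> x)" by (rule sum.swap)
    finally show ?thesis by (simp add: sum_distrib_right)
  qed
  from jackE_independent[OF this \<eta>M] have "C ?m ?\<eta> = (\<Sum>\<tau>\<in>?M. C ?m \<tau> * e \<tau> ?\<eta>)" .
  also have "\<dots> = (\<Sum>\<tau>\<in>{?\<eta>, \<kappa>}. C ?m \<tau> * e \<tau> ?\<eta>)"
    using \<eta>M \<kappa>M e0 by (intro sum.mono_neutral_right) auto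
  also have "\<dots> = C ?m ?\<eta> * ?c + C ?m \<kappa>" using ne e1 e2 by simp
  finally have "C ?m ?\<eta> - C ?m ?\<eta> * ?c = C ?m \<kappa>" by (metis add_diff_cancel_left')
  then show ?thesis by (simp only: right_diff_distrib mult_1_right)
qed

definition coefR :: "(nat \<Rightarrow> nat) \<Rightarrow> real" where
  "coefR \<eta> = Re (C (absv n \<eta>) \<eta>)"

text \<open>Both recursions divide by a positive number, \<open>phi_fac\<close> and 1 -
  \<open>swap_coef\<close> respectively, starting from the coefficient 1 in degree 0.\<close>

lemma coefs_pos:
  assumes "\<eta> \<in> multi_idx n" shows "C (absv n \<eta>) \<eta> = of_real (coefR \<eta>)" "0 < coefR \<eta>"
proof -
  have "\<exists>r>0. C (absv n \<eta>) \<eta> = complex_of_real r"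
    using n assms
  proof (induction rule: multi_idx_induct)
    case zero
    have a: "absv n (\<lambda>_. 0) = 0" by (simp add: absv_def)
    have "C 0 (\<lambda>_. 0) = 1" using sum_power_coefs[of "\<lambda>_. 0" 0] by (simp add: jackE_zero deg_idx_zero)
    then show ?case unfolding a by (intro exI[of _ 1]) simp
  next
    case (phi \<eta>)
    then obtain r where r: "0 < r" "C (absv n \<eta>) \<eta> = complex_of_real r" by blast
    have "C (absv n (phi_idx n \<eta>)) (phi_idx n \<eta>) = of_real (real (Suc (absv n \<eta>)) * r / phi_fac \<eta>)"
      using coefs_phi[OF phi(1)] phi_fac_pos[of \<eta>] unfolding absv_phi_idx[OF n] r(2)
      by (simp add: field_simps)
    moreover have "0 < real (Suc (absv n \<eta>)) * r / phi_fac \<eta>" using r phi_fac_pos[of \<eta>] by simp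
    ultimately show ?case by blast
  next
    case (swap \<kappa> j)
    then obtain r where r: "0 < r" "C (absv n \<kappa>) \<kappa> = complex_of_real r" by blast
    have lt: "\<kappa> j < \<kappa> (Suc j)" using swap by simp
    have jn: "j < n" using swap by simp
    note b = swap_coef_bounds[OF k swap(2) lt]
    have ne: "1 - complex_of_real (swap_coef n k \<kappa> j) \<noteq> 0" using b(2)
      by (metis eq_iff_diff_eq_0 less_irrefl of_real_1 of_real_eq_iff)
    have "C (absv n \<kappa>) (\<kappa> \<circ> swp j (Suc j)) = of_real (r / (1 - swap_coef n k \<kappa> j))"
      using coefs_swap[OF swap(1,2) lt] ne unfolding r(2) by (simp add: field_simps)
    moreover have "0 < r / (1 - swap_coef n k \<kappa> j)" using r b by simp
    ultimately show ?case unfolding absv_perm[OF swp_permutes[OF jn swap(2)]] by blast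
  qed
  then show "C (absv n \<eta>) \<eta> = of_real (coefR \<eta>)" "0 < coefR \<eta>" by (auto simp: coefR_def)
qed

abbreviation "L \<equiv> jackL n k"

lemma jackL_eq: "L \<eta> = (\<lambda>z. C (absv n \<eta>) \<eta> * E \<eta> z)"
  by (rule ext) (simp add: jackL_def)

lemma dir_diff_jackL: "\<eta> \<in> multi_idx n \<Longrightarrow> dir_diff (L \<eta>)"
  unfolding jackL_eq by (intro dir_diff_mult dir_diff_const dir_diff_jackE)

lemma Psi_op_cmult: "dir_diff f \<Longrightarrow> Psi_op (\<lambda>x. c * f x) x = c * Psi_op f x"
  unfolding Psi_op_def using n by (intro dunkl_cmult) auto

definition betaE :: "(nat \<Rightarrow> nat) \<Rightarrow> complex" where
  "betaE \<kappa> = (if 0 < \<kappa> (n - 1) then of_real (phi_fac (psi_idx n \<kappa>)) else 0)"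

text \<open>For the normalization \<open>L\<close>, the recursion \<open>coefs_phi\<close> trades
  \<open>phi_fac\<close> for the degree, so the factor no longer involves k.\<close>

definition betaL :: "(nat \<Rightarrow> nat) \<Rightarrow> complex" where
  "betaL \<kappa> = (if 0 < \<kappa> (n - 1) then of_nat (absv n \<kappa>) else 0)"

lemma Psi_op_jackE: "\<kappa> \<in> multi_idx n \<Longrightarrow> Psi_op (E \<kappa>) x = betaE \<kappa> * E (psi_idx n \<kappa>) x"
  using Psi_op_jackE_zero[of \<kappa> x] Psi_op_jackE_phi[OF psi_idx_multi[OF n], of \<kappa> x] phi_psi_idx[OF n, of \<kappa>]
  by (cases "0 < \<kappa> (n - 1)") (auto simp: betaE_def)

lemma Psi_op_jackL:
  assumes "\<kappa> \<in> multi_idx n" shows "Psi_op (L \<kappa>) x = betaL \<kappa> * L (psi_idx n \<kappa>) x"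
proof -
  have e: "Psi_op (L \<kappa>) x = C (absv n \<kappa>) \<kappa> * (betaE \<kappa> * E (psi_idx n \<kappa>) x)"
    unfolding jackL_eq Psi_op_cmult[OF dir_diff_jackE[OF assms]] Psi_op_jackE[OF assms] ..
  show ?thesis
  proof (cases "0 < \<kappa> (n - 1)")
    case True
    note pp = phi_psi_idx[OF n assms True]
    have "C (absv n \<kappa>) \<kappa> * of_real (phi_fac (psi_idx n \<kappa>)) = of_nat (absv n \<kappa>) * C (absv n (psi_idx n \<kappa>)) (psi_idx n \<kappa>)"
      using coefs_phi[OF psi_idx_multi[OF n], of \<kappa>] absv_phi_idx[OF n, of "psi_idx n \<kappa>"] unfolding pp by simp
    then show ?thesis unfolding e using True by (simp add: betaE_def betaL_def jackL_eq algebra_simps)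
  qed (simp add: e betaE_def betaL_def)
qed

section \<open>Iterates of the lowering operator\<close>

lemma psi_idx_pow_multi: "\<eta> \<in> multi_idx n \<Longrightarrow> (psi_idx n ^^ i) \<eta> \<in> multi_idx n"
  by (induction i) (auto simp: psi_idx_multi[OF n])

text \<open>The family and its factor are abstract in order to serve \<open>E\<close> and
  \<open>L\<close> alike; finite sums are built in for the orbit sums \<open>jackC\<close>.\<close>

lemma Psi_op_pow_sum:
  assumes F: "\<And>\<kappa>. \<kappa> \<in> multi_idx n \<Longrightarrow> dir_diff (F \<kappa>)"
    and P: "\<And>\<kappa> x. \<kappa> \<in> multi_idx n \<Longrightarrow> Psi_op (F \<kappa>) x = \<beta> \<kappa> * F (psi_idx n \<kappa>) x"
    and S: "S \<subseteq> multi_idx n"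
  shows "(Psi_op ^^ i) (\<lambda>x. \<Sum>\<eta>\<in>S. c \<eta> * F \<eta> x)
    = (\<lambda>x. \<Sum>\<eta>\<in>S. (c \<eta> * (\<Prod>t<i. \<beta> ((psi_idx n ^^ t) \<eta>))) * F ((psi_idx n ^^ i) \<eta>) x)"
proof (induction i)
  case (Suc i)
  have "(Psi_op ^^ Suc i) (\<lambda>x. \<Sum>\<eta>\<in>S. c \<eta> * F \<eta> x)
    = Psi_op (\<lambda>x. \<Sum>\<eta>\<in>S. (c \<eta> * (\<Prod>t<i. \<beta> ((psi_idx n ^^ t) \<eta>))) * F ((psi_idx n ^^ i) \<eta>) x)"
    using Suc by simp
  also have "\<dots> = (\<lambda>x. \<Sum>\<eta>\<in>S. (c \<eta> * (\<Prod>t<i. \<beta> ((psi_idx n ^^ t) \<eta>))) * Psi_op (F ((psi_idx n ^^ i) \<eta>)) x)"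
    by (rule ext, rule Psi_op_sum) (use S F psi_idx_pow_multi in blast)
  also have "\<dots> = (\<lambda>x. \<Sum>\<eta>\<in>S. (c \<eta> * (\<Prod>t<Suc i. \<beta> ((psi_idx n ^^ t) \<eta>))) * F ((psi_idx n ^^ Suc i) \<eta>) x)"
  proof (intro ext sum.cong refl)
    fix x \<eta> assume "\<eta> \<in> S"
    then have "(psi_idx n ^^ i) \<eta> \<in> multi_idx n" using S psi_idx_pow_multi by blast
    from P[OF this] show "(c \<eta> * (\<Prod>t<i. \<beta> ((psi_idx n ^^ t) \<eta>))) * Psi_op (F ((psi_idx n ^^ i) \<eta>)) x
      = (c \<eta> * (\<Prod>t<Suc i. \<beta> ((psi_idx n ^^ t) \<eta>))) * F ((psi_idx n ^^ Suc i) \<eta>) x" by simp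
  qed
  finally show ?case .
qed simp

lemma cyc_pow: "(cyc n ^^ i) m = (if m < n then (m + i) mod n else m)"
proof (induction i)
  case (Suc i)
  show ?case
  proof (cases "m < n")
    case True
    then have "(m + i) mod n < n" by simp
    then have "cyc n ((m + i) mod n) = Suc (m + i) mod n"
      by (auto simp: cyc_def mod_Suc)
    then show ?thesis using Suc True by simp
  qed (use Suc in \<open>simp add: cyc_def\<close>)
qed simp

lemma Psi_op_pow_eq_foldr:
  assumes "i \<le> n"
  shows "(Psi_op ^^ i) f = foldr (\<lambda>j g. dunkl n k (unit_vec j) g) [0..<i] (\<lambda>x. f (x \<circ> (cyc n ^^ i)))"
  using assms
proof (induction i arbitrary: f)
  case (Suc i)
  have p: "cyc n ^^ i permutes {..<n}" for i
    by (induction i) (simp_all only: funpow.simps permutes_id permutes_compose cyc_permutes)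
  have n1: "n - 1 < n" using n by simp
  \<comment> \<open>After i + 1 shifts the last position has become i modulo n, so the next operator
    in the product is T_i.\<close>
  have c: "(cyc n ^^ Suc i) (n - 1) = i"
    unfolding cyc_pow using Suc.prems n by simp
  have "Psi_op f (x \<circ> (cyc n ^^ i)) = dunkl n k (unit_vec i) (\<lambda>x. f (x \<circ> (cyc n ^^ Suc i))) x" for x
  proof -
    have "Psi_op f (x \<circ> (cyc n ^^ i)) = dunkl n k (unit_vec (n - 1)) f (x \<circ> (cyc n ^^ Suc i))"
      unfolding Psi_op_def comp_assoc funpow_Suc_right ..
    then show ?thesis using dunkl_perm[OF p[of "Suc i"] n1, of k f x] unfolding c by simp
  qed
  then have e: "(\<lambda>x. Psi_op f (x \<circ> (cyc n ^^ i))) = dunkl n k (unit_vec i) (\<lambda>x. f (x \<circ> (cyc n ^^ Suc i)))" by (rule ext)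
  have "(Psi_op ^^ Suc i) f = (Psi_op ^^ i) (Psi_op f)" by (simp only: funpow_Suc_right o_apply)
  also have "\<dots> = foldr (\<lambda>j g. dunkl n k (unit_vec j) g) [0..<i] (\<lambda>x. Psi_op f (x \<circ> (cyc n ^^ i)))"
    by (rule Suc.IH) (use Suc.prems in simp)
  finally show ?case unfolding e by (simp add: comp_def)
qed simp

lemma dunkl_Delta_eq: "dunkl_Delta n k f = (Psi_op ^^ n) f"
proof -
  have "cyc n ^^ n = id" by (auto simp: fun_eq_iff cyc_pow)
  then show ?thesis unfolding dunkl_Delta_def Psi_op_pow_eq_foldr[OF order_refl] by simp
qed

lemma psi_idx_pow:
  assumes "\<eta> \<in> multi_idx n" "i \<le> n"
  shows "(psi_idx n ^^ i) \<eta> m = (if m < i then \<eta> (n - i + m) - 1 else if m < n then \<eta> (m - i) else 0)"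
  using assms(2)
proof (induction i arbitrary: m)
  case 0 then show ?case using assms by (auto simp: multi_idx_def)
next
  case (Suc i)
  have IH: "(psi_idx n ^^ i) \<eta> m = (if m < i then \<eta> (n - i + m) - 1 else if m < n then \<eta> (m - i) else 0)" for m
    using Suc by simp
  show ?case
  proof (cases m)
    case 0
    then show ?thesis using Suc.prems by (simp add: psi_idx_def[of n "(psi_idx n ^^ i) \<eta>"] IH)
  next
    case (Suc m')
    moreover have "Suc (n + m' - Suc i) = n + m' - i" using \<open>Suc i \<le> n\<close> by simp
    ultimately show ?thesis using \<open>Suc i \<le> n\<close> by (auto simp: psi_idx_def[of n "(psi_idx n ^^ i) \<eta>"] IH)
  qed
qed

lemma psi_idx_pow_n: "\<eta> \<in> multi_idx n \<Longrightarrow> (psi_idx n ^^ n) \<eta> = minus_one \<eta>"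
  by (auto simp: fun_eq_iff psi_idx_pow minus_one_def multi_idx_def)

lemma psi_idx_pow_last:
  "\<eta> \<in> multi_idx n \<Longrightarrow> i < n \<Longrightarrow> (psi_idx n ^^ i) \<eta> (n - 1) = \<eta> (n - 1 - i)"
  using n by (auto simp: psi_idx_pow)

text \<open>A zero at position j arrives at the last position after n - 1 - j steps, and there the
  factor vanishes.\<close>

lemma prod_zero_of_zero_entry:
  assumes "\<eta> \<in> multi_idx n" "j < n" "\<eta> j = 0" "\<And>\<kappa>. \<kappa> (n - 1) = 0 \<Longrightarrow> \<beta> \<kappa> = (0::complex)"
  shows "(\<Prod>t<n. \<beta> ((psi_idx n ^^ t) \<eta>)) = 0"
proof -
  have "(psi_idx n ^^ (n - 1 - j)) \<eta> (n - 1) = 0"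
    using psi_idx_pow_last[OF assms(1), of "n - 1 - j"] assms(2,3) by simp
  then have "\<beta> ((psi_idx n ^^ (n - 1 - j)) \<eta>) = 0" by (rule assms(4))
  then show ?thesis using assms(2) by (intro prod_zero bexI[of _ "n - 1 - j"]) auto
qed

text \<open>Positive entries make each step a genuine inverse of \<open>phi_idx\<close>, so the
  eigenvalues rotate with the entries and drop by 1 on passing the end.\<close>

lemma eigval_psi_pow:
  assumes \<eta>: "\<eta> \<in> multi_idx n" and pos: "\<And>j. j < n \<Longrightarrow> 0 < \<eta> j" and "i \<le> n" "m < n"
  shows "eigval n k ((psi_idx n ^^ i) \<eta>) m = (if m < i then eigval n k \<eta> (n - i + m) - 1 else eigval n k \<eta> (m - i))"
  using assms(3,4)
proof (induction i arbitrary: m)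
  case (Suc i)
  let ?\<kappa> = "(psi_idx n ^^ i) \<eta>"
  have m: "?\<kappa> \<in> multi_idx n" by (rule psi_idx_pow_multi[OF \<eta>])
  have "0 < ?\<kappa> (n - 1)" using psi_idx_pow_last[OF \<eta>, of i] Suc.prems pos[of "n - 1 - i"] by simp
  note pp = phi_psi_idx[OF n m this]
  show ?case
  proof (cases m)
    case 0
    have "eigval n k (psi_idx n ?\<kappa>) 0 = eigval n k ?\<kappa> (n - 1) - 1"
      using eigval_phi_idx(2)[OF n, of k "psi_idx n ?\<kappa>"] unfolding pp by simp
    then show ?thesis using Suc 0 n by simp
  next
    case (Suc m')
    have "eigval n k (psi_idx n ?\<kappa>) m = eigval n k ?\<kappa> m'"
      using eigval_phi_idx(1)[of m' n k "psi_idx n ?\<kappa>"] Suc Suc.prems unfolding pp by simp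
    moreover have "Suc (n + m' - Suc i) = n + m' - i" using Suc.prems by simp
    ultimately show ?thesis using Suc Suc.IH[of m'] Suc.prems by simp
  qed
qed simp

definition delta_eig :: "(nat \<Rightarrow> nat) \<Rightarrow> real" where
  "delta_eig \<eta> = (if \<forall>i<n. 1 \<le> \<eta> i then \<Prod>j<n. eigval n k \<eta> j + k * (real n - 1) else 0)"

lemma prod_betaE:
  assumes \<eta>: "\<eta> \<in> multi_idx n" and pos: "\<And>j. j < n \<Longrightarrow> 0 < \<eta> j"
  shows "(\<Prod>t<n. betaE ((psi_idx n ^^ t) \<eta>)) = of_real (\<Prod>j<n. eigval n k \<eta> j + k * (real n - 1))"
proof -
  have "betaE ((psi_idx n ^^ t) \<eta>) = of_real (eigval n k \<eta> (n - Suc t) + k * (real n - 1))" if t: "t < n" for t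
  proof -
    let ?\<kappa> = "(psi_idx n ^^ t) \<eta>"
    have "0 < ?\<kappa> (n - 1)" using psi_idx_pow_last[OF \<eta> t] t pos[of "n - 1 - t"] by simp
    \<comment> \<open>This drop by 1 cancels the 1 added in \<open>phi_fac\<close>.\<close>
    moreover have "eigval n k (psi_idx n ?\<kappa>) 0 = eigval n k \<eta> (n - Suc t) - 1"
      using eigval_psi_pow[OF \<eta> pos, of "Suc t" 0] t n by simp
    ultimately show ?thesis by (simp add: betaE_def phi_fac_def)
  qed
  then have "(\<Prod>t<n. betaE ((psi_idx n ^^ t) \<eta>)) = (\<Prod>t<n. complex_of_real (eigval n k \<eta> (n - Suc t) + k * (real n - 1)))"
    by (intro prod.cong) auto
  also have "\<dots> = (\<Prod>j<n. complex_of_real (eigval n k \<eta> j + k * (real n - 1)))"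
    by (rule prod.nat_diff_reindex)
  finally show ?thesis by simp
qed

lemma dunkl_Delta_jackE:
  assumes "\<eta> \<in> multi_idx n"
  shows "dunkl_Delta n k (E \<eta>) = (\<lambda>x. of_real (delta_eig \<eta>) * E (minus_one \<eta>) x)"
proof -
  have "(Psi_op ^^ n) (\<lambda>x. \<Sum>\<eta>\<in>{\<eta>}. 1 * E \<eta> x)
    = (\<lambda>x. \<Sum>\<eta>\<in>{\<eta>}. (1 * (\<Prod>t<n. betaE ((psi_idx n ^^ t) \<eta>))) * E ((psi_idx n ^^ n) \<eta>) x)"
    by (rule Psi_op_pow_sum[where F = E and \<beta> = betaE]) (use assms dir_diff_jackE Psi_op_jackE in auto)
  then have "dunkl_Delta n k (E \<eta>) = (\<lambda>x. (\<Prod>t<n. betaE ((psi_idx n ^^ t) \<eta>)) * E (minus_one \<eta>) x)"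
    unfolding dunkl_Delta_eq psi_idx_pow_n[OF assms, symmetric] by simp
  moreover have "(\<Prod>t<n. betaE ((psi_idx n ^^ t) \<eta>)) = of_real (delta_eig \<eta>)"
  proof (cases "\<forall>i<n. 1 \<le> \<eta> i")
    case True
    then show ?thesis using prod_betaE[OF assms] by (force simp: delta_eig_def Suc_le_eq)
  next
    case False
    then obtain j where "j < n" "\<eta> j = 0" by (auto simp: not_le)
    from prod_zero_of_zero_entry[OF assms this, of betaE] show ?thesis using False by (auto simp: delta_eig_def betaE_def)
  qed
  ultimately show ?thesis by simp
qed

text \<open>Reindexing by rank expresses the product through the sorted index alone.\<close>

lemma delta_eig_perm:
  assumes "\<eta> \<in> multi_idx n" "\<sigma> permutes {..<n}" shows "delta_eig (\<eta> \<circ> \<sigma>) = delta_eig \<eta>"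
proof -
  have *: "(\<Prod>j<n. eigval n k \<eta> j + k * (real n - 1)) = (\<Prod>i<n. real (plus_part n \<eta> i) - k * real i + k * (real n - 1))"
    if "\<eta> \<in> multi_idx n" for \<eta>
    using prod.permute[OF rnk_permutes[of n \<eta>], of "\<lambda>i. real (plus_part n \<eta> i) - k * real i + k * (real n - 1)"]
    by (simp add: plus_part_o_rnk[OF that] eigval_rnk)
  have "(\<forall>i<n. 1 \<le> (\<eta> \<circ> \<sigma>) i) \<longleftrightarrow> (\<forall>i<n. 1 \<le> \<eta> i)"
    using permutes_in_image[OF assms(2)] permutes_in_image[OF permutes_inv[OF assms(2)]]
    by (metis comp_apply lessThan_iff permutes_inverses(1)[OF assms(2)])
  then show ?thesis unfolding delta_eig_def *[OF assms(1)] *[OF multi_idx_perm[OF assms]] plus_part_perm[OF assms] by simp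
qed

lemma absv_psi_pow:
  assumes \<eta>: "\<eta> \<in> multi_idx n" and pos: "\<And>j. j < n \<Longrightarrow> 0 < \<eta> j" and "i \<le> n"
  shows "absv n ((psi_idx n ^^ i) \<eta>) + i = absv n \<eta>"
  using assms(3)
proof (induction i)
  case (Suc i)
  let ?\<kappa> = "(psi_idx n ^^ i) \<eta>"
  have m: "?\<kappa> \<in> multi_idx n" by (rule psi_idx_pow_multi[OF \<eta>])
  have "0 < ?\<kappa> (n - 1)" using psi_idx_pow_last[OF \<eta>, of i] Suc.prems pos[of "n - 1 - i"] by simp
  note pp = phi_psi_idx[OF n m this]
  show ?case using absv_phi_idx[OF n, of "psi_idx n ?\<kappa>"] Suc unfolding pp by simp
qed simp

text \<open>The degree falls by 1 at each step, so the factors telescope to a quotient of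
  factorials.\<close>

lemma prod_betaL:
  assumes \<eta>: "\<eta> \<in> multi_idx n"
  shows "(\<Prod>t<n. betaL ((psi_idx n ^^ t) \<eta>)) = d_coef n \<eta>"
proof (cases "\<forall>i<n. \<eta> i \<noteq> 0")
  case False
  then obtain j where "j < n" "\<eta> j = 0" by auto
  from prod_zero_of_zero_entry[OF \<eta> this, of betaL] show ?thesis using False by (auto simp: d_coef_def betaL_def)
next
  case True
  then have pos: "\<And>j. j < n \<Longrightarrow> 0 < \<eta> j" by simp
  have "(\<Prod>t<i. betaL ((psi_idx n ^^ t) \<eta>)) * fact (absv n ((psi_idx n ^^ i) \<eta>)) = fact (absv n \<eta>)" if "i \<le> n" for i
    using that
  proof (induction i)
    case (Suc i)
    let ?\<kappa> = "(psi_idx n ^^ i) \<eta>"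
    have "0 < ?\<kappa> (n - 1)" using psi_idx_pow_last[OF \<eta>, of i] Suc.prems pos[of "n - 1 - i"] by simp
    moreover have "absv n ?\<kappa> = Suc (absv n (psi_idx n ?\<kappa>))"
      using absv_psi_pow[OF \<eta> pos, of i] absv_psi_pow[OF \<eta> pos, of "Suc i"] Suc.prems by simp
    ultimately have "betaL ?\<kappa> * fact (absv n (psi_idx n ?\<kappa>)) = fact (absv n ?\<kappa>)"
      by (simp add: betaL_def)
    then show ?case using Suc by (simp add: mult.assoc)
  qed simp
  from this[of n] have "(\<Prod>t<n. betaL ((psi_idx n ^^ t) \<eta>)) * fact (absv n (minus_one \<eta>)) = fact (absv n \<eta>)"
    by (simp add: psi_idx_pow_n[OF \<eta>])
  then show ?thesis using True by (simp add: d_coef_def field_simps)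
qed

lemma dunkl_Delta_sum_jackL:
  assumes "S \<subseteq> multi_idx n"
  shows "dunkl_Delta n k (\<lambda>x. \<Sum>\<eta>\<in>S. L \<eta> x) = (\<lambda>x. \<Sum>\<eta>\<in>S. d_coef n \<eta> * L (minus_one \<eta>) x)"
proof -
  have "dunkl_Delta n k (\<lambda>x. \<Sum>\<eta>\<in>S. 1 * L \<eta> x)
    = (\<lambda>x. \<Sum>\<eta>\<in>S. (1 * (\<Prod>t<n. betaL ((psi_idx n ^^ t) \<eta>))) * L ((psi_idx n ^^ n) \<eta>) x)"
    unfolding dunkl_Delta_eq 
    by (rule Psi_op_pow_sum[where F = L and \<beta> = betaL]) (use assms dir_diff_jackL Psi_op_jackL in auto)
  also have "\<dots> = (\<lambda>x. \<Sum>\<eta>\<in>S. d_coef n \<eta> * L (minus_one \<eta>) x)"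
    using assms prod_betaL psi_idx_pow_n by (intro ext sum.cong) auto
  finally show ?thesis by simp
qed

lemma dunkl_Delta_jackL:
  "\<eta> \<in> multi_idx n \<Longrightarrow> dunkl_Delta n k (L \<eta>) = (\<lambda>x. d_coef n \<eta> * L (minus_one \<eta>) x)"
  using dunkl_Delta_sum_jackL[of "{\<eta>}"] by simp

section \<open>Shifting all entries, and sums over orbits\<close>

lemma minus_one_perm: "minus_one (\<eta> \<circ> \<sigma>) = minus_one \<eta> \<circ> \<sigma>"
  by (auto simp: minus_one_def)

lemma minus_one_multi: "\<eta> \<in> multi_idx n \<Longrightarrow> minus_one \<eta> \<in> multi_idx n"
  by (auto simp: minus_one_def multi_idx_def)

definition plus_one :: "(nat \<Rightarrow> nat) \<Rightarrow> nat \<Rightarrow> nat" where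
  "plus_one \<kappa> i = (if i < n then Suc (\<kappa> i) else 0)"

lemma plus_one_multi: "plus_one \<kappa> \<in> multi_idx n"
  by (auto simp: plus_one_def multi_idx_def)

lemma minus_plus_one: "\<kappa> \<in> multi_idx n \<Longrightarrow> minus_one (plus_one \<kappa>) = \<kappa>"
  by (auto simp: plus_one_def minus_one_def multi_idx_def fun_eq_iff)

lemma plus_minus_one: "\<eta> \<in> multi_idx n \<Longrightarrow> \<forall>i<n. \<eta> i \<noteq> 0 \<Longrightarrow> plus_one (minus_one \<eta>) = \<eta>"
  by (auto simp: plus_one_def minus_one_def multi_idx_def fun_eq_iff)

lemma plus_one_perm: "\<sigma> permutes {..<n} \<Longrightarrow> plus_one (\<kappa> \<circ> \<sigma>) = plus_one \<kappa> \<circ> \<sigma>"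
  using permutes_in_image[of \<sigma> "{..<n}"] by (auto simp: plus_one_def fun_eq_iff)

lemma plus_part_minus_one:
  assumes "\<eta> \<in> multi_idx n" shows "plus_part n (minus_one \<eta>) = minus_one (plus_part n \<eta>)"
proof -
  let ?r = "inv (rnk n \<eta>)"
  have e: "minus_one (plus_part n \<eta>) = minus_one \<eta> \<circ> ?r"
    unfolding plus_part_rnk(1)[OF assms] by (rule minus_one_perm)
  have "is_partition n (minus_one (plus_part n \<eta>))"
    using plus_part_rnk(2)[OF assms] minus_one_multi[of "plus_part n \<eta>"]
    unfolding is_partition_def by (auto simp: minus_one_def intro: diff_le_mono)
  then show ?thesis unfolding e
    by (intro plus_part_unique[OF minus_one_multi[OF assms]] permutes_inv rnk_permutes)
qed

lemma plus_part_plus_one: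
  assumes "\<kappa> \<in> multi_idx n" shows "plus_part n (plus_one \<kappa>) = plus_one (plus_part n \<kappa>)"
proof -
  let ?r = "inv (rnk n \<kappa>)"
  have p: "?r permutes {..<n}" by (intro permutes_inv rnk_permutes)
  have e: "plus_one (plus_part n \<kappa>) = plus_one \<kappa> \<circ> ?r"
    unfolding plus_part_rnk(1)[OF assms] by (rule plus_one_perm[OF p])
  have "is_partition n (plus_one (plus_part n \<kappa>))"
    using plus_part_rnk(2)[OF assms] plus_one_multi[of "plus_part n \<kappa>"]
    unfolding is_partition_def by (auto simp: plus_one_def)
  then show ?thesis unfolding e by (intro plus_part_unique[OF plus_one_multi p])
qed

definition orbit :: "(nat \<Rightarrow> nat) \<Rightarrow> (nat \<Rightarrow> nat) set" where
  "orbit lam = {\<eta> \<in> multi_idx n. plus_part n \<eta> = lam}"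

lemma orbit_subset: "orbit lam \<subseteq> deg_idx n (absv n lam)"
  using absv_plus_part[of _ n] by (auto simp: orbit_def deg_idx_def)

lemma finite_orbit: "finite (orbit lam)"
  using finite_subset[OF orbit_subset finite_deg_idx] .

lemma jackC_eq: "jackC n k lam = (\<lambda>z. \<Sum>\<eta>\<in>orbit lam. L \<eta> z)"
  by (rule ext) (simp add: jackC_def orbit_def)

lemma d_coef_perm:
  assumes "\<sigma> permutes {..<n}" shows "d_coef n (\<eta> \<circ> \<sigma>) = d_coef n \<eta>"
proof -
  have "(\<forall>i<n. (\<eta> \<circ> \<sigma>) i \<noteq> 0) \<longleftrightarrow> (\<forall>i<n. \<eta> i \<noteq> 0)"
    using permutes_in_image[OF assms] permutes_in_image[OF permutes_inv[OF assms]]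
    by (metis comp_apply lessThan_iff permutes_inverses(1)[OF assms])
  then show ?thesis unfolding d_coef_def minus_one_perm absv_perm[OF assms] by simp
qed

lemma orbit_perm:
  assumes "is_partition n lam" "\<eta> \<in> orbit lam"
  obtains \<sigma> where "\<sigma> permutes {..<n}" "\<eta> = lam \<circ> \<sigma>"
proof -
  have "\<eta> \<in> multi_idx n" "lam \<in> multi_idx n" "plus_part n \<eta> = plus_part n lam"
    using assms plus_part_partition[OF assms(1)] by (auto simp: orbit_def is_partition_def)
  then show ?thesis using plus_part_eqD that by blast
qed

lemma sum_orbit_minus_one:
  assumes lam: "is_partition n lam" and pos: "\<forall>i<n. lam i \<noteq> 0"
  shows "(\<Sum>\<eta>\<in>orbit lam. g (minus_one \<eta>)) = (\<Sum>\<kappa>\<in>orbit (minus_one lam). g \<kappa>)"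
proof (rule sum.reindex_bij_witness[where i = plus_one and j = minus_one])
  fix \<eta> assume \<eta>: "\<eta> \<in> orbit lam"
  then have m: "\<eta> \<in> multi_idx n" "plus_part n \<eta> = lam" by (auto simp: orbit_def)
  obtain \<sigma> where s: "\<sigma> permutes {..<n}" "\<eta> = lam \<circ> \<sigma>" using orbit_perm[OF lam \<eta>] .
  have "\<forall>i<n. \<eta> i \<noteq> 0" using s pos permutes_in_image[OF s(1)] by simp
  then show "plus_one (minus_one \<eta>) = \<eta>" by (rule plus_minus_one[OF m(1)])
  show "minus_one \<eta> \<in> orbit (minus_one lam)"
    using m plus_part_minus_one[OF m(1)] minus_one_multi[OF m(1)] by (simp add: orbit_def)
next
  have lm: "lam \<in> multi_idx n" using lam by (simp add: is_partition_def)
  fix \<kappa> assume \<kappa>: "\<kappa> \<in> orbit (minus_one lam)"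
  then have m: "\<kappa> \<in> multi_idx n" "plus_part n \<kappa> = minus_one lam" by (auto simp: orbit_def)
  show "minus_one (plus_one \<kappa>) = \<kappa>" by (rule minus_plus_one[OF m(1)])
  show "plus_one \<kappa> \<in> orbit lam"
    using m plus_part_plus_one[OF m(1)] plus_one_multi plus_minus_one[OF lm pos] by (simp add: orbit_def)
qed simp

lemma dunkl_Delta_jackC:
  assumes lam: "is_partition n lam"
  shows "dunkl_Delta n k (jackC n k lam) = (\<lambda>x. d_coef n lam * jackC n k (minus_one lam) x)"
proof -
  have sub: "orbit lam \<subseteq> multi_idx n" by (auto simp: orbit_def)
  have d: "d_coef n \<eta> = d_coef n lam" if "\<eta> \<in> orbit lam" for \<eta>
    using orbit_perm[OF lam that] d_coef_perm by metis
  have "dunkl_Delta n k (jackC n k lam) = (\<lambda>x. \<Sum>\<eta>\<in>orbit lam. d_coef n \<eta> * L (minus_one \<eta>) x)"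
    unfolding jackC_eq by (rule dunkl_Delta_sum_jackL[OF sub])
  also have "\<dots> = (\<lambda>x. d_coef n lam * (\<Sum>\<eta>\<in>orbit lam. L (minus_one \<eta>) x))"
    unfolding sum_distrib_left using d by (intro ext sum.cong) auto
  also have "\<dots> = (\<lambda>x. d_coef n lam * jackC n k (minus_one lam) x)"
  proof (cases "\<forall>i<n. lam i \<noteq> 0")
    case True
    then show ?thesis unfolding jackC_eq using sum_orbit_minus_one[OF lam True, of "\<lambda>\<eta>. L \<eta> x" for x] by simp
  next
    case False
    then have "d_coef n lam = 0" unfolding d_coef_def by (rule if_not_P)
    then show ?thesis by simp
  qed
  finally show ?thesis .
qed

subsection \<open>Growth of the values at the all-one vector\<close>

definition jackL_at_one :: "(nat \<Rightarrow> nat) \<Rightarrow> real" where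
  "jackL_at_one \<eta> = coefR \<eta> * Re (E \<eta> one_vec)"

lemma jackE_one: "\<eta> \<in> multi_idx n \<Longrightarrow> E \<eta> one_vec = of_real (Re (E \<eta> one_vec)) \<and> 1 \<le> Re (E \<eta> one_vec)"
  using is_jack_bound[OF jackE_is_jack] by fastforce

lemma jackL_one: "\<eta> \<in> multi_idx n \<Longrightarrow> L \<eta> one_vec = of_real (jackL_at_one \<eta>)"
  using jackE_one[of \<eta>] coefs_pos[of \<eta>] by (simp add: jackL_def jackL_at_one_def)

lemma jackL_at_one_pos: "\<eta> \<in> multi_idx n \<Longrightarrow> 0 < jackL_at_one \<eta>"
  using jackE_one[of \<eta>] coefs_pos[of \<eta>] by (simp add: jackL_at_one_def)

lemma jackL_bound:
  assumes "\<eta> \<in> multi_idx n" "\<And>i. i < n \<Longrightarrow> cmod (x i) \<le> R"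
  shows "cmod (L \<eta> x) \<le> jackL_at_one \<eta> * R ^ absv n \<eta>"
proof -
  obtain r where r: "E \<eta> one_vec = complex_of_real r" "cmod (E \<eta> x) \<le> r * R ^ absv n \<eta>"
    using is_jack_bound[OF jackE_is_jack[OF assms(1)] assms(1)] assms(2) by blast
  have "cmod (L \<eta> x) = coefR \<eta> * cmod (E \<eta> x)"
    using coefs_pos[OF assms(1)] by (simp add: jackL_def norm_mult)
  also have "\<dots> \<le> coefR \<eta> * (r * R ^ absv n \<eta>)"
    using r coefs_pos[OF assms(1)] by (intro mult_left_mono) auto
  finally show ?thesis using r by (simp add: jackL_at_one_def mult.assoc)
qed

lemma jackL_at_one_phi:
  assumes "\<eta> \<in> multi_idx n"
  shows "jackL_at_one (phi_idx n \<eta>) * phi_fac \<eta> = real (Suc (absv n \<eta>)) * jackL_at_one \<eta>"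
proof -
  have "complex_of_real (coefR (phi_idx n \<eta>) * phi_fac \<eta>) = of_real (real (Suc (absv n \<eta>)) * coefR \<eta>)"
    using coefs_phi[OF assms] coefs_pos[OF assms] coefs_pos[OF phi_idx_multi, of \<eta>]
    unfolding absv_phi_idx[OF n] by simp
  then have "coefR (phi_idx n \<eta>) * phi_fac \<eta> = real (Suc (absv n \<eta>)) * coefR \<eta>" using of_real_eq_iff by blast
  moreover have "E (phi_idx n \<eta>) one_vec = E \<eta> one_vec"
    unfolding jackE_phi[OF assms] by (simp add: Phi_op_def one_vec_def comp_def)
  moreover have "jackL_at_one (phi_idx n \<eta>) * phi_fac \<eta> = (coefR (phi_idx n \<eta>) * phi_fac \<eta>) * Re (E (phi_idx n \<eta>) one_vec)"
    by (simp add: jackL_at_one_def)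
  ultimately show ?thesis by (simp only: jackL_at_one_def mult.assoc)
qed

text \<open>The point \<open>one_vec\<close> is fixed by the transposition, so
  \<open>jackE_swap\<close> contributes 1 + c, while \<open>coefs_swap\<close> contributes the
  divisor 1 - c.\<close>

lemma jackL_at_one_swap:
  assumes \<kappa>: "\<kappa> \<in> multi_idx n" and j: "Suc j < n" "\<kappa> j < \<kappa> (Suc j)"
  shows "jackL_at_one (\<kappa> \<circ> swp j (Suc j)) * (1 - swap_coef n k \<kappa> j) = (1 + swap_coef n k \<kappa> j) * jackL_at_one \<kappa>"
proof -
  let ?\<eta> = "\<kappa> \<circ> swp j (Suc j)" and ?c = "swap_coef n k \<kappa> j"
  have jn: "j < n" using j by simp
  have \<eta>: "?\<eta> \<in> multi_idx n" by (rule multi_idx_perm[OF \<kappa> swp_permutes[OF jn j(1)]])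
  have "complex_of_real (coefR ?\<eta> * (1 - ?c)) = of_real (coefR \<kappa>)"
    using coefs_swap[OF \<kappa> j] coefs_pos[OF \<kappa>] coefs_pos[OF \<eta>] unfolding absv_perm[OF swp_permutes[OF jn j(1)]] by simp
  then have 1: "coefR ?\<eta> * (1 - ?c) = coefR \<kappa>" using of_real_eq_iff by blast
  have "sw_pt j (Suc j) one_vec = one_vec" by (simp add: sw_pt_def one_vec_def comp_def)
  then have "E ?\<eta> one_vec = (1 + of_real ?c) * E \<kappa> one_vec"
    using jackE_swap[OF \<kappa> j, of one_vec] by (simp add: algebra_simps)
  then have 2: "Re (E ?\<eta> one_vec) = (1 + ?c) * Re (E \<kappa> one_vec)" by simp
  have "jackL_at_one ?\<eta> * (1 - ?c) = (coefR ?\<eta> * (1 - ?c)) * Re (E ?\<eta> one_vec)" by (simp add: jackL_at_one_def)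
  also have "\<dots> = (1 + ?c) * jackL_at_one \<kappa>" unfolding 1 2 by (simp add: jackL_at_one_def)
  finally show ?thesis .
qed

text \<open>The generalized Pochhammer symbol at 1 + k(n - 1): this parameter makes the normalized value
  scaled_at_one invariant under phi_idx.\<close>

definition poch_prod :: "(nat \<Rightarrow> nat) \<Rightarrow> real" where
  "poch_prod \<eta> = (\<Prod>j<n. pochhammer (1 + k * (real n - 1) - k * real (rnk n \<eta> j)) (\<eta> j))"

definition scaled_at_one :: "(nat \<Rightarrow> nat) \<Rightarrow> real" where
  "scaled_at_one \<eta> = jackL_at_one \<eta> / fact (absv n \<eta>) * poch_prod \<eta>"

lemma poch_base_ge: "j < n \<Longrightarrow> 1 \<le> 1 + k * (real n - 1) - k * real (rnk n \<eta> j)"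
proof -
  assume "j < n"
  then have "k * real (rnk n \<eta> j) \<le> k * (real n - 1)"
    using rnk_le[of j \<eta>] n k by (intro mult_left_mono) (auto simp: of_nat_diff)
  then show ?thesis by simp
qed

lemma poch_prod_pos: "0 < poch_prod \<eta>"
  unfolding poch_prod_def
proof (intro prod_pos pochhammer_pos)
  fix j assume "j \<in> {..<n}"
  then show "0 < 1 + k * (real n - 1) - k * real (rnk n \<eta> j)" using poch_base_ge[of j \<eta>] by simp
qed

lemma scaled_at_one_pos: "\<eta> \<in> multi_idx n \<Longrightarrow> 0 < scaled_at_one \<eta>"
  unfolding scaled_at_one_def using jackL_at_one_pos poch_prod_pos by simp

text \<open>The Pochhammer factor of the entry passing the end gains \<open>phi_fac\<close>, at an
  unchanged rank, and the factorial gains the new degree; \<open>jackL_at_one_phi\<close> cancels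
  both.\<close>

lemma scaled_at_one_phi:
  assumes "\<eta> \<in> multi_idx n" shows "scaled_at_one (phi_idx n \<eta>) = scaled_at_one \<eta>"
proof -
  obtain p where p: "n = Suc p" using n by (cases n) auto
  define g where "g \<kappa> j = pochhammer (1 + k * (real n - 1) - k * real (rnk n \<kappa> j)) (\<kappa> j)" for \<kappa> j
  have pn: "Suc p = n" using p by simp
  have sn: "Suc j < n" if "j < p" for j using that p by simp
  have r: "rnk n (phi_idx n \<eta>) j = rnk n \<eta> (cyc n j)" for j by (simp add: rnk_phi_idx[OF n])
  have "(\<Prod>j<p. g (phi_idx n \<eta>) j) = (\<Prod>j<p. g \<eta> (Suc j))"
    by (intro prod.cong refl) (auto simp: g_def r phi_idx_def cyc_def sn)
  moreover have "g (phi_idx n \<eta>) p = g \<eta> 0 * phi_fac \<eta>"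
    using n by (simp add: g_def r phi_idx_def cyc_def pn pochhammer_Suc phi_fac_def eigval_rnk algebra_simps)
  moreover have "(\<Prod>j<n. g (phi_idx n \<eta>) j) = (\<Prod>j<p. g (phi_idx n \<eta>) j) * g (phi_idx n \<eta>) p"
    unfolding pn[symmetric] by (rule prod.lessThan_Suc)
  moreover have "(\<Prod>j<n. g \<eta> j) = g \<eta> 0 * (\<Prod>j<p. g \<eta> (Suc j))"
    unfolding pn[symmetric] by (rule prod.lessThan_Suc_shift)
  ultimately have "(\<Prod>j<n. g (phi_idx n \<eta>) j) = (\<Prod>j<n. g \<eta> j) * phi_fac \<eta>" by simp
  then have "poch_prod (phi_idx n \<eta>) = poch_prod \<eta> * phi_fac \<eta>" by (simp add: poch_prod_def g_def)
  then show ?thesis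
    using jackL_at_one_phi[OF assms] by (simp add: scaled_at_one_def absv_phi_idx[OF n] divide_simps algebra_simps del: of_nat_Suc)
qed

text \<open>\<open>poch_prod\<close> is unchanged because ranks travel with entries, which leaves
  the ratio (1 + c)/(1 - c) = 1 + 2k/(d - k) for the spectral gap d. As the entry exchanged is 0, d
  is at least \<open>\<kappa> (Suc j)\<close> + k.\<close>

lemma scaled_at_one_swap_le:
  assumes \<kappa>: "\<kappa> \<in> multi_idx n" and j: "Suc j < n" "\<kappa> j = 0" "0 < \<kappa> (Suc j)"
  shows "scaled_at_one (\<kappa> \<circ> swp j (Suc j)) \<le> (1 + 2 * k / real (\<kappa> (Suc j))) * scaled_at_one \<kappa>"
proof -
  let ?\<eta> = "\<kappa> \<circ> swp j (Suc j)" and ?c = "swap_coef n k \<kappa> j" and ?a = "real (\<kappa> (Suc j))"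
  have jn: "j < n" using j by simp
  note sp = swp_permutes[OF jn j(1)]
  have lt: "\<kappa> j < \<kappa> (Suc j)" using j by simp
  note b = swap_coef_bounds[OF k j(1) lt]
  define d where "d = eigval n k \<kappa> (Suc j) - eigval n k \<kappa> j"
  have "rnk n \<kappa> (Suc j) < rnk n \<kappa> j" using j by (simp add: rnk_less_iff before_def)
  then have "k * real (rnk n \<kappa> (Suc j) + 1) \<le> k * real (rnk n \<kappa> j)" using k by (intro mult_left_mono) auto
  then have d: "?a + k \<le> d" unfolding d_def using j by (simp add: eigval_rnk algebra_simps)
  have dk: "0 < d - k" "?a \<le> d - k" "0 < d" using d j k by auto
  have c: "?c = k / d" by (simp add: swap_coef_def d_def)
  have "(1 + ?c) / (1 - ?c) = 1 + 2 * k / (d - k)"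
    unfolding c using dk by (simp add: field_simps)
  also have "\<dots> \<le> 1 + 2 * k / ?a" using dk j k by (intro add_left_mono divide_left_mono) auto
  finally have cb: "(1 + ?c) / (1 - ?c) \<le> 1 + 2 * k / ?a" .
  have "poch_prod ?\<eta> = poch_prod \<kappa>"
  proof -
    have "rnk n ?\<eta> = rnk n \<kappa> \<circ> swp j (Suc j)" using lt j by (intro rnk_swap) auto
    then show ?thesis unfolding poch_prod_def
      using prod.permute[OF sp, of "\<lambda>j. pochhammer (1 + k * (real n - 1) - k * real (rnk n \<kappa> j)) (\<kappa> j)"] by simp
  qed
  moreover have "jackL_at_one ?\<eta> = (1 + ?c) / (1 - ?c) * jackL_at_one \<kappa>"
    using jackL_at_one_swap[OF \<kappa> j(1) lt] b by (simp add: field_simps)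
  ultimately have "scaled_at_one ?\<eta> = (1 + ?c) / (1 - ?c) * scaled_at_one \<kappa>" unfolding scaled_at_one_def absv_perm[OF sp] by simp
  then show ?thesis using mult_right_mono[OF cb, of "scaled_at_one \<kappa>"] scaled_at_one_pos[OF \<kappa>] by simp
qed

text \<open>A budget of n - 1 leftward moves for each value that an entry takes on its way up to a.
  Consecutive values have ratio tending to 1, so the growth is polynomial and harmless in a ratio
  test.\<close>

definition growth :: "nat \<Rightarrow> real" where
  "growth a = (\<Prod>b<a. (1 + 2 * k / real (Suc b)) ^ (n - 1))"

lemma growth_pos: "0 < growth a"
  unfolding growth_def using k by (intro prod_pos zero_less_power) (auto intro: add_pos_nonneg)

definition growth_prod :: "(nat \<Rightarrow> nat) \<Rightarrow> real" where
  "growth_prod \<eta> = (\<Prod>i<n. growth (\<eta> i))"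

lemma growth_prod_perm: "\<sigma> permutes {..<n} \<Longrightarrow> growth_prod (\<eta> \<circ> \<sigma>) = growth_prod \<eta>"
  unfolding growth_prod_def using prod.permute[of \<sigma> "{..<n}" "\<lambda>i. growth (\<eta> i)"] by (simp add: comp_def)

lemma growth_prod_phi: "growth_prod (phi_idx n \<eta>) = growth_prod \<eta> * (1 + 2 * k / real (Suc (\<eta> 0))) ^ (n - 1)"
proof -
  obtain p where p: "n = Suc p" using n by (cases n) auto
  have pn: "Suc p = n" using p by simp
  have "(\<Prod>i<p. growth (phi_idx n \<eta> i)) = (\<Prod>i<p. growth (\<eta> (Suc i)))"
    using p by (intro prod.cong refl) (auto simp: phi_idx_def)
  moreover have "growth (phi_idx n \<eta> p) = growth (\<eta> 0) * (1 + 2 * k / real (Suc (\<eta> 0))) ^ (n - 1)"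
    by (simp add: phi_idx_def pn growth_def)
  moreover have "growth_prod (phi_idx n \<eta>) = (\<Prod>i<p. growth (phi_idx n \<eta> i)) * growth (phi_idx n \<eta> p)"
    unfolding growth_prod_def using prod.lessThan_Suc[of "\<lambda>i. growth (phi_idx n \<eta> i)" p] by (simp only: pn)
  moreover have "growth_prod \<eta> = growth (\<eta> 0) * (\<Prod>i<p. growth (\<eta> (Suc i)))"
    unfolding growth_prod_def using prod.lessThan_Suc_shift[of "\<lambda>i. growth (\<eta> i)" p] by (simp only: pn)
  ultimately show ?thesis by simp
qed

lemma one_le_frac: "1 \<le> 1 + 2 * k / real a"
  using k by simp

text \<open>An entry a is moved left at most n - 1 times between two applications of phi_idx, each time at
  the cost of a factor 1 + 2k/a.\<close>

lemma scaled_at_one_bound: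
  assumes "\<eta> \<in> multi_idx n" shows "scaled_at_one \<eta> \<le> scaled_at_one (\<lambda>_. 0) * growth_prod \<eta>"
proof -
  let ?K = "scaled_at_one (\<lambda>_. 0)"
  have K: "0 < ?K" by (rule scaled_at_one_pos) (simp add: multi_idx_def)
  \<comment> \<open>The claim is strengthened by a reserve: the last nonzero entry, at position j,
    still holds j factors for the moves it can make.\<close>
  have "scaled_at_one \<eta> \<le> ?K * growth_prod \<eta> \<and>
    (\<forall>j. 0 < \<eta> j \<and> (\<forall>i>j. \<eta> i = 0) \<longrightarrow> scaled_at_one \<eta> * (1 + 2 * k / real (\<eta> j)) ^ j \<le> ?K * growth_prod \<eta>)"
    using n assms
  proof (induction rule: multi_idx_induct)
    case zero
    show ?case by (simp add: growth_prod_def growth_def)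
  next
    case (phi \<eta>)
    \<comment> \<open>\<open>growth_prod_phi\<close> adds a fresh reserve of n - 1 factors for the
      entry that has just reached the end.\<close>
    let ?q = "(1 + 2 * k / real (Suc (\<eta> 0))) ^ (n - 1)"
    have le: "scaled_at_one (phi_idx n \<eta>) * ?q \<le> ?K * growth_prod (phi_idx n \<eta>)"
      unfolding scaled_at_one_phi[OF phi(1)] growth_prod_phi mult.assoc[symmetric] using phi k by (intro mult_right_mono) auto
    have "1 \<le> ?q" by (intro one_le_power one_le_frac)
    then have "scaled_at_one (phi_idx n \<eta>) \<le> scaled_at_one (phi_idx n \<eta>) * ?q"
      using scaled_at_one_pos[OF phi_idx_multi, of \<eta>] by simp
    then have 1: "scaled_at_one (phi_idx n \<eta>) \<le> ?K * growth_prod (phi_idx n \<eta>)" using le by linarith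
    have "scaled_at_one (phi_idx n \<eta>) * (1 + 2 * k / real (phi_idx n \<eta> j)) ^ j \<le> ?K * growth_prod (phi_idx n \<eta>)"
      if j: "0 < phi_idx n \<eta> j" "\<forall>i>j. phi_idx n \<eta> i = 0" for j
    proof -
      have pos: "phi_idx n \<eta> (n - 1) = Suc (\<eta> 0)" using n by (simp add: phi_idx_def)
      have "j < n" using j(1) by (auto simp: phi_idx_def split: if_splits)
      moreover have "\<not> j < n - 1" using j(2) pos by fastforce
      ultimately have "j = n - 1" by simp
      then show ?thesis using le pos by simp
    qed
    then show ?case using 1 by blast
  next
    case (swap \<kappa> j)
    let ?\<eta> = "\<kappa> \<circ> swp j (Suc j)" and ?a = "\<kappa> (Suc j)"
    let ?q = "1 + 2 * k / real ?a"
    have jn: "j < n" using swap by simp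
    note sp = swp_permutes[OF jn swap(2)]
    have tp: "0 < scaled_at_one ?\<eta>" by (rule scaled_at_one_pos[OF multi_idx_perm[OF swap(1) sp]])
    have q: "1 \<le> ?q" by (rule one_le_frac)
    have "scaled_at_one ?\<eta> * ?q ^ j \<le> (?q * scaled_at_one \<kappa>) * ?q ^ j"
      using scaled_at_one_swap_le[OF swap(1-4)] q by (intro mult_right_mono) auto
    also have "\<dots> = scaled_at_one \<kappa> * ?q ^ Suc j" by simp
    also have "\<dots> \<le> ?K * growth_prod \<kappa>" using swap by blast
    finally have le: "scaled_at_one ?\<eta> * ?q ^ j \<le> ?K * growth_prod ?\<eta>" unfolding growth_prod_perm[OF sp] .
    have "1 \<le> ?q ^ j" by (intro one_le_power q)
    then have "scaled_at_one ?\<eta> \<le> scaled_at_one ?\<eta> * ?q ^ j" using tp by simp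
    then have 1: "scaled_at_one ?\<eta> \<le> ?K * growth_prod ?\<eta>" using le by linarith
    have "scaled_at_one ?\<eta> * (1 + 2 * k / real (?\<eta> i)) ^ i \<le> ?K * growth_prod ?\<eta>" if i: "0 < ?\<eta> i" "\<forall>l>i. ?\<eta> l = 0" for i
    proof -
      have "i = j"
      proof (rule ccontr)
        assume "i \<noteq> j"
        then consider "i < j" | "i = Suc j" | "Suc j < i" by linarith
        then show False
        proof cases
          case 1
          then have "?\<eta> j = 0" using i by blast
          then show False using swap(4) by simp
        next
          case 2 then show False using i(1) swap(3) by simp
        next
          case 3 then show False using i(1) swap(5) by simp
        qed
      qed
      then show ?thesis using le by simp
    qed
    then show ?case using 1 by blast
  qed
  then show ?thesis by blast
qed

lemma jackL_at_one_bound: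
  assumes "\<eta> \<in> multi_idx n"
  shows "jackL_at_one \<eta> / fact (absv n \<eta>) \<le> scaled_at_one (\<lambda>_. 0) * (growth_prod \<eta> / poch_prod \<eta>)"
  using scaled_at_one_bound[OF assms] poch_prod_pos[of \<eta>] by (simp add: scaled_at_one_def field_simps)

end

subsection \<open>Absolute convergence\<close>

text \<open>A finite set of indices lies in a box, and over a box the sum of products is a product
  of partial sums, each bounded by \<open>suminf h\<close>.\<close>

lemma summable_on_prod_multi_idx:
  fixes h :: "nat \<Rightarrow> real"
  assumes nonneg: "\<And>a. 0 \<le> h a" and sum: "summable h"
  shows "(\<lambda>\<eta>. \<Prod>i<n. h (\<eta> i)) summable_on multi_idx n"
proof (rule nonneg_bdd_above_summable_on)
  show "0 \<le> (\<Prod>i<n. h (\<eta> i))" for \<eta> by (intro prod_nonneg) (auto simp: nonneg)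
  show "bdd_above (sum (\<lambda>\<eta>. \<Prod>i<n. h (\<eta> i)) ` {F. F \<subseteq> multi_idx n \<and> finite F})"
  proof (rule bdd_aboveI2)
    fix F assume "F \<in> {F. F \<subseteq> multi_idx n \<and> finite F}"
    then have F: "F \<subseteq> multi_idx n" "finite F" by auto
    define N where "N = Suc (\<Sum>\<eta>\<in>F. \<Sum>i<n. \<eta> i)"
    have N: "\<eta> i < N" if "\<eta> \<in> F" "i < n" for \<eta> i
    proof -
      have "\<eta> i \<le> (\<Sum>i<n. \<eta> i)" using that by (intro member_le_sum) auto
      also have "\<dots> \<le> (\<Sum>\<eta>\<in>F. \<Sum>i<n. \<eta> i)" using that F by (intro member_le_sum[of _ _ "\<lambda>\<eta>. \<Sum>i<n. \<eta> i"]) auto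
      finally show ?thesis by (simp add: N_def)
    qed
    let ?\<rho> = "\<lambda>\<eta>. restrict \<eta> {..<n}"
    have inj: "inj_on ?\<rho> F"
    proof (rule inj_onI)
      fix \<eta> \<kappa> assume "\<eta> \<in> F" "\<kappa> \<in> F" "?\<rho> \<eta> = ?\<rho> \<kappa>"
      moreover from this have "\<eta> i = \<kappa> i" if "i < n" for i using that by (metis lessThan_iff restrict_apply')
      ultimately show "\<eta> = \<kappa>" using F by (intro multi_idx_eqI) auto
    qed
    have sub: "?\<rho> ` F \<subseteq> PiE {..<n} (\<lambda>_. {..<N})" using N by (auto split: if_splits)
    have "(\<Sum>\<eta>\<in>F. \<Prod>i<n. h (\<eta> i)) = (\<Sum>g\<in>?\<rho> ` F. \<Prod>i<n. h (g i))"
      by (simp add: sum.reindex[OF inj])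
    also have "\<dots> \<le> (\<Sum>g\<in>PiE {..<n} (\<lambda>_. {..<N}). \<Prod>i<n. h (g i))"
      by (intro sum_mono2 finite_PiE sub prod_nonneg) (auto simp: nonneg)
    also have "\<dots> = (\<Prod>i<n. \<Sum>a<N. h a)" by (rule prod_sum_PiE[symmetric]) auto
    also have "\<dots> \<le> (\<Prod>i<n. suminf h)"
      by (intro prod_mono) (auto simp: nonneg sum_nonneg intro!: sum_le_suminf sum)
    finally show "(\<Sum>\<eta>\<in>F. \<Prod>i<n. h (\<eta> i)) \<le> (\<Prod>i<n. suminf h)" .
  qed
qed

lemma cmod_shift_ratio_tendsto: "(\<lambda>a. cmod (z + of_nat a) / real (Suc a)) \<longlonglongrightarrow> 1"
proof -
  have "(\<lambda>a. (z - 1) / of_nat (Suc a)) \<longlonglongrightarrow> 0"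
    using LIMSEQ_Suc[OF lim_const_over_n[of "z - 1"]] by simp
  then have "(\<lambda>a. cmod ((z - 1) / of_nat (Suc a) + 1)) \<longlonglongrightarrow> cmod (0 + 1)"
    by (intro tendsto_intros)
  moreover have "cmod ((z - 1) / of_nat (Suc a) + 1) = cmod (z + of_nat a) / real (Suc a)" for a
  proof -
    have "of_nat (Suc a) \<noteq> (0::complex)" by (simp only: of_nat_eq_0_iff)
    then have "(z - 1) / of_nat (Suc a) + 1 = (z + of_nat a) / of_nat (Suc a)"
      by (simp add: field_simps)
    then show ?thesis by (simp only: norm_divide norm_of_nat)
  qed
  ultimately show ?thesis by simp
qed

lemma power_ratio_tendsto:
  assumes "p \<le> Suc q"
  shows "(\<lambda>a. real (Suc a) ^ p / real (Suc a) ^ Suc q) \<longlonglongrightarrow> (if p \<le> q then 0 else 1)"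
proof (cases "p \<le> q")
  case False
  then have "p = Suc q" using assms by simp
  then show ?thesis by simp
next
  case True
  then obtain d where d: "Suc q = p + Suc d" using less_imp_Suc_add[of p "Suc q"] by auto
  have "(\<lambda>a. (inverse (real (Suc a))) ^ Suc d) \<longlonglongrightarrow> 0 ^ Suc d"
    by (intro tendsto_power LIMSEQ_inverse_real_of_nat)
  moreover have "real (Suc a) ^ p / real (Suc a) ^ Suc q = (inverse (real (Suc a))) ^ Suc d" for a
  proof -
    have "real (Suc a) ^ p \<noteq> 0" by simp
    then show ?thesis unfolding d power_add by (simp add: power_inverse divide_inverse)
  qed
  ultimately show ?thesis using True by simp
qed

context jack_setup
begin

text \<open>The share that an entry a of rank r has in the bound for the general term: Pochhammer
  symbols, \<open>growth\<close> and \<open>poch_prod\<close> all factor over the entries.\<close>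

definition majorant :: "nat \<Rightarrow> nat \<Rightarrow> (nat \<Rightarrow> complex) \<Rightarrow> (nat \<Rightarrow> complex) \<Rightarrow> real \<Rightarrow> nat \<Rightarrow> nat \<Rightarrow> real" where
  "majorant p q \<mu> \<nu> \<rho> r a = \<rho> ^ a * growth a * (\<Prod>i<p. cmod (pochhammer (\<mu> i - of_real k * of_nat r) a)) /
    ((\<Prod>i<q. cmod (pochhammer (\<nu> i - of_real k * of_nat r) a)) * pochhammer (1 + k * (real n - 1) - k * real r) a)"

lemma majorant_nonneg:
  assumes "r < n" "0 \<le> \<rho>" shows "0 \<le> majorant p q \<mu> \<nu> \<rho> r a"
proof -
  have "k * real r \<le> k * (real n - 1)" using assms k by (intro mult_left_mono) auto
  then have "0 < pochhammer (1 + k * (real n - 1) - k * real r) a" by (intro pochhammer_pos) simp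
  then show ?thesis unfolding majorant_def using assms growth_pos[of a]
    by (intro divide_nonneg_nonneg mult_nonneg_nonneg prod_nonneg) auto
qed

text \<open>Ratio test. Each step adds p linear factors above and q + 1 below, the extra one coming
  from \<open>poch_prod\<close>, so the ratio tends to 0 for p \<le> q and to \<rho> for p = q +
  1.\<close>

lemma majorant_summable:
  assumes r: "r < n" and pq: "p \<le> q + 1" and \<rho>: "0 \<le> \<rho>" "p \<le> q \<or> \<rho> < 1"
  shows "summable (majorant p q \<mu> \<nu> \<rho> r)"
proof -
  let ?m = "\<lambda>i. \<mu> i - of_real k * of_nat r" and ?n = "\<lambda>i. \<nu> i - of_real k * of_nat r"
  let ?c = "1 + k * (real n - 1) - k * real r"
  have "k * real r \<le> k * (real n - 1)" using r k by (intro mult_left_mono) auto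
  then have c: "1 \<le> ?c" by simp
  define R where "R a = \<rho> * (1 + 2 * k / real (Suc a)) ^ (n - 1) * (\<Prod>i<p. cmod (?m i + of_nat a)) /
    ((\<Prod>i<q. cmod (?n i + of_nat a)) * (?c + real a))" for a
  have step: "majorant p q \<mu> \<nu> \<rho> r (Suc a) = R a * majorant p q \<mu> \<nu> \<rho> r a" for a
  proof -
    have g: "growth (Suc a) = growth a * (1 + 2 * k / real (Suc a)) ^ (n - 1)" by (simp add: growth_def)
    have p: "(\<Prod>i<l. cmod (pochhammer (z i) (Suc a))) = (\<Prod>i<l. cmod (z i + of_nat a)) * (\<Prod>i<l. cmod (pochhammer (z i) a))"
      for z l by (simp add: pochhammer_Suc norm_mult prod.distrib mult.commute)
    show ?thesis unfolding majorant_def R_def p g pochhammer_Suc[of ?c] times_divide_times_eq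
      by (simp only: power_Suc ac_simps)
  qed
  have lim: "R \<longlonglongrightarrow> \<rho> * (if p \<le> q then 0 else 1)"
  proof -
    let ?s = "\<lambda>a. real (Suc a)"
    \<comment> \<open>The ratio R with every linear factor divided by \<open>Suc a\<close>, so that
      each quotient tends to 1 and the surplus powers are collected at the end.\<close>
    define R' where "R' a = \<rho> * (1 + 2 * k / ?s a) ^ (n - 1) * (\<Prod>i<p. cmod (?m i + of_nat a) / ?s a) /
      ((\<Prod>i<q. cmod (?n i + of_nat a) / ?s a) * (cmod (of_real ?c + of_nat a) / ?s a)) * (?s a ^ p / ?s a ^ Suc q)" for a
    have "(\<lambda>a. 2 * k / ?s a) \<longlonglongrightarrow> 0"
      using LIMSEQ_Suc[OF lim_const_over_n[of "2 * k"]] by simp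
    then have l1: "(\<lambda>a. \<rho> * (1 + 2 * k / ?s a) ^ (n - 1)) \<longlonglongrightarrow> \<rho> * (1 + 0) ^ (n - 1)" by (intro tendsto_intros)
    have "R' \<longlonglongrightarrow> \<rho> * (1 + 0) ^ (n - 1) * (\<Prod>i<p. 1) / ((\<Prod>i<q. 1) * 1) * (if p \<le> q then 0 else 1)"
      unfolding R'_def[abs_def] using pq
      by (intro tendsto_mult tendsto_divide tendsto_prod l1 cmod_shift_ratio_tendsto power_ratio_tendsto) auto
    moreover have "R' = R"
    proof
      fix a
      let ?S = "?s a"
      have S: "?S \<noteq> 0" by simp
      have cc: "cmod (of_real ?c + of_nat a) = ?c + real a"
      proof -
        have "of_real ?c + of_nat a = complex_of_real (?c + real a)" by simp
        then have "cmod (of_real ?c + of_nat a) = \<bar>?c + real a\<bar>" by (simp only: norm_of_real)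
        then show ?thesis using c by simp
      qed
      have pr: "(\<Prod>i<l. f i / ?S) = (\<Prod>i<l. f i) / ?S ^ l" for f :: "nat \<Rightarrow> real" and l
        by (simp only: prod_dividef prod_constant card_lessThan)
      define X Y Z where "X = \<rho> * (1 + 2 * k / ?S) ^ (n - 1)" and "Y = (\<Prod>i<p. cmod (?m i + of_nat a))"
        and "Z = (\<Prod>i<q. cmod (?n i + of_nat a))"
      have "R' a = X * (Y / ?S ^ p) / (Z / ?S ^ q * ((?c + real a) / ?S)) * (?S ^ p / ?S ^ Suc q)"
        unfolding R'_def cc pr X_def Y_def Z_def ..
      also have "\<dots> = X * Y / (Z * (?c + real a))" using S by (simp add: divide_simps del: of_nat_Suc)
      finally show "R' a = R a" unfolding R_def X_def Y_def Z_def .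
    qed
    ultimately show ?thesis by simp
  qed
  define l where "l = \<rho> * (if p \<le> q then 0 else (1::real))"
  have l: "l < 1" using \<rho> by (auto simp: l_def)
  have Rn: "0 \<le> R a" for a unfolding R_def using \<rho> k c
    by (intro divide_nonneg_nonneg mult_nonneg_nonneg prod_nonneg zero_le_power) auto
  have "eventually (\<lambda>a. R a < (l + 1) / 2) sequentially"
    using lim l unfolding l_def[symmetric] by (intro order_tendstoD(2)[of R l]) auto
  then obtain N where N: "\<And>a. N \<le> a \<Longrightarrow> R a < (l + 1) / 2" by (auto simp: eventually_sequentially)
  show ?thesis
  proof (rule summable_ratio_test[of "(l + 1) / 2" N])
    show "(l + 1) / 2 < 1" using l by simp
    fix a assume "N \<le> a"
    then show "norm (majorant p q \<mu> \<nu> \<rho> r (Suc a)) \<le> (l + 1) / 2 * norm (majorant p q \<mu> \<nu> \<rho> r a)"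
      unfolding step norm_mult using N[of a] Rn[of a] by (intro mult_right_mono) auto
  qed
qed

lemma gpoch_plus_part:
  assumes "\<eta> \<in> multi_idx n"
  shows "gpoch n k p \<mu> (plus_part n \<eta>) = (\<Prod>j<n. \<Prod>i<p. pochhammer (\<mu> i - of_real k * of_nat (rnk n \<eta> j)) (\<eta> j))"
proof -
  have "(\<Prod>j<n. pochhammer (\<mu> i - of_real k * of_nat j) (plus_part n \<eta> j))
    = (\<Prod>j<n. pochhammer (\<mu> i - of_real k * of_nat (rnk n \<eta> j)) (\<eta> j))" for i
    using prod.permute[OF rnk_permutes[of n \<eta>], of "\<lambda>j. pochhammer (\<mu> i - of_real k * of_nat j) (plus_part n \<eta> j)"]
    by (simp add: plus_part_o_rnk[OF assms])
  then show ?thesis unfolding gpoch_def by (simp only: prod.swap[of _ "{..<n}"])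
qed

lemma hyp_coef_summable:
  assumes pq: "p \<le> q + 1" and \<rho>: "0 \<le> \<rho>" "p \<le> q \<or> \<rho> < 1"
  shows "(\<lambda>\<eta>. cmod (gpoch n k p \<mu> (plus_part n \<eta>) / gpoch n k q \<nu> (plus_part n \<eta>)) *
    (jackL_at_one \<eta> / fact (absv n \<eta>)) * \<rho> ^ absv n \<eta>) summable_on multi_idx n"
proof (rule summable_on_comparison_test)
  \<comment> \<open>The rank of an entry depends on the whole index. Summing over all ranks removes
    this dependence and leaves a product of functions of single entries.\<close>
  define H where "H a = (\<Sum>r<n. majorant p q \<mu> \<nu> \<rho> r a)" for a
  have H0: "0 \<le> H a" for a unfolding H_def using \<rho> by (intro sum_nonneg majorant_nonneg) auto
  have "summable H" unfolding H_def[abs_def] using assms by (intro summable_sum majorant_summable) auto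
  from summable_on_prod_multi_idx[OF H0 this, of n]
  show "(\<lambda>\<eta>. scaled_at_one (\<lambda>_. 0) * (\<Prod>i<n. H (\<eta> i))) summable_on multi_idx n" by (rule summable_on_cmult_right)
  fix \<eta> assume \<eta>: "\<eta> \<in> multi_idx n"
  let ?G = "cmod (gpoch n k p \<mu> (plus_part n \<eta>) / gpoch n k q \<nu> (plus_part n \<eta>))"
  let ?K = "scaled_at_one (\<lambda>_. 0)"
  have K: "0 < ?K" by (rule scaled_at_one_pos) (simp add: multi_idx_def)
  show "0 \<le> ?G * (jackL_at_one \<eta> / fact (absv n \<eta>)) * \<rho> ^ absv n \<eta>"
    using jackL_at_one_pos[OF \<eta>] \<rho> by simp
  have "?G * (jackL_at_one \<eta> / fact (absv n \<eta>)) * \<rho> ^ absv n \<eta> \<le> ?G * (?K * (growth_prod \<eta> / poch_prod \<eta>)) * \<rho> ^ absv n \<eta>"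
    using jackL_at_one_bound[OF \<eta>] \<rho> by (intro mult_right_mono mult_left_mono) auto
  also have "\<dots> = ?K * (\<Prod>j<n. majorant p q \<mu> \<nu> \<rho> (rnk n \<eta> j) (\<eta> j))"
    unfolding gpoch_plus_part[OF \<eta>] growth_prod_def poch_prod_def majorant_def absv_def power_sum norm_divide prod_norm[symmetric]
      prod_dividef prod.distrib
    by (simp add: divide_inverse ac_simps)
  also have "\<dots> \<le> ?K * (\<Prod>j<n. H (\<eta> j))"
  proof (intro mult_left_mono prod_mono conjI)
    fix j assume "j \<in> {..<n}"
    then have rj: "rnk n \<eta> j < n" using permutes_in_image[OF rnk_permutes[of n \<eta>], of j] by simp
    then show "0 \<le> majorant p q \<mu> \<nu> \<rho> (rnk n \<eta> j) (\<eta> j)" by (rule majorant_nonneg[OF _ \<rho>(1)])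
    show "majorant p q \<mu> \<nu> \<rho> (rnk n \<eta> j) (\<eta> j) \<le> H (\<eta> j)"
      unfolding H_def using rj \<rho> by (intro member_le_sum majorant_nonneg) auto
  qed (use K in simp)
  finally show "?G * (jackL_at_one \<eta> / fact (absv n \<eta>)) * \<rho> ^ absv n \<eta> \<le> ?K * (\<Prod>i<n. H (\<eta> i))" .
qed

end

subsection \<open>Series in Jack polynomials\<close>

lemma dir_diff_DERIV_at:
  assumes "dir_diff f"
  shows "((\<lambda>t. f (\<lambda>m. x m + t * unit_vec j m)) has_field_derivative
    dir_deriv (unit_vec j) f (\<lambda>m. x m + w * unit_vec j m)) (at w)"
proof -
  have "((\<lambda>t. f (\<lambda>m. (x m + w * unit_vec j m) + t * unit_vec j m)) has_field_derivative
    dir_deriv (unit_vec j) f (\<lambda>m. x m + w * unit_vec j m)) (at 0)"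
    by (rule dir_diff_DERIV[OF assms])
  then have "((\<lambda>t. f (\<lambda>m. x m + (t + w) * unit_vec j m)) has_field_derivative
    dir_deriv (unit_vec j) f (\<lambda>m. x m + w * unit_vec j m)) (at 0)"
    by (simp add: algebra_simps)
  then show ?thesis using DERIV_shift[of "\<lambda>t. f (\<lambda>m. x m + t * unit_vec j m)" _ 0 w] by simp
qed

lemma has_sum_finite_sum:
  fixes g :: "'b \<Rightarrow> 'a \<Rightarrow> 'c::topological_comm_monoid_add"
  assumes "\<And>b. b \<in> B \<Longrightarrow> (g b has_sum S b) X"
  shows "((\<lambda>\<eta>. \<Sum>b\<in>B. g b \<eta>) has_sum (\<Sum>b\<in>B. S b)) X"
  using assms by (induction B rule: infinite_finite_induct) (auto intro: has_sum_add)

text \<open>A slightly smaller radius pays for the factor, linear in the degree, that one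
  application of \<open>Psi_op\<close> brings in.\<close>

lemma linear_times_power_bounded:
  fixes r r' c :: real
  assumes "0 \<le> r" "r < r'"
  obtains K where "0 \<le> K" "\<And>m. (real m + c) * r ^ m \<le> K * r' ^ Suc m"
proof -
  define q where "q = r / r'"
  have q: "0 \<le> q" "q < 1" using assms by (auto simp: q_def)
  have "(\<lambda>m. real m * q ^ m) \<longlonglongrightarrow> 0" using q powser_times_n_limit_0[of q] by simp
  moreover have "(\<lambda>m. c * q ^ m) \<longlonglongrightarrow> c * 0" using q by (intro tendsto_intros LIMSEQ_realpow_zero) auto
  ultimately have "(\<lambda>m. real m * q ^ m + c * q ^ m) \<longlonglongrightarrow> 0 + c * 0" by (rule tendsto_add)
  then have "Bseq (\<lambda>m. real m * q ^ m + c * q ^ m)" using convergentI convergent_imp_Bseq by blast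
  then obtain K where K: "0 < K" "\<And>m. norm (real m * q ^ m + c * q ^ m) \<le> K" by (auto simp: Bseq_def)
  have "(real m + c) * r ^ m \<le> (K / r') * r' ^ Suc m" for m
  proof -
    have "(real m + c) * r ^ m = (real m * q ^ m + c * q ^ m) * r' ^ m"
      using assms by (simp add: q_def power_divide field_simps)
    also have "\<dots> \<le> K * r' ^ m" using K(2)[of m] assms by (intro mult_right_mono) auto
    finally show ?thesis using assms by simp
  qed
  then show ?thesis using K assms by (intro that[of "K / r'"]) auto
qed

context jack_setup
begin

text \<open>By \<open>term_bound\<close> this series dominates the one in \<open>Lsum\<close> on the
  closed polydisc of radius r.\<close>

definition conv_at :: "((nat \<Rightarrow> nat) \<Rightarrow> complex) \<Rightarrow> real \<Rightarrow> bool" where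
  "conv_at A r \<longleftrightarrow> (\<lambda>\<eta>. cmod (A \<eta>) * jackL_at_one \<eta> * r ^ absv n \<eta>) summable_on multi_idx n"

definition Lsum :: "((nat \<Rightarrow> nat) \<Rightarrow> complex) \<Rightarrow> (nat \<Rightarrow> complex) \<Rightarrow> complex" where
  "Lsum A x = (\<Sum>\<^sub>\<infinity>\<eta>\<in>multi_idx n. A \<eta> * L \<eta> x)"

lemma term_bound:
  assumes "\<eta> \<in> multi_idx n" "\<And>i. i < n \<Longrightarrow> cmod (x i) \<le> r"
  shows "cmod (A \<eta> * L \<eta> x) \<le> cmod (A \<eta>) * jackL_at_one \<eta> * r ^ absv n \<eta>"
  using jackL_bound[OF assms] by (simp add: norm_mult mult.assoc mult_left_mono)

lemma conv_at_has_sum: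
  assumes "conv_at A r" "\<And>i. i < n \<Longrightarrow> cmod (x i) \<le> r"
  shows "((\<lambda>\<eta>. A \<eta> * L \<eta> x) has_sum Lsum A x) (multi_idx n)"
proof -
  have "(\<lambda>\<eta>. cmod (A \<eta>) * jackL_at_one \<eta> * r ^ absv n \<eta>) summable_on multi_idx n" using assms(1) by (simp add: conv_at_def)
  then have "(\<lambda>\<eta>. norm (A \<eta> * L \<eta> x)) summable_on multi_idx n"
    by (rule summable_on_comparison_test) (use term_bound[OF _ assms(2)] in auto)
  then show ?thesis unfolding Lsum_def by (rule has_sum_infsum[OF abs_summable_summable])
qed

text \<open>On a disc in the coordinate line the M-test gives uniform convergence, and derivatives
  of uniform limits of holomorphic functions converge. Agreement of f with the series is assumed
  only on the open polydisc, which is all that is known about iterates of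
  \<open>Psi_op\<close>.\<close>

lemma has_sum_dir_deriv:
  assumes g: "conv_at A r" and f: "\<And>x. (\<And>i. i < n \<Longrightarrow> cmod (x i) < r) \<Longrightarrow> f x = Lsum A x"
    and y: "\<And>i. i < n \<Longrightarrow> cmod (y i) < r" and a: "a < n"
  shows "((\<lambda>\<eta>. A \<eta> * dir_deriv (unit_vec a) (L \<eta>) y) has_sum dir_deriv (unit_vec a) f y) (multi_idx n)"
proof -
  let ?M = "multi_idx n" and ?y = "\<lambda>t m. y m + t * unit_vec a m"
  \<comment> \<open>Half the distance to the boundary keeps the closed disc inside the
    polydisc.\<close>
  define d where "d = (r - cmod (y a)) / 2"
  have d: "0 < d" "cmod (y a) + d < r" using y[OF a] by (auto simp: d_def field_simps)
  have yt: "cmod (?y t i) < r" if "t \<in> cball 0 d" "i < n" for t i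
  proof (cases "i = a")
    case True
    have "cmod (y a + t) \<le> cmod (y a) + cmod t" by (rule norm_triangle_ineq)
    also have "\<dots> < r" using d that by (simp add: dist_norm)
    finally show ?thesis using True by (simp add: unit_vec_apply)
  qed (use y that in \<open>simp add: unit_vec_apply\<close>)
  let ?F = "finite_subsets_at_top ?M"
  have ulim: "uniform_limit (cball 0 d) (\<lambda>X t. \<Sum>\<eta>\<in>X. A \<eta> * L \<eta> (?y t)) (\<lambda>t. \<Sum>\<^sub>\<infinity>\<eta>\<in>?M. A \<eta> * L \<eta> (?y t)) ?F"
  proof (rule Weierstrass_m_test_general)
    show "(\<lambda>\<eta>. cmod (A \<eta>) * jackL_at_one \<eta> * r ^ absv n \<eta>) summable_on ?M" using g by (simp add: conv_at_def)
    show "cmod (A \<eta> * L \<eta> (?y t)) \<le> cmod (A \<eta>) * jackL_at_one \<eta> * r ^ absv n \<eta>" if "\<eta> \<in> ?M" "t \<in> cball 0 d" for \<eta> t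
      using yt[OF that(2)] by (intro term_bound[OF that(1)] less_imp_le)
  qed
  have der: "((\<lambda>t. \<Sum>\<eta>\<in>X. A \<eta> * L \<eta> (?y t)) has_field_derivative
      (\<Sum>\<eta>\<in>X. A \<eta> * dir_deriv (unit_vec a) (L \<eta>) (?y w))) (at w)" if "X \<subseteq> ?M" for X w
    using that dir_diff_jackL by (intro DERIV_sum DERIV_cmult dir_diff_DERIV_at) auto
  have cont: "eventually (\<lambda>X. continuous_on (cball 0 d) (\<lambda>t. \<Sum>\<eta>\<in>X. A \<eta> * L \<eta> (?y t)) \<and>
      (\<forall>w\<in>ball 0 d. ((\<lambda>t. \<Sum>\<eta>\<in>X. A \<eta> * L \<eta> (?y t)) has_field_derivative
        (\<Sum>\<eta>\<in>X. A \<eta> * dir_deriv (unit_vec a) (L \<eta>) (?y w))) (at w))) ?F"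
  proof (rule eventually_finite_subsets_at_top_weakI, intro conjI ballI)
    fix X assume X: "X \<subseteq> ?M"
    show "continuous_on (cball 0 d) (\<lambda>t. \<Sum>\<eta>\<in>X. A \<eta> * L \<eta> (?y t))"
      by (rule DERIV_continuous_on[OF has_field_derivative_at_within[OF der[OF X]]])
    show "((\<lambda>t. \<Sum>\<eta>\<in>X. A \<eta> * L \<eta> (?y t)) has_field_derivative
        (\<Sum>\<eta>\<in>X. A \<eta> * dir_deriv (unit_vec a) (L \<eta>) (?y w))) (at w)" for w by (rule der[OF X])
  qed
  obtain g' where "continuous_on (cball 0 d) (\<lambda>t. \<Sum>\<^sub>\<infinity>\<eta>\<in>?M. A \<eta> * L \<eta> (?y t))"
    and g': "\<And>w. w \<in> ball 0 d \<Longrightarrow> ((\<lambda>t. \<Sum>\<^sub>\<infinity>\<eta>\<in>?M. A \<eta> * L \<eta> (?y t)) has_field_derivative g' w) (at w) \<and>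
      ((\<lambda>X. \<Sum>\<eta>\<in>X. A \<eta> * dir_deriv (unit_vec a) (L \<eta>) (?y w)) \<longlongrightarrow> g' w) ?F"
  proof (rule has_complex_derivative_uniform_limit[OF cont ulim finite_subsets_at_top_neq_bot d(1)], goal_cases)
    case (1 g')
    show ?case by (rule 1(1)[OF 1(2,3)])
  qed
  have b0: "(0::complex) \<in> ball 0 d" using d by simp
  have "((\<lambda>t. f (?y t)) has_field_derivative g' 0) (at 0)"
  proof (rule has_field_derivative_transform_within_open)
    show "((\<lambda>t. \<Sum>\<^sub>\<infinity>\<eta>\<in>?M. A \<eta> * L \<eta> (?y t)) has_field_derivative g' 0) (at 0)" using g'[OF b0] by blast
    show "open (ball (0::complex) d)" "0 \<in> ball (0::complex) d" using b0 by auto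
    fix t :: complex assume "t \<in> ball 0 d"
    then have "t \<in> cball 0 d" by simp
    from f[of "?y t", OF yt[OF this]] show "(\<Sum>\<^sub>\<infinity>\<eta>\<in>?M. A \<eta> * L \<eta> (?y t)) = f (?y t)" by (simp add: Lsum_def)
  qed
  then have "dir_deriv (unit_vec a) f y = g' 0" by (rule dir_derivI)
  moreover have "((\<lambda>X. \<Sum>\<eta>\<in>X. A \<eta> * dir_deriv (unit_vec a) (L \<eta>) y) \<longlongrightarrow> g' 0) ?F"
    using g'[OF b0] by simp
  ultimately show ?thesis by (simp add: has_sum_def)
qed

lemma has_sum_diff_quot:
  assumes g: "conv_at A r" and f: "\<And>x. (\<And>i. i < n \<Longrightarrow> cmod (x i) < r) \<Longrightarrow> f x = Lsum A x"
    and y: "\<And>i. i < n \<Longrightarrow> cmod (y i) < r" and ab: "a < n" "b < n"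
  shows "((\<lambda>\<eta>. A \<eta> * diff_quot a b (L \<eta>) y) has_sum diff_quot a b f y) (multi_idx n)"
proof (cases "y a = y b")
  case True
  have "((\<lambda>\<eta>. A \<eta> * dir_deriv (unit_vec a) (L \<eta>) y + (-1) * (A \<eta> * dir_deriv (unit_vec b) (L \<eta>) y)) has_sum
    (dir_deriv (unit_vec a) f y + (-1) * dir_deriv (unit_vec b) f y)) (multi_idx n)"
    by (intro has_sum_add has_sum_cmult_right has_sum_dir_deriv[OF g f y] ab)
  then show ?thesis using True by (simp add: diff_quot_def algebra_simps)
next
  case False
  let ?s = "sw_pt a b y"
  have s: "cmod (?s i) < r" if "i < n" for i
    using y that ab by (auto simp: sw_pt_def swp_def)
  have fy: "((\<lambda>\<eta>. A \<eta> * L \<eta> y) has_sum f y) (multi_idx n)"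
    using conv_at_has_sum[OF g less_imp_le[OF y]] f[of y, OF y] by simp
  have fs: "((\<lambda>\<eta>. A \<eta> * L \<eta> ?s) has_sum f ?s) (multi_idx n)"
    using conv_at_has_sum[OF g less_imp_le[OF s]] f[of ?s, OF s] by simp
  have "((\<lambda>\<eta>. (A \<eta> * L \<eta> y + (-1) * (A \<eta> * L \<eta> ?s)) / (y a - y b)) has_sum
    ((f y + (-1) * f ?s) / (y a - y b))) (multi_idx n)"
    by (intro has_sum_divide_const has_sum_add has_sum_cmult_right fy fs)
  then show ?thesis using False by (simp add: diff_quot_def algebra_simps)
qed

lemma has_sum_Psi_op:
  assumes g: "conv_at A r" and f: "\<And>x. (\<And>i. i < n \<Longrightarrow> cmod (x i) < r) \<Longrightarrow> f x = Lsum A x"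
    and x: "\<And>i. i < n \<Longrightarrow> cmod (x i) < r"
  shows "((\<lambda>\<eta>. A \<eta> * Psi_op (L \<eta>) x) has_sum Psi_op f x) (multi_idx n)"
proof -
  let ?y = "x \<circ> cyc n"
  have n1: "n - 1 < n" using n by simp
  have y: "cmod (?y i) < r" if "i < n" for i
    using x permutes_in_image[OF cyc_permutes, of n i] that by simp
  have "((\<lambda>\<eta>. A \<eta> * dir_deriv (unit_vec (n - 1)) (L \<eta>) ?y +
      of_real k * (\<Sum>b\<in>{..<n} - {n - 1}. A \<eta> * diff_quot (n - 1) b (L \<eta>) ?y)) has_sum
    (dir_deriv (unit_vec (n - 1)) f ?y + of_real k * (\<Sum>b\<in>{..<n} - {n - 1}. diff_quot (n - 1) b f ?y))) (multi_idx n)"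
    using n1 by (intro has_sum_add has_sum_cmult_right has_sum_finite_sum has_sum_dir_deriv[OF g f y] has_sum_diff_quot[OF g f y]) auto
  then show ?thesis unfolding Psi_op_def dunkl_unit[OF n1]
    by (simp only: sum_distrib_left distrib_left mult.left_commute[of "of_real k"])
qed

text \<open>The coefficients after one application of \<open>Psi_op\<close>; the second factor is
  \<open>betaL (phi_idx n \<kappa>)\<close>.\<close>

definition shift_coef :: "((nat \<Rightarrow> nat) \<Rightarrow> complex) \<Rightarrow> (nat \<Rightarrow> nat) \<Rightarrow> complex" where
  "shift_coef A \<kappa> = A (phi_idx n \<kappa>) * of_nat (Suc (absv n \<kappa>))"

lemma phi_idx_bij: "bij_betw (phi_idx n) (multi_idx n) {\<kappa> \<in> multi_idx n. 0 < \<kappa> (n - 1)}"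
proof (rule bij_betw_byWitness[where f' = "psi_idx n"])
  have "0 < phi_idx n \<eta> (n - 1)" for \<eta> using n by (simp add: phi_idx_def)
  then show "phi_idx n ` multi_idx n \<subseteq> {\<kappa> \<in> multi_idx n. 0 < \<kappa> (n - 1)}" by auto
qed (use psi_phi_idx[OF n] phi_psi_idx[OF n] psi_idx_multi[OF n] in auto)

lemma Psi_op_Lsum:
  assumes g: "conv_at A r" and f: "\<And>x. (\<And>i. i < n \<Longrightarrow> cmod (x i) < r) \<Longrightarrow> f x = Lsum A x"
    and x: "\<And>i. i < n \<Longrightarrow> cmod (x i) < r"
  shows "Psi_op f x = Lsum (shift_coef A) x"
proof -
  have "((\<lambda>\<eta>. A \<eta> * (betaL \<eta> * L (psi_idx n \<eta>) x)) has_sum Psi_op f x) (multi_idx n)"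
    using has_sum_Psi_op[OF assms] Psi_op_jackL by (simp cong: has_sum_cong)
  then have "((\<lambda>\<eta>. A \<eta> * (betaL \<eta> * L (psi_idx n \<eta>) x)) has_sum Psi_op f x) {\<kappa> \<in> multi_idx n. 0 < \<kappa> (n - 1)}"
    by (rule has_sum_cong_neutral[THEN iffD1, rotated -1]) (auto simp: betaL_def)
  then have "((\<lambda>\<kappa>. A (phi_idx n \<kappa>) * (betaL (phi_idx n \<kappa>) * L (psi_idx n (phi_idx n \<kappa>)) x)) has_sum Psi_op f x) (multi_idx n)"
    by (subst has_sum_reindex_bij_betw[OF phi_idx_bij])
  moreover have "A (phi_idx n \<kappa>) * (betaL (phi_idx n \<kappa>) * L (psi_idx n (phi_idx n \<kappa>)) x) = shift_coef A \<kappa> * L \<kappa> x"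
    if "\<kappa> \<in> multi_idx n" for \<kappa>
  proof -
    have "0 < phi_idx n \<kappa> (n - 1)" using n by (simp add: phi_idx_def)
    then show ?thesis by (simp add: betaL_def shift_coef_def absv_phi_idx[OF n] psi_phi_idx[OF n that])
  qed
  ultimately have "((\<lambda>\<kappa>. shift_coef A \<kappa> * L \<kappa> x) has_sum Psi_op f x) (multi_idx n)" by (simp cong: has_sum_cong)
  then show ?thesis unfolding Lsum_def by (rule infsumI[symmetric])
qed

lemma phi_fac_le: "phi_fac \<eta> \<le> real (absv n \<eta>) + (1 + k * real n)"
proof -
  have "\<eta> 0 \<le> absv n \<eta>" unfolding absv_def using n by (intro member_le_sum) auto
  then have "real (\<eta> 0) \<le> real (absv n \<eta>)" by simp
  moreover have "0 \<le> k * real (rnk n \<eta> 0)" using k by simp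
  moreover have "eigval n k \<eta> 0 = real (\<eta> 0) - k * real (rnk n \<eta> 0)" using n by (intro eigval_rnk) simp
  moreover have "k * (real n - 1) = k * real n - k" by (simp add: algebra_simps)
  ultimately show ?thesis unfolding phi_fac_def using k by linarith
qed

text \<open>By \<open>jackL_at_one_phi\<close> the new factor in the coefficients becomes
  \<open>phi_fac\<close>, which grows at most linearly with the degree and is absorbed by the gap
  between r and r'.\<close>

lemma conv_at_shift_coef:
  assumes g: "conv_at A r'" and r: "0 \<le> r" "r < r'"
  shows "conv_at (shift_coef A) r"
proof -
  obtain K where K: "0 \<le> K" "\<And>m. (real m + (1 + k * real n)) * r ^ m \<le> K * r' ^ Suc m"
    using linear_times_power_bounded[OF r, of "1 + k * real n"] by blast
  have "(\<lambda>\<eta>. K * (cmod (A \<eta>) * jackL_at_one \<eta> * r' ^ absv n \<eta>)) summable_on multi_idx n"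
    using g unfolding conv_at_def by (rule summable_on_cmult_right)
  then have "(\<lambda>\<eta>. K * (cmod (A \<eta>) * jackL_at_one \<eta> * r' ^ absv n \<eta>)) summable_on {\<kappa> \<in> multi_idx n. 0 < \<kappa> (n - 1)}"
    by (rule summable_on_subset_banach) auto
  then have "(\<lambda>\<kappa>. K * (cmod (A (phi_idx n \<kappa>)) * jackL_at_one (phi_idx n \<kappa>) * r' ^ absv n (phi_idx n \<kappa>))) summable_on multi_idx n"
    by (rule iffD2[OF summable_on_reindex_bij_betw[OF phi_idx_bij,
          of "\<lambda>\<eta>. K * (cmod (A \<eta>) * jackL_at_one \<eta> * r' ^ absv n \<eta>)"]])
  then show ?thesis unfolding conv_at_def
  proof (rule summable_on_comparison_test)
    fix \<kappa> assume \<kappa>: "\<kappa> \<in> multi_idx n"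
    let ?p = "phi_idx n \<kappa>" and ?m = "absv n \<kappa>"
    have "cmod (shift_coef A \<kappa>) * jackL_at_one \<kappa> * r ^ ?m = cmod (A ?p) * (real (Suc ?m) * jackL_at_one \<kappa>) * r ^ ?m"
      by (simp add: shift_coef_def norm_mult del: of_nat_Suc)
    also have "\<dots> = cmod (A ?p) * jackL_at_one ?p * (phi_fac \<kappa> * r ^ ?m)" unfolding jackL_at_one_phi[OF \<kappa>, symmetric] by simp
    also have "\<dots> \<le> cmod (A ?p) * jackL_at_one ?p * (K * r' ^ Suc ?m)"
    proof (intro mult_left_mono)
      have "phi_fac \<kappa> * r ^ ?m \<le> (real ?m + (1 + k * real n)) * r ^ ?m"
        using phi_fac_le r by (intro mult_right_mono) auto
      then show "phi_fac \<kappa> * r ^ ?m \<le> K * r' ^ Suc ?m" using K(2)[of ?m] by linarith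
    qed (use jackL_at_one_pos[OF phi_idx_multi, of \<kappa>] in simp)
    finally show "cmod (shift_coef A \<kappa>) * jackL_at_one \<kappa> * r ^ ?m \<le> K * (cmod (A ?p) * jackL_at_one ?p * r' ^ absv n ?p)"
      by (simp add: absv_phi_idx[OF n] algebra_simps)
    show "0 \<le> cmod (shift_coef A \<kappa>) * jackL_at_one \<kappa> * r ^ ?m" using jackL_at_one_pos[OF \<kappa>] r by simp
  qed
qed

text \<open>Each application costs a little radius. As \<open>Rad\<close> has no largest element,
  the loss is made up from a larger admissible radius and the domain is kept.\<close>

lemma Psi_op_pow_Lsum:
  assumes g: "\<And>r. r \<in> Rad \<Longrightarrow> conv_at A r" and Rad: "\<And>r. r \<in> Rad \<Longrightarrow> 0 \<le> r \<and> (\<exists>r'\<in>Rad. r < r')"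
    and f: "\<And>x r. r \<in> Rad \<Longrightarrow> (\<And>i. i < n \<Longrightarrow> cmod (x i) < r) \<Longrightarrow> f x = Lsum A x"
  shows "(\<forall>r\<in>Rad. conv_at ((shift_coef ^^ i) A) r) \<and>
    (\<forall>x. \<forall>r\<in>Rad. (\<forall>j<n. cmod (x j) < r) \<longrightarrow> (Psi_op ^^ i) f x = Lsum ((shift_coef ^^ i) A) x)"
proof (induction i)
  case 0 then show ?case using g f by simp
next
  case (Suc i)
  have "conv_at ((shift_coef ^^ Suc i) A) r" if r: "r \<in> Rad" for r
  proof -
    obtain r' where "r' \<in> Rad" "r < r'" "0 \<le> r" using Rad[OF r] by blast
    then show ?thesis using conv_at_shift_coef[of "(shift_coef ^^ i) A" r' r] Suc by simp
  qed
  moreover have "(Psi_op ^^ Suc i) f x = Lsum ((shift_coef ^^ Suc i) A) x"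
    if r: "r \<in> Rad" and x: "\<forall>j<n. cmod (x j) < r" for x r
  proof -
    have "Psi_op ((Psi_op ^^ i) f) x = Lsum (shift_coef ((shift_coef ^^ i) A)) x"
      by (rule Psi_op_Lsum[of _ r]) (use Suc r x in blast)+
    then show ?thesis by simp
  qed
  ultimately show ?case by blast
qed

lemma shift_coef_pow: "(shift_coef ^^ i) A \<kappa> = A ((phi_idx n ^^ i) \<kappa>) * (fact (absv n \<kappa> + i) / fact (absv n \<kappa>))"
proof (induction i arbitrary: \<kappa>)
  case (Suc i)
  have "(shift_coef ^^ Suc i) A \<kappa> = (shift_coef ^^ i) A (phi_idx n \<kappa>) * of_nat (Suc (absv n \<kappa>))" by (simp add: shift_coef_def)
  also have "\<dots> = A ((phi_idx n ^^ i) (phi_idx n \<kappa>)) *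
    (fact (Suc (absv n \<kappa>) + i) / fact (Suc (absv n \<kappa>))) * of_nat (Suc (absv n \<kappa>))"
    unfolding Suc absv_phi_idx[OF n] ..
  also have "\<dots> = A ((phi_idx n ^^ Suc i) \<kappa>) * (fact (absv n \<kappa> + Suc i) / fact (absv n \<kappa>))"
  proof -
    have "of_nat (Suc (absv n \<kappa>)) \<noteq> (0::complex)" by (simp only: of_nat_eq_0_iff)
    then have "(fact (Suc (absv n \<kappa>) + i) / fact (Suc (absv n \<kappa>))) * of_nat (Suc (absv n \<kappa>))
      = (fact (absv n \<kappa> + Suc i) / fact (absv n \<kappa>) :: complex)"
      by (simp add: divide_simps del: of_nat_Suc)
    then show ?thesis by (simp only: funpow_Suc_right o_apply mult.assoc)
  qed
  finally show ?case .
qed simp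

lemma phi_idx_pow:
  assumes "\<kappa> \<in> multi_idx n" "i \<le> n"
  shows "(phi_idx n ^^ i) \<kappa> m = (if m + i < n then \<kappa> (m + i) else if m < n then Suc (\<kappa> (m + i - n)) else 0)"
  using assms(2)
proof (induction i arbitrary: m)
  case 0 then show ?case using assms(1) by (auto simp: multi_idx_def)
next
  case (Suc i)
  have IH: "(phi_idx n ^^ i) \<kappa> m = (if m + i < n then \<kappa> (m + i) else if m < n then Suc (\<kappa> (m + i - n)) else 0)" for m
    using Suc by simp
  consider "Suc m < n" | "Suc m = n" | "n \<le> m" by linarith
  then show ?case using Suc.prems by cases (auto simp: phi_idx_def[of n "(phi_idx n ^^ i) \<kappa>"] IH)
qed

lemma phi_idx_pow_n: "\<kappa> \<in> multi_idx n \<Longrightarrow> (phi_idx n ^^ n) \<kappa> = plus_one \<kappa>"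
  by (auto simp: fun_eq_iff phi_idx_pow plus_one_def)

lemma absv_plus_one: "absv n (plus_one \<kappa>) = absv n \<kappa> + n"
  by (simp add: absv_def plus_one_def sum_Suc)

lemma dunkl_Delta_Lsum:
  assumes "\<And>r. r \<in> Rad \<Longrightarrow> conv_at A r" and "\<And>r. r \<in> Rad \<Longrightarrow> 0 \<le> r \<and> (\<exists>r'\<in>Rad. r < r')"
    and "\<And>x r. r \<in> Rad \<Longrightarrow> (\<And>i. i < n \<Longrightarrow> cmod (x i) < r) \<Longrightarrow> f x = Lsum A x"
    and z: "r \<in> Rad" "\<And>i. i < n \<Longrightarrow> cmod (z i) < r"
    and A': "\<And>\<kappa>. \<kappa> \<in> multi_idx n \<Longrightarrow> A (plus_one \<kappa>) * (fact (absv n \<kappa> + n) / fact (absv n \<kappa>)) = c * A' \<kappa>"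
  shows "dunkl_Delta n k f z = c * Lsum A' z"
proof -
  have "(\<forall>r\<in>Rad. conv_at ((shift_coef ^^ n) A) r) \<and>
    (\<forall>x. \<forall>r\<in>Rad. (\<forall>j<n. cmod (x j) < r) \<longrightarrow> (Psi_op ^^ n) f x = Lsum ((shift_coef ^^ n) A) x)"
  proof (rule Psi_op_pow_Lsum)
    show "conv_at A r" if "r \<in> Rad" for r by (rule assms(1)[OF that])
    show "0 \<le> r \<and> (\<exists>r'\<in>Rad. r < r')" if "r \<in> Rad" for r by (rule assms(2)[OF that])
    show "f x = Lsum A x" if "r \<in> Rad" "\<And>i. i < n \<Longrightarrow> cmod (x i) < r" for x r by (rule assms(3)[OF that])
  qed
  then have "dunkl_Delta n k f z = Lsum ((shift_coef ^^ n) A) z" unfolding dunkl_Delta_eq using z by blast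
  also have "\<dots> = (\<Sum>\<^sub>\<infinity>\<kappa>\<in>multi_idx n. c * (A' \<kappa> * L \<kappa> z))"
    unfolding Lsum_def shift_coef_pow using A' phi_idx_pow_n by (intro infsum_cong) simp
  also have "\<dots> = c * Lsum A' z" unfolding Lsum_def by (rule infsum_cmult_right')
  finally show ?thesis .
qed

subsection \<open>Hypergeometric series\<close>

lemma dcyc_pow_n: "dcyc n ^^ n = id"
proof -
  have "(dcyc n ^^ i) ((cyc n ^^ i) m) = m" for i m
    by (induction i arbitrary: m) (simp_all add: funpow_swap1)
  moreover have "cyc n ^^ n = id" by (auto simp: fun_eq_iff cyc_pow)
  ultimately show ?thesis by (metis eq_id_iff)
qed

lemma jackE_phi_pow:
  assumes "\<kappa> \<in> multi_idx n" "i \<le> n"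
  shows "E ((phi_idx n ^^ i) \<kappa>) x = (\<Prod>t<i. x (n - 1 - t)) * E \<kappa> (x \<circ> (dcyc n ^^ i))"
  using assms(2)
proof (induction i arbitrary: x)
  case (Suc i)
  have m: "(phi_idx n ^^ i) \<kappa> \<in> multi_idx n" using assms(1) by (cases i) auto
  have "(\<Prod>t<i. (x \<circ> dcyc n) (n - 1 - t)) = (\<Prod>t<i. x (n - 1 - Suc t))"
    using Suc.prems by (intro prod.cong refl) (auto simp: dcyc_def)
  moreover have "E ((phi_idx n ^^ i) \<kappa>) y = (\<Prod>t<i. y (n - 1 - t)) * E \<kappa> (y \<circ> (dcyc n ^^ i))" for y
    by (rule Suc.IH) (use Suc.prems in simp)
  moreover have "E ((phi_idx n ^^ Suc i) \<kappa>) x = x (n - 1) * E ((phi_idx n ^^ i) \<kappa>) (x \<circ> dcyc n)"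
    by (simp add: jackE_phi[OF m] Phi_op_def)
  ultimately have "E ((phi_idx n ^^ Suc i) \<kappa>) x
    = x (n - 1) * ((\<Prod>t<i. x (n - 1 - Suc t)) * E \<kappa> (x \<circ> dcyc n \<circ> (dcyc n ^^ i)))"
    by (simp only:)
  also have "x \<circ> dcyc n \<circ> (dcyc n ^^ i) = x \<circ> (dcyc n ^^ Suc i)" by (simp only: funpow.simps comp_assoc)
  finally show ?case by (simp only: prod.lessThan_Suc_shift mult.assoc diff_zero)
qed simp

text \<open>Over a full cycle of n raising steps every coordinate is multiplied in once and the
  shifts compose to the identity.\<close>

lemma jackE_plus_one:
  assumes "\<kappa> \<in> multi_idx n" shows "E (plus_one \<kappa>) x = (\<Prod>i<n. x i) * E \<kappa> x"
proof -
  have "(\<Prod>t<n. x (n - 1 - t)) = (\<Prod>i<n. x i)" using prod.nat_diff_reindex[of x n] by simp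
  then show ?thesis
    using jackE_phi_pow[OF assms order_refl, of x] by (simp add: phi_idx_pow_n[OF assms] dcyc_pow_n)
qed

text \<open>Dividing by the value at \<open>one_vec\<close> cancels the coefficients. This is where
  the factor \<Delta>(w) originates.\<close>

lemma jackL_plus_one_ratio:
  assumes "\<kappa> \<in> multi_idx n"
  shows "L (plus_one \<kappa>) w / L (plus_one \<kappa>) one_vec = (\<Prod>i<n. w i) * (L \<kappa> w / L \<kappa> one_vec)"
proof -
  have "C (absv n (plus_one \<kappa>)) (plus_one \<kappa>) \<noteq> 0" "C (absv n \<kappa>) \<kappa> \<noteq> 0"
    using coefs_pos[OF plus_one_multi[of \<kappa>]] coefs_pos[OF assms] by auto
  then show ?thesis unfolding jackL_def jackE_plus_one[OF assms] by (simp add: one_vec_def)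
qed

text \<open>The ratio of the normalizing coefficients of \<open>plus_one \<kappa>\<close> and
  \<kappa>. In this form it is visibly invariant under permutations and can be pulled out of the
  orbit sum in \<open>jackC_plus_one\<close>.\<close>

definition coef_ratio :: "(nat \<Rightarrow> nat) \<Rightarrow> complex" where
  "coef_ratio \<kappa> = d_coef n (plus_one \<kappa>) / of_real (delta_eig (plus_one \<kappa>))"

lemma delta_eig_plus_one_pos: "0 < delta_eig (plus_one \<kappa>)"
proof -
  have "0 < eigval n k (plus_one \<kappa>) j + k * (real n - 1)" if "j < n" for j
    using poch_base_ge[OF that, of "plus_one \<kappa>"] that by (simp add: eigval_rnk plus_one_def)
  then have "0 < (\<Prod>j<n. eigval n k (plus_one \<kappa>) j + k * (real n - 1))" by (intro prod_pos) auto
  then show ?thesis by (simp add: delta_eig_def plus_one_def)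
qed

text \<open>\<Delta>(T) of \<open>L (plus_one \<kappa>)\<close> is computed twice, by
  \<open>dunkl_Delta_jackL\<close> and through \<open>dunkl_Delta_jackE\<close>; comparison at
  \<open>one_vec\<close> relates the two coefficients.\<close>

lemma jackL_plus_one:
  assumes "\<kappa> \<in> multi_idx n"
  shows "L (plus_one \<kappa>) w = coef_ratio \<kappa> * ((\<Prod>i<n. w i) * L \<kappa> w)"
proof -
  let ?\<eta> = "plus_one \<kappa>"
  have E1: "E \<kappa> one_vec \<noteq> 0" using jackE_one[OF assms] by (metis not_one_le_zero of_real_0 of_real_eq_iff)
  have "C (absv n ?\<eta>) ?\<eta> * (of_real (delta_eig ?\<eta>) * E \<kappa> one_vec) = d_coef n ?\<eta> * (C (absv n \<kappa>) \<kappa> * E \<kappa> one_vec)"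
  proof -
    have "(Psi_op ^^ n) (\<lambda>x. \<Sum>\<eta>\<in>{?\<eta>}. C (absv n ?\<eta>) ?\<eta> * E \<eta> x)
      = (\<lambda>x. \<Sum>\<eta>\<in>{?\<eta>}. (C (absv n ?\<eta>) ?\<eta> * (\<Prod>t<n. betaE ((psi_idx n ^^ t) \<eta>))) * E ((psi_idx n ^^ n) \<eta>) x)"
      by (rule Psi_op_pow_sum[where F = E and \<beta> = betaE]) (use plus_one_multi dir_diff_jackE Psi_op_jackE in auto)
    moreover have "(Psi_op ^^ n) (\<lambda>x. \<Sum>\<eta>\<in>{?\<eta>}. 1 * E \<eta> x)
      = (\<lambda>x. \<Sum>\<eta>\<in>{?\<eta>}. (1 * (\<Prod>t<n. betaE ((psi_idx n ^^ t) \<eta>))) * E ((psi_idx n ^^ n) \<eta>) x)"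
      by (rule Psi_op_pow_sum[where F = E and \<beta> = betaE]) (use plus_one_multi dir_diff_jackE Psi_op_jackE in auto)
    ultimately have "dunkl_Delta n k (L ?\<eta>) one_vec = C (absv n ?\<eta>) ?\<eta> * dunkl_Delta n k (E ?\<eta>) one_vec"
      unfolding dunkl_Delta_eq jackL_eq by simp
    then show ?thesis
      unfolding dunkl_Delta_jackL[OF plus_one_multi] dunkl_Delta_jackE[OF plus_one_multi] minus_plus_one[OF assms]
      by (auto simp: jackL_def)
  qed
  then have "C (absv n ?\<eta>) ?\<eta> * of_real (delta_eig ?\<eta>) = d_coef n ?\<eta> * C (absv n \<kappa>) \<kappa>"
    using E1 by (metis mult.assoc mult_right_cancel)
  then have "C (absv n ?\<eta>) ?\<eta> = coef_ratio \<kappa> * C (absv n \<kappa>) \<kappa>"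
    using delta_eig_plus_one_pos[of \<kappa>] by (simp add: coef_ratio_def field_simps)
  then show ?thesis unfolding jackL_def jackE_plus_one[OF assms] by simp
qed

lemma coef_ratio_perm:
  assumes "\<kappa> \<in> multi_idx n" "\<sigma> permutes {..<n}" shows "coef_ratio (\<kappa> \<circ> \<sigma>) = coef_ratio \<kappa>"
  unfolding coef_ratio_def plus_one_perm[OF assms(2)] d_coef_perm[OF assms(2)] delta_eig_perm[OF plus_one_multi assms(2)] ..

lemma coef_ratio_nz: "\<kappa> \<in> multi_idx n \<Longrightarrow> coef_ratio \<kappa> \<noteq> 0"
proof
  assume \<kappa>: "\<kappa> \<in> multi_idx n" and "coef_ratio \<kappa> = 0"
  then have "L (plus_one \<kappa>) one_vec = 0" using jackL_plus_one[OF \<kappa>, of one_vec] by simp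
  then show False using jackL_one[OF plus_one_multi, of \<kappa>] jackL_at_one_pos[OF plus_one_multi, of \<kappa>] by simp
qed

lemma plus_one_partition: "is_partition n lam \<Longrightarrow> is_partition n (plus_one lam)"
  unfolding is_partition_def using plus_one_multi[of lam] by (auto simp: plus_one_def)

lemma jackC_plus_one:
  assumes lam: "is_partition n lam"
  shows "jackC n k (plus_one lam) w = coef_ratio lam * ((\<Prod>i<n. w i) * jackC n k lam w)"
proof -
  have lm: "lam \<in> multi_idx n" using lam by (simp add: is_partition_def)
  have pm: "minus_one (plus_one lam) = lam" by (rule minus_plus_one[OF lm])
  have "jackC n k (plus_one lam) w = (\<Sum>\<eta>\<in>orbit (plus_one lam). L (plus_one (minus_one \<eta>)) w)"
    unfolding jackC_eq
  proof (intro sum.cong refl)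
    fix \<eta> assume \<eta>: "\<eta> \<in> orbit (plus_one lam)"
    obtain \<sigma> where s: "\<sigma> permutes {..<n}" "\<eta> = plus_one lam \<circ> \<sigma>"
      using orbit_perm[OF plus_one_partition[OF lam] \<eta>] .
    have "\<forall>i<n. \<eta> i \<noteq> 0" using s permutes_in_image[OF s(1)] by (simp add: plus_one_def)
    then show "L \<eta> w = L (plus_one (minus_one \<eta>)) w" using \<eta> by (simp add: plus_minus_one orbit_def)
  qed
  also have "\<dots> = (\<Sum>\<kappa>\<in>orbit lam. L (plus_one \<kappa>) w)"
    using sum_orbit_minus_one[OF plus_one_partition[OF lam], of "\<lambda>\<kappa>. L (plus_one \<kappa>) w"]
    unfolding pm by (simp add: plus_one_def)
  also have "\<dots> = (\<Sum>\<kappa>\<in>orbit lam. coef_ratio lam * ((\<Prod>i<n. w i) * L \<kappa> w))"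
  proof (intro sum.cong refl)
    fix \<kappa> assume \<kappa>: "\<kappa> \<in> orbit lam"
    obtain \<sigma> where s: "\<sigma> permutes {..<n}" "\<kappa> = lam \<circ> \<sigma>" using orbit_perm[OF lam \<kappa>] .
    have "\<kappa> \<in> multi_idx n" using \<kappa> by (simp add: orbit_def)
    then show "L (plus_one \<kappa>) w = coef_ratio lam * ((\<Prod>i<n. w i) * L \<kappa> w)"
      using coef_ratio_perm[OF lm s(1)] s(2) by (simp add: jackL_plus_one)
  qed
  finally show ?thesis unfolding jackC_eq by (simp only: sum_distrib_left)
qed

lemma jackC_plus_one_ratio:
  assumes "is_partition n lam"
  shows "jackC n k (plus_one lam) w / jackC n k (plus_one lam) one_vec
    = (\<Prod>i<n. w i) * (jackC n k lam w / jackC n k lam one_vec)"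
  unfolding jackC_plus_one[OF assms] using coef_ratio_nz[of lam] assms by (simp add: is_partition_def one_vec_def)

lemma jackC_bound:
  assumes lam: "is_partition n lam" and w: "\<And>i. i < n \<Longrightarrow> cmod (w i) \<le> W"
  shows "cmod (jackC n k lam w / jackC n k lam one_vec) \<le> W ^ absv n lam"
proof -
  have m: "\<eta> \<in> multi_idx n" "absv n \<eta> = absv n lam" if "\<eta> \<in> orbit lam" for \<eta>
    using that orbit_subset[of lam] by (auto simp: deg_idx_def)
  have one: "jackC n k lam one_vec = of_real (\<Sum>\<eta>\<in>orbit lam. jackL_at_one \<eta>)"
    unfolding jackC_eq using m jackL_one by simp
  have "lam \<in> orbit lam" using lam plus_part_partition[OF lam] by (simp add: orbit_def is_partition_def)
  then have pos: "0 < (\<Sum>\<eta>\<in>orbit lam. jackL_at_one \<eta>)" using m jackL_at_one_pos by (intro sum_pos[OF finite_orbit]) auto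
  have "cmod (jackC n k lam w) \<le> (\<Sum>\<eta>\<in>orbit lam. jackL_at_one \<eta> * W ^ absv n lam)"
    unfolding jackC_eq
  proof (rule sum_norm_le)
    fix \<eta> assume "\<eta> \<in> orbit lam"
    from m[OF this] show "cmod (L \<eta> w) \<le> jackL_at_one \<eta> * W ^ absv n lam" using jackL_bound[OF _ w, of \<eta>] by simp
  qed
  also have "\<dots> = W ^ absv n lam * (\<Sum>\<eta>\<in>orbit lam. jackL_at_one \<eta>)" by (simp add: sum_distrib_left mult.commute)
  finally show ?thesis unfolding one norm_divide norm_of_real using pos by (simp add: field_simps)
qed

lemma jackL_ratio_bound:
  assumes "\<eta> \<in> multi_idx n" "\<And>i. i < n \<Longrightarrow> cmod (w i) \<le> W"
  shows "cmod (L \<eta> w / L \<eta> one_vec) \<le> W ^ absv n \<eta>"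
  using jackL_bound[OF assms] jackL_at_one_pos[OF assms(1)] unfolding jackL_one[OF assms(1)] norm_divide norm_of_real
  by (simp add: field_simps)

section \<open>Shifted parameters, radii of convergence and the two series\<close>

definition gpoch_ratio :: "nat \<Rightarrow> nat \<Rightarrow> (nat \<Rightarrow> complex) \<Rightarrow> (nat \<Rightarrow> complex) \<Rightarrow> (nat \<Rightarrow> nat) \<Rightarrow> complex" where
  "gpoch_ratio p q \<mu> \<nu> lam = gpoch n k p \<mu> lam / gpoch n k q \<nu> lam"

lemma gpoch_plus_one: "gpoch n k p \<mu> (plus_one lam) = gpoch n k p \<mu> (\<lambda>_. 1) * gpoch n k p (\<lambda>i. \<mu> i + 1) lam"
proof -
  have "pochhammer (\<mu> i - of_real k * of_nat j) (plus_one lam j)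
    = pochhammer (\<mu> i - of_real k * of_nat j) 1 * pochhammer (\<mu> i + 1 - of_real k * of_nat j) (lam j)"
    if "j < n" for i j
    using that by (simp add: plus_one_def pochhammer_rec algebra_simps)
  then show ?thesis unfolding gpoch_def by (simp add: prod.distrib)
qed

lemma gpoch_ratio_plus_one:
  "gpoch_ratio p q \<mu> \<nu> (plus_one lam) = gpoch n k p \<mu> (\<lambda>_. 1) / gpoch n k q \<nu> (\<lambda>_. 1) * gpoch_ratio p q (\<lambda>i. \<mu> i + 1) (\<lambda>i. \<nu> i + 1) lam"
  unfolding gpoch_ratio_def gpoch_plus_one by simp

definition radii :: "nat \<Rightarrow> nat \<Rightarrow> (nat \<Rightarrow> complex) \<Rightarrow> real set" where
  "radii p q w = {r. 0 \<le> r \<and> (p \<le> q \<or> r * supnorm n w < 1)}"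

lemma supnorm_ge: "i < n \<Longrightarrow> cmod (z i) \<le> supnorm n z"
  unfolding supnorm_def by (intro Max_ge) auto

lemma supnorm_nonneg: "0 \<le> supnorm n z"
  using order_trans[OF norm_ge_zero supnorm_ge[of 0 z]] n by simp

text \<open>The admissible radii are open upwards, as \<open>Psi_op_pow_Lsum\<close> demands; with s
  = \<open>supnorm n z\<close> this also fits a larger polydisc around the given point.\<close>

lemma radii_open:
  assumes "0 \<le> s" "p \<le> q \<or> s * supnorm n w < 1" shows "\<exists>r\<in>radii p q w. s < r"
proof (cases "p \<le> q")
  case True
  then show ?thesis using assms by (intro bexI[of _ "s + 1"]) (auto simp: radii_def)
next
  case False
  let ?W = "supnorm n w"
  have sW: "s * ?W < 1" "0 \<le> ?W" using assms False supnorm_nonneg by auto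
  \<comment> \<open>Solves (s + e) * ?W = 1 - e, so s + e / 2 is still admissible; the denominator
    stays positive when ?W = 0.\<close>
  define e where "e = (1 - s * ?W) / (1 + ?W)"
  have e: "0 < e" using sW by (auto simp: e_def)
  have "(s + e / 2) * ?W < 1"
  proof -
    have "e * (1 + ?W) = 1 - s * ?W" using sW by (simp add: e_def)
    then have "s * ?W + e * ?W = 1 - e" by (simp add: algebra_simps)
    moreover have "0 \<le> e * ?W" using e sW by simp
    ultimately show ?thesis using e by (simp add: algebra_simps)
  qed
  then show ?thesis using e assms(1) by (intro bexI[of _ "s + e / 2"]) (auto simp: radii_def)
qed

lemma conv_at_hyp:
  assumes pq: "p \<le> q + 1" and r: "r \<in> radii p q w"
    and A: "\<And>\<eta>. \<eta> \<in> multi_idx n \<Longrightarrow>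
      cmod (A \<eta>) \<le> cmod (gpoch_ratio p q \<mu> \<nu> (plus_part n \<eta>)) * supnorm n w ^ absv n \<eta> / fact (absv n \<eta>)"
  shows "conv_at A r"
  unfolding conv_at_def
proof (rule summable_on_comparison_test)
  let ?\<rho> = "r * supnorm n w"
  show "(\<lambda>\<eta>. cmod (gpoch n k p \<mu> (plus_part n \<eta>) / gpoch n k q \<nu> (plus_part n \<eta>)) *
    (jackL_at_one \<eta> / fact (absv n \<eta>)) * ?\<rho> ^ absv n \<eta>) summable_on multi_idx n"
    using pq r supnorm_nonneg by (intro hyp_coef_summable) (auto simp: radii_def)
  fix \<eta> assume \<eta>: "\<eta> \<in> multi_idx n"
  have "cmod (A \<eta>) * jackL_at_one \<eta> * r ^ absv n \<eta>
    \<le> (cmod (gpoch_ratio p q \<mu> \<nu> (plus_part n \<eta>)) * supnorm n w ^ absv n \<eta> / fact (absv n \<eta>)) * jackL_at_one \<eta> * r ^ absv n \<eta>"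
    using A[OF \<eta>] jackL_at_one_pos[OF \<eta>] r by (intro mult_right_mono) (auto simp: radii_def)
  also have "\<dots> = cmod (gpoch_ratio p q \<mu> \<nu> (plus_part n \<eta>)) * (jackL_at_one \<eta> / fact (absv n \<eta>)) * ?\<rho> ^ absv n \<eta>"
    by (simp add: power_mult_distrib)
  finally show "cmod (A \<eta>) * jackL_at_one \<eta> * r ^ absv n \<eta>
    \<le> cmod (gpoch n k p \<mu> (plus_part n \<eta>) / gpoch n k q \<nu> (plus_part n \<eta>)) * (jackL_at_one \<eta> / fact (absv n \<eta>)) * ?\<rho> ^ absv n \<eta>"
    unfolding gpoch_ratio_def .
  show "0 \<le> cmod (A \<eta>) * jackL_at_one \<eta> * r ^ absv n \<eta>" using jackL_at_one_pos[OF \<eta>] r by (simp add: radii_def)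
qed

text \<open>The part common to both series, which differ only in their coefficients A. The bound on
  A is the one that \<open>hyp_coef_summable\<close> turns into convergence.\<close>

lemma dunkl_Delta_hyp:
  assumes pq: "p \<le> q + 1" and z: "z \<in> conv_dom n p q w"
    and f: "\<And>x. x \<in> conv_dom n p q w \<Longrightarrow> f x = Lsum A x"
    and A: "\<And>\<eta>. \<eta> \<in> multi_idx n \<Longrightarrow>
      cmod (A \<eta>) \<le> cmod (gpoch_ratio p q \<mu> \<nu> (plus_part n \<eta>)) * supnorm n w ^ absv n \<eta> / fact (absv n \<eta>)"
    and A': "\<And>\<kappa>. \<kappa> \<in> multi_idx n \<Longrightarrow> A (plus_one \<kappa>) * (fact (absv n \<kappa> + n) / fact (absv n \<kappa>)) = c * A' \<kappa>"
  shows "dunkl_Delta n k f z = c * Lsum A' z"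
proof -
  have "p \<le> q \<or> supnorm n z * supnorm n w < 1" using z by (auto simp: conv_dom_def split: if_splits)
  from radii_open[OF supnorm_nonneg this] obtain r where r: "r \<in> radii p q w" "supnorm n z < r" by blast
  show ?thesis
  proof (rule dunkl_Delta_Lsum[where Rad = "radii p q w"])
    show "conv_at A r" if "r \<in> radii p q w" for r by (rule conv_at_hyp[OF pq that A])
    show "0 \<le> r \<and> (\<exists>r'\<in>radii p q w. r < r')" if "r \<in> radii p q w" for r
      using radii_open[of r p q w] that by (auto simp: radii_def)
    show "f x = Lsum A x" if r: "r \<in> radii p q w" and x: "\<And>i. i < n \<Longrightarrow> cmod (x i) < r" for x r
    proof (rule f)
      have "supnorm n x \<le> r"
        unfolding supnorm_def using n x by (subst Max_le_iff) (auto simp: lessThan_empty_iff intro: less_imp_le)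
      then have "supnorm n x * supnorm n w \<le> r * supnorm n w" using supnorm_nonneg by (rule mult_right_mono)
      then show "x \<in> conv_dom n p q w" using r by (auto simp: conv_dom_def radii_def)
    qed
    show "r \<in> radii p q w" by (rule r(1))
    show "cmod (z i) < r" if "i < n" for i using supnorm_ge[OF that, of z] r(2) by linarith
  qed (rule A')
qed

definition coefK :: "nat \<Rightarrow> nat \<Rightarrow> (nat \<Rightarrow> complex) \<Rightarrow> (nat \<Rightarrow> complex) \<Rightarrow> (nat \<Rightarrow> complex) \<Rightarrow> (nat \<Rightarrow> nat) \<Rightarrow> complex" where
  "coefK p q \<mu> \<nu> w \<eta> = gpoch_ratio p q \<mu> \<nu> (plus_part n \<eta>) / fact (absv n \<eta>) * (L \<eta> w / L \<eta> one_vec)"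

text \<open>A symmetric series is also a series in the \<open>L\<close>, with coefficients constant
  on each orbit, because \<open>jackC\<close> is the orbit sum. Both hypergeometric functions
  thereby fall under \<open>Lsum\<close>.\<close>

definition coefF :: "nat \<Rightarrow> nat \<Rightarrow> (nat \<Rightarrow> complex) \<Rightarrow> (nat \<Rightarrow> complex) \<Rightarrow> (nat \<Rightarrow> complex) \<Rightarrow> (nat \<Rightarrow> nat) \<Rightarrow> complex" where
  "coefF p q \<mu> \<nu> w \<eta> = gpoch_ratio p q \<mu> \<nu> (plus_part n \<eta>) / fact (absv n \<eta>) *
    (jackC n k (plus_part n \<eta>) w / jackC n k (plus_part n \<eta>) one_vec)"

lemma hypK_eq: "hypK n k p q \<mu> \<nu> w = Lsum (coefK p q \<mu> \<nu> w)"
  by (rule ext) (simp add: hypK_def Lsum_def coefK_def gpoch_ratio_def mult.assoc)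

lemma coefK_bound:
  assumes "\<eta> \<in> multi_idx n"
  shows "cmod (coefK p q \<mu> \<nu> w \<eta>) \<le> cmod (gpoch_ratio p q \<mu> \<nu> (plus_part n \<eta>)) * supnorm n w ^ absv n \<eta> / fact (absv n \<eta>)"
proof -
  have "cmod (L \<eta> w / L \<eta> one_vec) \<le> supnorm n w ^ absv n \<eta>" by (rule jackL_ratio_bound[OF assms supnorm_ge])
  then have "cmod (gpoch_ratio p q \<mu> \<nu> (plus_part n \<eta>)) / fact (absv n \<eta>) * cmod (L \<eta> w / L \<eta> one_vec)
    \<le> cmod (gpoch_ratio p q \<mu> \<nu> (plus_part n \<eta>)) / fact (absv n \<eta>) * supnorm n w ^ absv n \<eta>"
    by (intro mult_left_mono) auto
  then show ?thesis unfolding coefK_def norm_mult norm_divide[of "gpoch_ratio p q \<mu> \<nu> (plus_part n \<eta>)"] norm_fact by simp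
qed

lemma coefF_bound:
  assumes "\<eta> \<in> multi_idx n"
  shows "cmod (coefF p q \<mu> \<nu> w \<eta>) \<le> cmod (gpoch_ratio p q \<mu> \<nu> (plus_part n \<eta>)) * supnorm n w ^ absv n \<eta> / fact (absv n \<eta>)"
proof -
  let ?l = "plus_part n \<eta>"
  have "cmod (jackC n k ?l w / jackC n k ?l one_vec) \<le> supnorm n w ^ absv n \<eta>"
    using jackC_bound[OF plus_part_rnk(2)[OF assms] supnorm_ge] by (simp only: absv_plus_part[OF assms])
  then have "cmod (gpoch_ratio p q \<mu> \<nu> ?l) / fact (absv n \<eta>) * cmod (jackC n k ?l w / jackC n k ?l one_vec)
    \<le> cmod (gpoch_ratio p q \<mu> \<nu> ?l) / fact (absv n \<eta>) * supnorm n w ^ absv n \<eta>"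
    by (intro mult_left_mono) auto
  then show ?thesis unfolding coefF_def norm_mult norm_divide[of "gpoch_ratio p q \<mu> \<nu> ?l"] norm_fact by simp
qed

lemma coefK_plus_one:
  assumes "\<kappa> \<in> multi_idx n"
  shows "coefK p q \<mu> \<nu> w (plus_one \<kappa>) * (fact (absv n \<kappa> + n) / fact (absv n \<kappa>)) =
    gpoch n k p \<mu> (\<lambda>_. 1) / gpoch n k q \<nu> (\<lambda>_. 1) * (\<Prod>i<n. w i) * coefK p q (\<lambda>i. \<mu> i + 1) (\<lambda>i. \<nu> i + 1) w \<kappa>"
  unfolding coefK_def jackL_plus_one_ratio[OF assms] plus_part_plus_one[OF assms] gpoch_ratio_plus_one absv_plus_one
  by (simp add: ac_simps)

lemma coefF_plus_one:
  assumes "\<kappa> \<in> multi_idx n"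
  shows "coefF p q \<mu> \<nu> w (plus_one \<kappa>) * (fact (absv n \<kappa> + n) / fact (absv n \<kappa>)) =
    gpoch n k p \<mu> (\<lambda>_. 1) / gpoch n k q \<nu> (\<lambda>_. 1) * (\<Prod>i<n. w i) * coefF p q (\<lambda>i. \<mu> i + 1) (\<lambda>i. \<nu> i + 1) w \<kappa>"
  unfolding coefF_def plus_part_plus_one[OF assms] jackC_plus_one_ratio[OF plus_part_rnk(2)[OF assms]] gpoch_ratio_plus_one absv_plus_one
  by (simp add: ac_simps)

text \<open>Grouping by orbits turns the sum over multi-indices into one over partitions. Regrouping
  rests on summability, hence the restriction to the domain of convergence.\<close>

lemma Lsum_coefF:
  assumes pq: "p \<le> q + 1" and z: "z \<in> conv_dom n p q w"
  shows "Lsum (coefF p q \<mu> \<nu> w) z = hypF n k p q \<mu> \<nu> w z"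
proof -
  let ?A = "coefF p q \<mu> \<nu> w" and ?P = "{lam. is_partition n lam}"
  let ?t = "\<lambda>lam. gpoch n k p \<mu> lam / gpoch n k q \<nu> lam *
      (jackC n k lam w * jackC n k lam z / (fact (absv n lam) * jackC n k lam one_vec))"
  have "p \<le> q \<or> supnorm n z * supnorm n w < 1" using z by (auto simp: conv_dom_def split: if_splits)
  then have "supnorm n z \<in> radii p q w" using supnorm_nonneg by (auto simp: radii_def)
  from conv_at_hyp[OF pq this coefF_bound] have "conv_at ?A (supnorm n z)" .
  from conv_at_has_sum[OF this supnorm_ge]
  have "((\<lambda>\<eta>. ?A \<eta> * L \<eta> z) has_sum Lsum ?A z) (multi_idx n)" .
  moreover have "bij_betw snd (Sigma ?P orbit) (multi_idx n)"
    by (rule bij_betw_byWitness[where f' = "\<lambda>\<eta>. (plus_part n \<eta>, \<eta>)"])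
      (auto simp: orbit_def plus_part_rnk(2))
  ultimately have "((\<lambda>p. ?A (snd p) * L (snd p) z) has_sum Lsum ?A z) (Sigma ?P orbit)"
    using has_sum_reindex_bij_betw[of snd "Sigma ?P orbit" "multi_idx n" "\<lambda>\<eta>. ?A \<eta> * L \<eta> z"] by simp
  moreover have "((\<lambda>\<eta>. ?A (snd (lam, \<eta>)) * L (snd (lam, \<eta>)) z) has_sum ?t lam) (orbit lam)" if "lam \<in> ?P" for lam
  proof -
    have s1: "(\<Sum>\<eta>\<in>orbit lam. ?A \<eta> * L \<eta> z)
      = (\<Sum>\<eta>\<in>orbit lam. gpoch_ratio p q \<mu> \<nu> lam / fact (absv n lam) * (jackC n k lam w / jackC n k lam one_vec) * L \<eta> z)"
    proof (intro sum.cong refl)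
      fix \<eta> assume e: "\<eta> \<in> orbit lam"
      then have "plus_part n \<eta> = lam" "absv n \<eta> = absv n lam" using orbit_subset[of lam] by (auto simp: orbit_def deg_idx_def)
      then show "?A \<eta> * L \<eta> z = gpoch_ratio p q \<mu> \<nu> lam / fact (absv n lam) * (jackC n k lam w / jackC n k lam one_vec) * L \<eta> z"
        by (simp add: coefF_def)
    qed
    have "(\<Sum>\<eta>\<in>orbit lam. L \<eta> z) = jackC n k lam z" by (simp only: jackC_eq)
    then have s2: "(\<Sum>\<eta>\<in>orbit lam. ?A \<eta> * L \<eta> z) = ?t lam"
      unfolding s1 sum_distrib_left[symmetric] gpoch_ratio_def by (simp add: ac_simps)
    show ?thesis unfolding snd_conv s2[symmetric] by (rule has_sum_finite[OF finite_orbit])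
  qed
  ultimately have "(?t has_sum Lsum ?A z) ?P" by (rule has_sum_SigmaD)
  then show ?thesis unfolding hypF_def by (rule infsumI[symmetric])
qed

end

theorem theorem6p10:
  fixes n :: nat and k :: real
  assumes "1 \<le> n" and "0 \<le> k"
  shows
   "(\<exists>a :: (nat \<Rightarrow> nat) \<Rightarrow> real.
       (\<forall>\<eta>\<in>multi_idx n.
          (if (\<forall>i<n. 1 \<le> \<eta> i)
           then dunkl_Delta n k (jackE n k \<eta>) = (\<lambda>x. of_real (a \<eta>) * jackE n k (minus_one \<eta>) x)
           else dunkl_Delta n k (jackE n k \<eta>) = (\<lambda>x. 0) \<and> a \<eta> = 0)) \<and>
       (\<forall>\<eta>\<in>multi_idx n. \<forall>\<sigma>. \<sigma> permutes {..<n} \<longrightarrow> a (\<eta> \<circ> \<sigma>) = a \<eta>))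
    \<and> (\<forall>\<eta>\<in>multi_idx n.
          dunkl_Delta n k (jackL n k \<eta>) = (\<lambda>x. d_coef n \<eta> * jackL n k (minus_one \<eta>) x))
    \<and> (\<forall>lam. is_partition n lam \<longrightarrow>
          dunkl_Delta n k (jackC n k lam) = (\<lambda>x. d_coef n lam * jackC n k (minus_one lam) x))
    \<and> (\<forall>p q (\<mu> :: nat \<Rightarrow> complex) (\<nu> :: nat \<Rightarrow> complex) (w :: nat \<Rightarrow> complex).
          p \<le> q + 1 \<longrightarrow>
          (\<forall>i<q. \<forall>j<n. \<forall>m::nat. \<nu> i \<noteq> of_real k * of_nat j - of_nat m) \<longrightarrow>
          (\<forall>z\<in>conv_dom n p q w.
             dunkl_Delta n k (hypK n k p q \<mu> \<nu> w) z =
               gpoch n k p \<mu> (\<lambda>_. 1) / gpoch n k q \<nu> (\<lambda>_. 1) * (\<Prod>i<n. w i) *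
               hypK n k p q (\<lambda>i. \<mu> i + 1) (\<lambda>i. \<nu> i + 1) w z) \<and>
          (\<forall>z\<in>conv_dom n p q w.
             dunkl_Delta n k (hypF n k p q \<mu> \<nu> w) z =
               gpoch n k p \<mu> (\<lambda>_. 1) / gpoch n k q \<nu> (\<lambda>_. 1) * (\<Prod>i<n. w i) *
               hypF n k p q (\<lambda>i. \<mu> i + 1) (\<lambda>i. \<nu> i + 1) w z))"
proof -
  interpret jack_setup n k by unfold_locales (use assms in auto)
  have "\<forall>\<eta>\<in>multi_idx n.
      (if (\<forall>i<n. 1 \<le> \<eta> i)
       then dunkl_Delta n k (jackE n k \<eta>) = (\<lambda>x. of_real (delta_eig \<eta>) * jackE n k (minus_one \<eta>) x)
       else dunkl_Delta n k (jackE n k \<eta>) = (\<lambda>x. 0) \<and> delta_eig \<eta> = 0)"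
  proof
    fix \<eta> assume \<eta>: "\<eta> \<in> multi_idx n"
    show "if (\<forall>i<n. 1 \<le> \<eta> i)
       then dunkl_Delta n k (jackE n k \<eta>) = (\<lambda>x. of_real (delta_eig \<eta>) * jackE n k (minus_one \<eta>) x)
       else dunkl_Delta n k (jackE n k \<eta>) = (\<lambda>x. 0) \<and> delta_eig \<eta> = 0"
    proof (cases "\<forall>i<n. 1 \<le> \<eta> i")
      case True
      show ?thesis unfolding if_P[OF True] by (rule dunkl_Delta_jackE[OF \<eta>])
    next
      case False
      then have "delta_eig \<eta> = 0" unfolding delta_eig_def by (rule if_not_P)
      then show ?thesis unfolding if_not_P[OF False] dunkl_Delta_jackE[OF \<eta>] by simp
    qed
  qed
  moreover have "\<forall>\<eta>\<in>multi_idx n. \<forall>\<sigma>. \<sigma> permutes {..<n} \<longrightarrow> delta_eig (\<eta> \<circ> \<sigma>) = delta_eig \<eta>"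
    using delta_eig_perm by blast
  ultimately have 1: "\<exists>a :: (nat \<Rightarrow> nat) \<Rightarrow> real.
       (\<forall>\<eta>\<in>multi_idx n.
          (if (\<forall>i<n. 1 \<le> \<eta> i)
           then dunkl_Delta n k (jackE n k \<eta>) = (\<lambda>x. of_real (a \<eta>) * jackE n k (minus_one \<eta>) x)
           else dunkl_Delta n k (jackE n k \<eta>) = (\<lambda>x. 0) \<and> a \<eta> = 0)) \<and>
       (\<forall>\<eta>\<in>multi_idx n. \<forall>\<sigma>. \<sigma> permutes {..<n} \<longrightarrow> a (\<eta> \<circ> \<sigma>) = a \<eta>)"
    by (intro exI[of _ delta_eig] conjI)
  have K: "dunkl_Delta n k (hypK n k p q \<mu> \<nu> w) z =
      gpoch n k p \<mu> (\<lambda>_. 1) / gpoch n k q \<nu> (\<lambda>_. 1) * (\<Prod>i<n. w i) *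
      hypK n k p q (\<lambda>i. \<mu> i + 1) (\<lambda>i. \<nu> i + 1) w z"
    if "p \<le> q + 1" "z \<in> conv_dom n p q w" for p q \<mu> \<nu> w z
    unfolding hypK_eq by (rule dunkl_Delta_hyp[OF that refl coefK_bound coefK_plus_one])
  have F: "dunkl_Delta n k (hypF n k p q \<mu> \<nu> w) z =
      gpoch n k p \<mu> (\<lambda>_. 1) / gpoch n k q \<nu> (\<lambda>_. 1) * (\<Prod>i<n. w i) *
      hypF n k p q (\<lambda>i. \<mu> i + 1) (\<lambda>i. \<nu> i + 1) w z"
    if pq: "p \<le> q + 1" and z: "z \<in> conv_dom n p q w" for p q \<mu> \<nu> w z
    using dunkl_Delta_hyp[OF pq z Lsum_coefF[OF pq, symmetric] coefF_bound coefF_plus_one]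
    unfolding Lsum_coefF[OF pq z] .
  show ?thesis using 1 dunkl_Delta_jackL dunkl_Delta_jackC K F by blast
qed

end
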